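(* For $s\in\mathbb Z_{\ge0}$, in the Grothendieck ring of representations of the upper Borel part $\mathfrak b_+$ of $U_q(C^{(2)}(2))$, $$[W_s(\lambda)]=f_s^{-1}\,[\rho_+(q_*^{\frac s2+\frac12}\lambda)][\rho_-(q_*^{-\frac s2-\frac12}\lambda)]-f_{-s-2}^{-1}\,\sigma^{s+1}[\rho_+(q_*^{-\frac s2-\frac12}\lambda)][\rho_-(q_*^{\frac s2+\frac12}\lambda)],$$ where $f_s:=\sum_{m=0}^\infty\sigma^m[U_{-s-2m}]=\frac{[U_{-s}]}{1-\sigma[U_{-2}]}$. In particular, for $s=0$ one obtains the $q$-Wronskian identity $$1=[W_0(\lambda)]=f_0^{-1}[\rho_+(q_*^{\frac12}\lambda)][\rho_-(q_*^{-\frac12}\lambda)]-f_{-2}^{-1}\sigma[\rho_+(q_*^{-\frac12}\lambda)][\rho_-(q_*^{\frac12}\lambda)].$$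
   Context: $q=e^{\pi ib^2}$, $q_*:=-iq=e^{\pi ib_*^2}$, $b^2=b_*^2+\frac12$; $[x]_{q_*}=\frac{q_*^x-q_*^{-x}}{q_*-q_*^{-1}}$. $\mathfrak b_+$ is generated by odd $\mathcal E_0,\mathcal E_1$ and even $\mathcal K_0,\mathcal K_1$ with $\mathcal K_i\mathcal E_j=q^{a_{ij}}\mathcal E_j\mathcal K_i$, $(a_{ij})=\begin{pmatrix}2&-2\\-2&2\end{pmatrix}$, and the Serre relations $\mathcal E_i^3\mathcal E_j+\{3\}_q\mathcal E_i^2\mathcal E_j\mathcal E_i-\{3\}_q\mathcal E_i\mathcal E_j\mathcal E_i^2-\mathcal E_j\mathcal E_i^3=0$ ($i\ne j$), $\{3\}_q=\frac{q^3+q^{-3}}{q+q^{-1}}$. Coproduct: $\Delta(\mathcal E_i)=\mathcal E_i\otimes\mathcal K_i+1\otimes\mathcal E_i$, $\Delta(\mathcal K_i)=\mathcal K_i\otimes\mathcal K_i$; tensor products are super. Representations: - Prefundamental ($q$-oscillator) representations $\rho_\pm(\lambda)$: let $\alpha_+,\alpha_-$ (odd) and $\mathcal H$ satisfy $q\alpha_+\alpha_-+q^{-1}\alpha_-\alpha_+=-\frac1{q+q^{-1}}$, $[\mathcal H,\alpha_\pm]=\pm2\alpha_\pm$, with Fock modules $\Pi_\pm=\mathrm{span}\{\alpha_\pm^k|0\rangle_\pm:\ \mathcal H|0\rangle_\pm=0,\ \alpha_\mp|0\rangle_\pm=0\}_{k\ge0}$, the vacuum vectors being even. $\rho_\pm(\lambda)$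 is given by $\mathcal E_1=\lambda\alpha_\pm$, $\mathcal E_0=\lambda\alpha_\mp$, $\mathcal K_1=q^{\pm\mathcal H}$, $\mathcal K_0=q^{\mp\mathcal H}$, acting on $\Pi_\mp$. - $W_s(\lambda)=W_s^+(\lambda)$, $s=2l$: the $(s+1)$-dimensional evaluation module with even highest weight vector; it has basis $v_m$, $m=-l,-l+1,\dots,l$, with $v_m$ of parity $l-m$ mod $2$, and $\mathcal E_1v_m=\lambda[l-m]_{q_*}v_{m+1}$, $\mathcal E_0v_m=\lambda[l+m]_{q_*}v_{m-1}$, $\mathcal K_1v_m=(-1)^{l-m}q_*^{2m}v_m$, $\mathcal K_0v_m=(-1)^{l-m}q_*^{-2m}v_m$. - $U_p=U_p^+$: one-dimensional with even generator, $\mathcal E_0,\mathcal E_1$ acting as $0$, $\mathcal K_1,\mathcal K_0$ acting as $q_*^p,q_*^{-p}$. $U_p^-$: one-dimensional with odd generator, $\mathcal E_i$ acting as $0$ and $\mathcal K_1,\mathcal K_0$ as $-q_*^p,-q_*^{-p}$, so that $U_m^{\epsilon_1}\otimes U_n^{\epsilon_2}\simeq U_{m+n}^{\epsilon_1\epsilon_2}$. The parity element is $\sigma:=[U_0^-]$; thus $\sigma^2=1$, $\sigma[U_p^\pm]=[U_p^\mp]$, and $[U_0]=1$.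
   Formalization: It is assumed that q is not a root of unity; otherwise σ[U_{-2}] has finite order, so 1-σ[U_{-2}] is a zero divisor and f_s is undefined. Representations are taken in category O, with f_s the class of the infinite direct sum. *)

theory Defs
  imports Complex_Main "HOL-Algebra.Free_Abelian_Groups" "HOL-Algebra.QuotRing"
begin

section \<open>Powers of \<open>q\<close> and \<open>q\<^sub>*\<close>\<close>

text \<open>\<open>qpow b x = q\<^sup>x\<close> for \<open>q = exp (\<pi> \<i> b\<^sup>2)\<close>, hence \<open>qpow b\<^sub>* x = q\<^sub>*\<^sup>x\<close>.
  This fixes the branch of the half-integral powers of \<open>q\<^sub>*\<close>.\<close>

definition qpow :: "complex \<Rightarrow> complex \<Rightarrow> complex" where
  "qpow b x = exp (of_real pi * \<i> * b\<^sup>2 * x)"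

lemma qpow_star:
  assumes "b\<^sup>2 = bs\<^sup>2 + 1 / 2"
  shows "qpow bs 1 = - \<i> * qpow b 1"
proof -
  have "qpow b 1 = exp (of_real pi * \<i> * bs\<^sup>2 + \<i> * of_real (pi / 2))"
    unfolding qpow_def assms by (simp add: algebra_simps)
  also have "\<dots> = qpow bs 1 * \<i>"
    unfolding exp_add cis_conv_exp[symmetric] by (simp add: qpow_def)
  finally show ?thesis by (simp add: mult.commute mult.left_commute)
qed

definition qnum :: "complex \<Rightarrow> complex \<Rightarrow> complex" where
  "qnum bs x = (qpow bs x - qpow bs (- x)) / (qpow bs 1 - qpow bs (- 1))"


section \<open>Weight supermodules over \<open>\<bb>\<^sub>+\<close>\<close>

text \<open>Vectors are finitely supported functions on a set of basis labels; a linear map is given by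
  the images of the basis vectors and extended by \<open>lin\<close>.\<close>

type_synonym vec = "nat \<Rightarrow>\<^sub>0 complex"

abbreviation bvec :: "nat \<Rightarrow> vec" where
  "bvec n \<equiv> Poly_Mapping.single n 1"

definition smul :: "complex \<Rightarrow> vec \<Rightarrow> vec" where
  "smul c v = Poly_Mapping.map ((*) c) v"

definition lin :: "(nat \<Rightarrow> vec) \<Rightarrow> vec \<Rightarrow> vec" where
  "lin f v = (\<Sum>n\<in>Poly_Mapping.keys v. smul (Poly_Mapping.lookup v n) (f n))"

datatype node = N0 | N1

text \<open>A module is presented in a basis of parity-homogeneous joint eigenvectors of
  \<open>\<K>\<^sub>0\<close> and \<open>\<K>\<^sub>1\<close>, with eigenvalues \<open>Kev\<close>. As the objects of category \<open>\<O>\<close> below are direct sums of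
  weight spaces and have countable dimension, each of them is isomorphic to one of this form with
  labels in \<^typ>\<open>nat\<close>. In \<open>odd_vec\<close>, \<^const>\<open>True\<close> is the odd parity.\<close>

record bmodule =
  basis :: "nat set"
  odd_vec :: "nat \<Rightarrow> bool"
  Eact :: "node \<Rightarrow> nat \<Rightarrow> vec"
  Kev :: "node \<Rightarrow> nat \<Rightarrow> complex"

definition vspace :: "bmodule \<Rightarrow> vec set" where
  "vspace M = {v. Poly_Mapping.keys v \<subseteq> basis M}"

definition Eop :: "bmodule \<Rightarrow> node \<Rightarrow> vec \<Rightarrow> vec" where
  "Eop M i = lin (Eact M i)"

definition Kop :: "bmodule \<Rightarrow> node \<Rightarrow> vec \<Rightarrow> vec" where
  "Kop M i = lin (\<lambda>n. smul (Kev M i n) (bvec n))"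

definition cartan :: "node \<Rightarrow> node \<Rightarrow> int" where
  "cartan i j = (if i = j then 2 else - 2)"

definition qthree :: "complex \<Rightarrow> complex" where
  "qthree q = (q ^ 3 + inverse q ^ 3) / (q + inverse q)"

text \<open>The generators \<open>\<K>\<^sub>i\<close> are invertible; they commute because they are
  simultaneously diagonal.\<close>

definition is_bmodule :: "complex \<Rightarrow> bmodule \<Rightarrow> bool" where
  "is_bmodule q M \<longleftrightarrow>
     (\<forall>i. \<forall>n\<in>basis M. Eact M i n \<in> vspace M \<and>
        (\<forall>k\<in>Poly_Mapping.keys (Eact M i n). odd_vec M k \<longleftrightarrow> \<not> odd_vec M n)) \<and>
     (\<forall>i. \<forall>n\<in>basis M. Kev M i n \<noteq> 0) \<and>
     (\<forall>i j. \<forall>v\<in>vspace M.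
        Kop M i (Eop M j v) = smul (q powi cartan i j) (Eop M j (Kop M i v))) \<and>
     (\<forall>i j. i \<noteq> j \<longrightarrow> (\<forall>v\<in>vspace M.
        (let A = Eop M i; B = Eop M j in
         A (A (A (B v))) + smul (qthree q) (A (A (B (A v))))
         - smul (qthree q) (A (B (A (A v)))) - B (A (A (A v))) = 0)))"

text \<open>Category \<open>\<O>\<close>: finite-dimensional weight spaces, and all weights
  \<open>(\<K>\<^sub>0, \<K>\<^sub>1)\<close> in a finite union of cones; \<open>\<E>\<^sub>0\<close> lowers the weight.\<close>

definition in_O :: "complex \<Rightarrow> bmodule \<Rightarrow> bool" where
  "in_O q M \<longleftrightarrow> is_bmodule q M \<and>
     (\<forall>a0 a1. finite {n\<in>basis M. Kev M N0 n = a0 \<and> Kev M N1 n = a1}) \<and>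
     (\<exists>S. finite S \<and> (\<forall>n\<in>basis M. \<exists>(a0, a1)\<in>S. \<exists>k::nat.
        Kev M N0 n = a0 * q ^ (2 * k) \<and> Kev M N1 n = a1 * inverse q ^ (2 * k)))"

text \<open>Morphisms are even.\<close>

definition bhom :: "bmodule \<Rightarrow> bmodule \<Rightarrow> (nat \<Rightarrow> vec) set" where
  "bhom L M = {f.
     (\<forall>n\<in>basis L. f n \<in> vspace M \<and>
        (\<forall>k\<in>Poly_Mapping.keys (f n). odd_vec M k \<longleftrightarrow> odd_vec L n)) \<and>
     (\<forall>i. \<forall>v\<in>vspace L. lin f (Eop L i v) = Eop M i (lin f v) \<and>
        lin f (Kop L i v) = Kop M i (lin f v))}"

definition short_exact :: "bmodule \<Rightarrow> bmodule \<Rightarrow> bmodule \<Rightarrow> bool" where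
  "short_exact L M N \<longleftrightarrow> (\<exists>f\<in>bhom L M. \<exists>g\<in>bhom M N.
     inj_on (lin f) (vspace L) \<and>
     lin f ` vspace L = {v\<in>vspace M. lin g v = 0} \<and>
     lin g ` vspace M = vspace N)"

text \<open>Super tensor product along \<open>\<Delta>(\<E>\<^sub>i) = \<E>\<^sub>i \<otimes> \<K>\<^sub>i + 1 \<otimes> \<E>\<^sub>i\<close>, \<open>\<Delta>(\<K>\<^sub>i) = \<K>\<^sub>i \<otimes> \<K>\<^sub>i\<close>;
  the odd \<open>\<E>\<^sub>i\<close> passing an odd vector in the left factor gives a sign.\<close>

definition tvec :: "vec \<Rightarrow> vec \<Rightarrow> vec" where
  "tvec v w = lin (\<lambda>k. lin (\<lambda>l. bvec (prod_encode (k, l))) w) v"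

definition tensor :: "bmodule \<Rightarrow> bmodule \<Rightarrow> bmodule" where
  "tensor M N = \<lparr>
     basis = prod_encode ` (basis M \<times> basis N),
     odd_vec = (\<lambda>n. case prod_decode n of (k, l) \<Rightarrow> odd_vec M k \<noteq> odd_vec N l),
     Eact = (\<lambda>i n. case prod_decode n of (k, l) \<Rightarrow>
        tvec (Eact M i k) (smul (Kev N i l) (bvec l)) +
        smul (if odd_vec M k then - 1 else 1) (tvec (bvec k) (Eact N i l))),
     Kev = (\<lambda>i n. case prod_decode n of (k, l) \<Rightarrow> Kev M i k * Kev N i l)\<rparr>"

definition direct_sum :: "(nat \<Rightarrow> bmodule) \<Rightarrow> bmodule" where
  "direct_sum M = \<lparr>
     basis = {prod_encode (m, k) | m k. k \<in> basis (M m)},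
     odd_vec = (\<lambda>n. case prod_decode n of (m, k) \<Rightarrow> odd_vec (M m) k),
     Eact = (\<lambda>i n. case prod_decode n of (m, k) \<Rightarrow>
        lin (\<lambda>l. bvec (prod_encode (m, l))) (Eact (M m) i k)),
     Kev = (\<lambda>i n. case prod_decode n of (m, k) \<Rightarrow> Kev (M m) i k)\<rparr>"


section \<open>The representations\<close>

text \<open>On the Fock modules \<open>\<Pi>\<^sub>\<plusminus>\<close> the label \<open>k\<close> stands for \<open>\<alpha>\<^sub>\<plusminus>\<^sup>k|0\<rangle>\<^sub>\<plusminus>\<close>, so
  \<open>\<H>\<close> has eigenvalue \<open>\<plusminus>2k\<close>, and \<open>\<alpha>\<^sub>\<mp> \<alpha>\<^sub>\<plusminus>\<^sup>k|0\<rangle>\<^sub>\<plusminus> = osc r k \<cdot> \<alpha>\<^sub>\<plusminus>\<^sup>k\<^sup>-\<^sup>1|0\<rangle>\<^sub>\<plusminus>\<close> with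
  \<open>r = q\<close> on \<open>\<Pi>\<^sub>+\<close> and \<open>r = q\<^sup>-\<^sup>1\<close> on \<open>\<Pi>\<^sub>-\<close>: the recursion is the oscillator relation
  \<open>r\<^sup>-\<^sup>1 \<alpha>\<^sub>\<mp> \<alpha>\<^sub>\<plusminus> + r \<alpha>\<^sub>\<plusminus> \<alpha>\<^sub>\<mp> = -1/(r + r\<^sup>-\<^sup>1)\<close>.\<close>

primrec osc :: "complex \<Rightarrow> nat \<Rightarrow> complex" where
  "osc r 0 = 0"
| "osc r (Suc k) = r * (- 1 / (r + inverse r) - r * osc r k)"

definition create :: "nat \<Rightarrow> vec" where
  "create k = bvec (Suc k)"

definition annihilate :: "complex \<Rightarrow> nat \<Rightarrow> vec" where
  "annihilate r k = smul (osc r k) (bvec (k - 1))"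

lemma smul_simps [simp]:
  "smul c (Poly_Mapping.single n a) = Poly_Mapping.single n (c * a)"
  "smul c 0 = 0" "smul 0 v = 0" "smul 1 v = v" "smul c (smul d v) = smul (c * d) v"
  by (rule poly_mapping_eqI; simp add: smul_def Poly_Mapping.map.rep_eq
      Poly_Mapping.lookup_single when_def mult.assoc)+

lemma lin_zero [simp]: "lin f 0 = 0"
  by (simp add: lin_def)

lemma lin_single [simp]: "lin f (Poly_Mapping.single n a) = smul a (f n)"
  by (cases "a = 0") (simp_all add: lin_def)

lemma oscillator_relation:
  assumes "q \<noteq> 0"
  shows "smul q (lin create (annihilate q k)) +
           smul (inverse q) (lin (annihilate q) (create k)) =
         smul (- 1 / (q + inverse q)) (bvec k)"
    and "smul q (lin (annihilate (inverse q)) (create k)) +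
           smul (inverse q) (lin create (annihilate (inverse q) k)) =
         smul (- 1 / (q + inverse q)) (bvec k)"
proof -
  have *: "r * osc r k + inverse r * osc r (Suc k) = - 1 / (r + inverse r)"
    if "r \<noteq> 0" for r
    using that by (simp add: ring_distribs flip: mult.assoc)
  have lower: "smul c (lin create (annihilate r k)) = smul (c * osc r k) (bvec k)" for c r
    by (cases k) (simp_all add: create_def annihilate_def)
  have raise: "smul c (lin (annihilate r) (create k)) = smul (c * osc r (Suc k)) (bvec k)" for c r
    by (simp add: create_def annihilate_def del: osc.simps)
  show "smul q (lin create (annihilate q k)) +
           smul (inverse q) (lin (annihilate q) (create k)) =
         smul (- 1 / (q + inverse q)) (bvec k)"
    using *[OF assms] unfolding lower raise by (simp flip: Poly_Mapping.single_add del: osc.simps)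
  show "smul q (lin (annihilate (inverse q)) (create k)) +
           smul (inverse q) (lin create (annihilate (inverse q) k)) =
         smul (- 1 / (q + inverse q)) (bvec k)"
    using *[of "inverse q"] assms unfolding lower raise
    by (simp add: add.commute flip: Poly_Mapping.single_add del: osc.simps)
qed

text \<open>\<open>\<rho>\<^sub>+(\<mu>)\<close> acts on \<open>\<Pi>\<^sub>-\<close>, where \<open>\<alpha>\<^sub>+\<close> annihilates, and \<open>\<rho>\<^sub>-(\<mu>)\<close> acts on \<open>\<Pi>\<^sub>+\<close>.
  In both cases \<open>q\<^bsup>\<plusminus>\<H>\<^esup>\<close> has eigenvalue \<open>q\<^bsup>-2k\<^esup>\<close>.\<close>

definition rho_plus :: "complex \<Rightarrow> complex \<Rightarrow> bmodule" where
  "rho_plus b \<mu> = \<lparr>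
     basis = UNIV, odd_vec = odd,
     Eact = (\<lambda>i k. case i of
        N1 \<Rightarrow> smul \<mu> (annihilate (qpow b (- 1)) k) | N0 \<Rightarrow> smul \<mu> (create k)),
     Kev = (\<lambda>i k. case i of N1 \<Rightarrow> qpow b (- 2 * of_nat k) | N0 \<Rightarrow> qpow b (2 * of_nat k))\<rparr>"

definition rho_minus :: "complex \<Rightarrow> complex \<Rightarrow> bmodule" where
  "rho_minus b \<mu> = \<lparr>
     basis = UNIV, odd_vec = odd,
     Eact = (\<lambda>i k. case i of
        N1 \<Rightarrow> smul \<mu> (annihilate (qpow b 1) k) | N0 \<Rightarrow> smul \<mu> (create k)),
     Kev = (\<lambda>i k. case i of N1 \<Rightarrow> qpow b (- 2 * of_nat k) | N0 \<Rightarrow> qpow b (2 * of_nat k))\<rparr>"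

text \<open>The label \<open>k = l - m\<close> stands for \<open>v\<^sub>m\<close>, where \<open>s = 2l\<close>; so \<open>l + m = s - k\<close>, \<open>2m = s - 2k\<close>.
  The coefficients vanish at the two ends of the basis.\<close>

definition W_mod :: "complex \<Rightarrow> nat \<Rightarrow> complex \<Rightarrow> bmodule" where
  "W_mod bs s \<mu> = \<lparr>
     basis = {0..s}, odd_vec = odd,
     Eact = (\<lambda>i k. case i of
        N1 \<Rightarrow> smul (\<mu> * qnum bs (of_nat k)) (bvec (k - 1))
      | N0 \<Rightarrow> smul (\<mu> * qnum bs (of_nat s - of_nat k)) (bvec (Suc k))),
     Kev = (\<lambda>i k. case i of
        N1 \<Rightarrow> (- 1) ^ k * qpow bs (of_nat s - 2 * of_nat k)
      | N0 \<Rightarrow> (- 1) ^ k * qpow bs (- (of_nat s - 2 * of_nat k)))\<rparr>"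

text \<open>\<open>U_mod bs False p\<close> is \<open>U\<^sub>p\<^sup>+\<close> and \<open>U_mod bs True p\<close> is \<open>U\<^sub>p\<^sup>-\<close>.\<close>

definition U_mod :: "complex \<Rightarrow> bool \<Rightarrow> int \<Rightarrow> bmodule" where
  "U_mod bs odd_gen p = \<lparr>
     basis = {0}, odd_vec = (\<lambda>_. odd_gen),
     Eact = (\<lambda>i k. 0),
     Kev = (\<lambda>i k. (if odd_gen then - 1 else 1) *
        (case i of N1 \<Rightarrow> qpow bs (of_int p) | N0 \<Rightarrow> qpow bs (- of_int p)))\<rparr>"


section \<open>The Grothendieck ring\<close>

text \<open>\<open>free_ring b\<close> is the free abelian group on the objects of \<open>\<O>\<close> with the tensor product
  extended biadditively. It becomes associative and unital only modulo the relations
  \<open>[M] = [L] + [N]\<close> for short exact sequences \<open>0 \<rightarrow> L \<rightarrow> M \<rightarrow> N \<rightarrow> 0\<close> (which identify isomorphic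
  objects), that is, in the quotient \<open>groth b\<close>.\<close>

definition objects :: "complex \<Rightarrow> bmodule set" where
  "objects b = {M. in_O (qpow b 1) M}"

definition free_ring :: "complex \<Rightarrow> (bmodule \<Rightarrow>\<^sub>0 int) ring" where
  "free_ring b = \<lparr>
     carrier = carrier (free_Abelian_group (objects b)),
     mult = (\<lambda>x y. frag_extend (\<lambda>M. frag_extend (\<lambda>N. frag_of (tensor M N)) y) x),
     one = frag_of (U_mod b False 0),
     zero = 0,
     add = (+)\<rparr>"

definition ses_relations :: "complex \<Rightarrow> (bmodule \<Rightarrow>\<^sub>0 int) set" where
  "ses_relations b = generate (free_Abelian_group (objects b))
     {frag_of M - frag_of L - frag_of N | L M N.
        L \<in> objects b \<and> M \<in> objects b \<and> N \<in> objects b \<and> short_exact L M N}"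

definition groth :: "complex \<Rightarrow> (bmodule \<Rightarrow>\<^sub>0 int) set ring" where
  "groth b = free_ring b Quot ses_relations b"

definition cls :: "complex \<Rightarrow> bmodule \<Rightarrow> (bmodule \<Rightarrow>\<^sub>0 int) set" where
  "cls b M = ses_relations b +>\<^bsub>free_ring b\<^esub> frag_of M"

definition sigma :: "complex \<Rightarrow> complex \<Rightarrow> (bmodule \<Rightarrow>\<^sub>0 int) set" where
  "sigma b bs = cls b (U_mod bs True 0)"

text \<open>The infinite sum \<open>f\<^sub>p = \<Sum>\<^sub>m \<sigma>\<^sup>m [U\<^bsub>-p-2m\<^esub>]\<close> is the class of the direct sum
  of the modules representing its terms, \<open>\<sigma>\<^sup>m [U\<^bsub>-p-2m\<^esub>]\<close> being the class of
  \<open>U\<^bsub>-p-2m\<^esub>\<close> with sign \<open>(-1)\<^sup>m\<close>.\<close>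

definition f_series :: "complex \<Rightarrow> complex \<Rightarrow> int \<Rightarrow> (bmodule \<Rightarrow>\<^sub>0 int) set" where
  "f_series b bs p = cls b (direct_sum (\<lambda>m. U_mod bs (odd m) (- p - 2 * int m)))"

end

(* Write T(mu) for rho_+(q_*^mu lambda) (x) rho_-(q_*^(-mu) lambda), mu = (s+1)/2, and X, Y for the two summands
   of E_0 on T(mu). Then XY = q_*^2 YX, and the vectors E_0^j (|m> (x) |0>) form a basis in which E_1 does not
   raise m. The m-th layer of the resulting filtration is U_{-s-2m} (with parity (-1)^m) tensored
   with a Verma type module V_s, so that [T(mu)] = f_s [V_s]. For integral s >= 0, V_s contains
   sigma^(s+1) V_{-s-2} with quotient W_s.

   The filtration is infinite, while the Grothendieck group has only relations from short exact sequences. An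
   Eilenberg swindle bridges this: if every weight space of M lies in some step of M_0 < M_1 < ..., then
   the direct sum P of all M/M_k is in category O, and comparing P with its shift gives [M] = [gr M]. *)

theory Submission
  imports Defs
begin

section \<open>Linear maps and modules on basis vectors\<close>

text \<open>The computation rests on the two summands C and D of E_1. Up to a scalar, C and D
  commute with the whole of E_0 = X + Y by factors q_*^-2 and q_*^2, since each meets the oscillator
  relation in only one of X, Y. On |m> (x) |0>, D vanishes and C lowers m, so pushing them through
  E_0^j leaves two geometric sums inside layer m. They combine to [j][s-j+1] when the two spectral
  shifts have squares q_*^(s+1) and q_*^(-s-1); this is the origin of mu = (s+1)/2. The basis is
  built from E_0 stripped of lambda, so lambda = 0 is covered too. Two obstacles shape the rest. The
  Serre relations are quartic, but on a module with a single ladder of weights they become a linear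
  recurrence with roots 1, -q^2, -q^-2; for the new basis of T(mu) they are pulled back along the
  change of basis. And the free group with the extended tensor product is not a ring, so the ring
  laws are checked modulo the relations; commutativity is not established, so sigma is moved past f
  by an explicit isomorphism.\<close>

lemma lookup_smul [simp]: "Poly_Mapping.lookup (smul c v) n = c * Poly_Mapping.lookup v n"
  by (simp add: smul_def Poly_Mapping.map.rep_eq when_def)

lemma smul_add: "smul c (v + w) = smul c v + smul c w"
  by (rule poly_mapping_eqI) (simp add: lookup_add algebra_simps)

lemma smul_diff: "smul c (v - w) = smul c v - smul c w"
  by (rule poly_mapping_eqI) (simp add: lookup_minus algebra_simps)

lemma smul_left_add: "smul (c + d) v = smul c v + smul d v"
  by (rule poly_mapping_eqI) (simp add: lookup_add algebra_simps)

lemma smul_sum: "smul c (sum g A) = (\<Sum>a\<in>A. smul c (g a))"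
  by (induction A rule: infinite_finite_induct) (simp_all add: smul_add)

lemma keys_smul: "Poly_Mapping.keys (smul c v) \<subseteq> Poly_Mapping.keys v"
  by (auto simp: in_keys_iff)

lemma lin_superset:
  assumes "finite A" "Poly_Mapping.keys v \<subseteq> A"
  shows "lin f v = (\<Sum>n\<in>A. smul (Poly_Mapping.lookup v n) (f n))"
  unfolding lin_def using assms
  by (intro sum.mono_neutral_left) (auto simp: in_keys_iff)

lemma lin_add: "lin f (v + w) = lin f v + lin f w"
proof -
  let ?A = "Poly_Mapping.keys v \<union> Poly_Mapping.keys w"
  have "Poly_Mapping.keys (v + w) \<subseteq> ?A"
    by (rule Poly_Mapping.keys_add)
  then show ?thesis
    by (simp add: lin_superset[of ?A] lookup_add smul_left_add sum.distrib)
qed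

lemma lin_smul: "lin f (smul c v) = smul c (lin f v)"
  by (simp add: lin_superset[OF _ keys_smul, of v] smul_sum)
     (simp add: lin_def smul_sum)

lemma lin_diff: "lin f (v - w) = lin f v - lin f w"
  using lin_add[of f "v - w" w] by (simp add: algebra_simps)

lemma lin_sum: "lin f (sum g A) = (\<Sum>a\<in>A. lin f (g a))"
  by (induction A rule: infinite_finite_induct) (simp_all add: lin_add)

lemma lin_cong: "(\<And>n. n \<in> Poly_Mapping.keys v \<Longrightarrow> f n = g n) \<Longrightarrow> lin f v = lin g v"
  unfolding lin_def by (rule sum.cong) auto

lemma lin_fun_zero [simp]: "lin (\<lambda>_. 0) v = 0"
  by (simp add: lin_def)

lemma lin_fun_add: "lin (\<lambda>n. f n + g n) v = lin f v + lin g v"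
  by (simp add: lin_def smul_add sum.distrib)

lemma lin_fun_diff: "lin (\<lambda>n. f n - g n) v = lin f v - lin g v"
  by (simp add: lin_def smul_diff sum_subtractf)

lemma lin_fun_smul: "lin (\<lambda>n. smul c (f n)) v = smul c (lin f v)"
  by (simp add: lin_def smul_sum mult.commute)

lemma lin_lin: "lin f (lin g v) = lin (\<lambda>n. lin f (g n)) v"
  by (subst (2) lin_def) (simp add: lin_sum lin_smul, simp add: lin_def)

lemma lookup_lin:
  "Poly_Mapping.lookup (lin f v) m =
     (\<Sum>n\<in>Poly_Mapping.keys v. Poly_Mapping.lookup v n * Poly_Mapping.lookup (f n) m)"
  by (simp add: lin_def lookup_sum)

lemma lin_bvec [simp]: "lin bvec v = v"
proof (rule poly_mapping_eqI)
  fix k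
  have "Poly_Mapping.lookup (lin bvec v) k =
    (\<Sum>n\<in>Poly_Mapping.keys v. if n = k then Poly_Mapping.lookup v n else 0)"
    unfolding lookup_lin by (rule sum.cong) (auto simp: lookup_single)
  also have "\<dots> = Poly_Mapping.lookup v k"
    by (simp add: in_keys_iff)
  finally show "Poly_Mapping.lookup (lin bvec v) k = Poly_Mapping.lookup v k" .
qed

lemma keys_lin: "Poly_Mapping.keys (lin f v) \<subseteq> (\<Union>n\<in>Poly_Mapping.keys v. Poly_Mapping.keys (f n))"
proof
  fix m assume "m \<in> Poly_Mapping.keys (lin f v)"
  then have "(\<Sum>n\<in>Poly_Mapping.keys v. Poly_Mapping.lookup v n * Poly_Mapping.lookup (f n) m) \<noteq> 0"
    by (simp add: in_keys_iff lookup_lin)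
  then obtain n where "n \<in> Poly_Mapping.keys v" "Poly_Mapping.lookup (f n) m \<noteq> 0"
    by (metis (no_types, lifting) mult_zero_right sum.neutral)
  then show "m \<in> (\<Union>n\<in>Poly_Mapping.keys v. Poly_Mapping.keys (f n))"
    by (auto simp: in_keys_iff)
qed

lemma lin_eq_on_vspace:
  assumes "v \<in> vspace M" "\<And>n. n \<in> basis M \<Longrightarrow> f n = g n"
  shows "lin f v = lin g v"
  using assms by (intro lin_cong) (auto simp: vspace_def)

lemma vspace_bvec [simp]: "bvec n \<in> vspace M \<longleftrightarrow> n \<in> basis M"
  by (simp add: vspace_def)

lemma vspace_zero [simp]: "0 \<in> vspace M"
  by (simp add: vspace_def)

lemma vspace_smul: "v \<in> vspace M \<Longrightarrow> smul c v \<in> vspace M"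
  using keys_smul unfolding vspace_def by blast

lemma vspace_add: "v \<in> vspace M \<Longrightarrow> w \<in> vspace M \<Longrightarrow> v + w \<in> vspace M"
  using Poly_Mapping.keys_add[of v w] unfolding vspace_def by blast

lemma vspace_diff: "v \<in> vspace M \<Longrightarrow> w \<in> vspace M \<Longrightarrow> v - w \<in> vspace M"
  using keys_diff[of v w] unfolding vspace_def by blast

lemma vspace_lin:
  assumes "v \<in> vspace L" "\<And>n. n \<in> basis L \<Longrightarrow> f n \<in> vspace M"
  shows "lin f v \<in> vspace M"
  using assms keys_lin[of f v] unfolding vspace_def by blast

lemma Eop_bvec [simp]: "Eop M i (bvec n) = Eact M i n"
  by (simp add: Eop_def)

lemma lookup_Kop [simp]:
  "Poly_Mapping.lookup (Kop M i v) k = Kev M i k * Poly_Mapping.lookup v k"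
proof -
  have "Poly_Mapping.lookup (Kop M i v) k =
    (\<Sum>n\<in>Poly_Mapping.keys v. if n = k then Kev M i k * Poly_Mapping.lookup v n else 0)"
    unfolding Kop_def lookup_lin by (rule sum.cong) (auto simp: lookup_single)
  also have "\<dots> = Kev M i k * Poly_Mapping.lookup v k"
    by (simp add: in_keys_iff)
  finally show ?thesis .
qed

lemma Kop_bvec [simp]: "Kop M i (bvec n) = smul (Kev M i n) (bvec n)"
  by (simp add: Kop_def)

lemma Kop_eq_smul_iff:
  "Kop M i v = smul c v \<longleftrightarrow> (\<forall>k\<in>Poly_Mapping.keys v. Kev M i k = c)"
  by (auto simp: poly_mapping_eq_iff fun_eq_iff in_keys_iff)

section \<open>Module and morphism axioms on basis vectors\<close>

definition serre :: "complex \<Rightarrow> (vec \<Rightarrow> vec) \<Rightarrow> (vec \<Rightarrow> vec) \<Rightarrow> vec \<Rightarrow> vec" where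
  "serre c A B v = A (A (A (B v))) + smul c (A (A (B (A v)))) - smul c (A (B (A (A v)))) - B (A (A (A v)))"

lemma serre_lin:
  "serre c (lin f) (lin g) v = lin (\<lambda>n. serre c (lin f) (lin g) (bvec n)) v"
  by (simp add: serre_def lin_lin lin_fun_add lin_fun_diff lin_fun_smul)

text \<open>Every axiom is an equality of linear maps, so basis vectors suffice. As
  \<open>Kop\<close> is diagonal, its commutation with \<open>Eop\<close> becomes a shift of
  eigenvalues, and only the Serre relation remains a genuine computation.\<close>

lemma is_bmodule_iff:
  "is_bmodule q M \<longleftrightarrow>
     (\<forall>i. \<forall>n\<in>basis M. Eact M i n \<in> vspace M) \<and>
     (\<forall>i. \<forall>n\<in>basis M. \<forall>k\<in>Poly_Mapping.keys (Eact M i n). odd_vec M k \<longleftrightarrow> \<not> odd_vec M n) \<and>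
     (\<forall>i. \<forall>n\<in>basis M. Kev M i n \<noteq> 0) \<and>
     (\<forall>i j. \<forall>n\<in>basis M. \<forall>k\<in>Poly_Mapping.keys (Eact M j n). Kev M i k = q powi cartan i j * Kev M i n) \<and>
     (\<forall>i j. i \<noteq> j \<longrightarrow> (\<forall>n\<in>basis M. serre (qthree q) (Eop M i) (Eop M j) (bvec n) = 0))"
proof -
  have 1: "(\<forall>v\<in>vspace M. Kop M i (Eop M j v) = smul (q powi cartan i j) (Eop M j (Kop M i v))) \<longleftrightarrow>
     (\<forall>n\<in>basis M. \<forall>k\<in>Poly_Mapping.keys (Eact M j n). Kev M i k = q powi cartan i j * Kev M i n)"
     (is "?L \<longleftrightarrow> ?R") for i j
  proof
    assume ?L
    then have "Kop M i (Eact M j n) = smul (q powi cartan i j * Kev M i n) (Eact M j n)"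
      if "n \<in> basis M" for n
      using that bspec[OF \<open>?L\<close>, of "bvec n"] by (simp add: lin_smul Eop_def)
    then show ?R unfolding Kop_eq_smul_iff by blast
  next
    assume ?R
    then have *: "Kop M i (Eact M j n) = smul (q powi cartan i j * Kev M i n) (Eact M j n)"
      if "n \<in> basis M" for n
      using that unfolding Kop_eq_smul_iff by blast
    show ?L
    proof
      fix v assume v: "v \<in> vspace M"
      have "Kop M i (Eop M j v) = lin (\<lambda>n. Kop M i (Eact M j n)) v"
        by (simp add: Kop_def Eop_def lin_lin)
      also have "\<dots> = lin (\<lambda>n. smul (q powi cartan i j * Kev M i n) (Eact M j n)) v"
        by (rule lin_eq_on_vspace[OF v]) (rule *)
      also have "\<dots> = smul (q powi cartan i j) (Eop M j (Kop M i v))"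
        by (simp add: Kop_def Eop_def lin_lin lin_smul flip: lin_fun_smul)
      finally show "Kop M i (Eop M j v) = smul (q powi cartan i j) (Eop M j (Kop M i v))" .
    qed
  qed
  have 2: "(\<forall>v\<in>vspace M. serre c (Eop M i) (Eop M j) v = 0) \<longleftrightarrow>
     (\<forall>n\<in>basis M. serre c (Eop M i) (Eop M j) (bvec n) = 0)" (is "?L \<longleftrightarrow> ?R") for c i j
  proof
    assume R: ?R
    have "serre c (Eop M i) (Eop M j) v = lin (\<lambda>_. 0) v" if "v \<in> vspace M" for v
      using R unfolding Eop_def serre_lin[of _ _ _ v] by (intro lin_eq_on_vspace[OF that]) auto
    then show ?L by simp
  qed auto
  show ?thesis
    unfolding is_bmodule_def Let_def serre_def[symmetric] 1 2 by blast
qed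

lemma serre_zero:
  assumes "is_bmodule q M" "i \<noteq> j" "v \<in> vspace M"
  shows "serre (qthree q) (Eop M i) (Eop M j) v = 0"
  using assms unfolding is_bmodule_def Let_def serre_def[symmetric] by blast

lemma Eop_vspace: "is_bmodule q M \<Longrightarrow> v \<in> vspace M \<Longrightarrow> Eop M i v \<in> vspace M"
  unfolding Eop_def is_bmodule_iff by (rule vspace_lin) auto

lemma bhom_iff:
  "f \<in> bhom L M \<longleftrightarrow>
     (\<forall>n\<in>basis L. f n \<in> vspace M) \<and>
     (\<forall>n\<in>basis L. \<forall>k\<in>Poly_Mapping.keys (f n). odd_vec M k = odd_vec L n) \<and>
     (\<forall>i. \<forall>n\<in>basis L. \<forall>k\<in>Poly_Mapping.keys (f n). Kev M i k = Kev L i n) \<and>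
     (\<forall>i. \<forall>n\<in>basis L. lin f (Eact L i n) = Eop M i (f n))"
proof -
  have 1: "(\<forall>v\<in>vspace L. lin f (Eop L i v) = Eop M i (lin f v)) \<longleftrightarrow>
      (\<forall>n\<in>basis L. lin f (Eact L i n) = Eop M i (f n))" (is "?L \<longleftrightarrow> ?R") for i
  proof
    assume ?L
    then show ?R by (metis Eop_bvec lin_single smul_simps(4) vspace_bvec)
  next
    assume R: ?R
    then show ?L unfolding Eop_def lin_lin
      by (auto intro!: lin_eq_on_vspace)
  qed
  have 2: "(\<forall>v\<in>vspace L. lin f (Kop L i v) = Kop M i (lin f v)) \<longleftrightarrow>
      (\<forall>n\<in>basis L. \<forall>k\<in>Poly_Mapping.keys (f n). Kev M i k = Kev L i n)" (is "?L \<longleftrightarrow> ?R") for i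
  proof
    assume L: ?L
    have "Kop M i (f n) = smul (Kev L i n) (f n)" if "n \<in> basis L" for n
      using that bspec[OF L, of "bvec n"] by simp
    then show ?R unfolding Kop_eq_smul_iff by blast
  next
    assume ?R
    then have "Kop M i (f n) = smul (Kev L i n) (f n)" if "n \<in> basis L" for n
      using that unfolding Kop_eq_smul_iff by blast
    then show ?L unfolding Kop_def lin_lin
      by (auto intro!: lin_eq_on_vspace)
  qed
  show ?thesis unfolding bhom_def using 1 2 by blast
qed

section \<open>Tensor products in category \<open>\<O>\<close>\<close>

lemma vec_eqI_prod:
  assumes "\<And>k l. Poly_Mapping.lookup v (prod_encode (k, l)) = Poly_Mapping.lookup w (prod_encode (k, l))"
  shows "v = w"
proof (rule poly_mapping_eqI)
  fix n show "Poly_Mapping.lookup v n = Poly_Mapping.lookup w n"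
    using assms[of "fst (prod_decode n)" "snd (prod_decode n)"] by simp
qed

lemma lookup_tvec [simp]:
  "Poly_Mapping.lookup (tvec v w) (prod_encode (k, l)) = Poly_Mapping.lookup v k * Poly_Mapping.lookup w l"
proof -
  have "Poly_Mapping.lookup (lin (\<lambda>l. bvec (prod_encode (k', l))) w) (prod_encode (k, l)) =
    (if k' = k then Poly_Mapping.lookup w l else 0)" for k'
  proof -
    have "Poly_Mapping.lookup (lin (\<lambda>l. bvec (prod_encode (k', l))) w) (prod_encode (k, l)) =
      (\<Sum>l'\<in>Poly_Mapping.keys w. if l' = l then (if k' = k then Poly_Mapping.lookup w l else 0) else 0)"
      unfolding lookup_lin by (rule sum.cong) (auto simp: lookup_single)
    then show ?thesis by (simp add: in_keys_iff)
  qed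
  then have "Poly_Mapping.lookup (tvec v w) (prod_encode (k, l)) =
     (\<Sum>k'\<in>Poly_Mapping.keys v. if k' = k then Poly_Mapping.lookup v k * Poly_Mapping.lookup w l else 0)"
    unfolding tvec_def lookup_lin by (intro sum.cong) auto
  then show ?thesis by (simp add: in_keys_iff)
qed

lemma tvec_linear [simp]:
  "tvec (v + v') w = tvec v w + tvec v' w" "tvec v (w + w') = tvec v w + tvec v w'"
  "tvec (v - v') w = tvec v w - tvec v' w" "tvec v (w - w') = tvec v w - tvec v w'"
  "tvec (smul c v) w = smul c (tvec v w)" "tvec v (smul c w) = smul c (tvec v w)"
  "tvec 0 w = 0" "tvec v 0 = 0"
  by (rule vec_eqI_prod; simp add: lookup_add lookup_minus algebra_simps)+

lemma tvec_bvec [simp]: "tvec (bvec k) (bvec l) = bvec (prod_encode (k, l))"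
  by (simp add: tvec_def)

lemma tvec_single: "tvec (bvec k) (Poly_Mapping.single l a) = Poly_Mapping.single (prod_encode (k, l)) a"
  "tvec (Poly_Mapping.single k a) (bvec l) = Poly_Mapping.single (prod_encode (k, l)) a"
  by (simp_all add: tvec_def)

lemma lin_swap: "lin (\<lambda>l. lin (\<lambda>k. F k l) v) w = lin (\<lambda>k. lin (\<lambda>l. F k l) w) v"
  unfolding lin_def smul_sum smul_simps(5) by (subst sum.swap) (simp add: mult.commute)

lemma lin_tvec: "lin F (tvec v w) = lin (\<lambda>k. lin (\<lambda>l. F (prod_encode (k, l))) w) v"
  by (simp add: tvec_def lin_lin)

lemma tvec_lin_lin: "tvec (lin f v) (lin g w) = lin (\<lambda>k. lin (\<lambda>l. tvec (f k) (g l)) w) v"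
proof -
  have L: "tvec (lin f v) w = lin (\<lambda>k. tvec (f k) w) v" for w
    by (simp add: tvec_def lin_lin)
  have R: "tvec x (lin g w) = lin (\<lambda>l. tvec x (g l)) w" for x
    unfolding tvec_def lin_lin by (rule lin_swap[symmetric])
  show ?thesis unfolding L unfolding R ..
qed

lemma keys_tvec: "Poly_Mapping.keys (tvec v w) = prod_encode ` (Poly_Mapping.keys v \<times> Poly_Mapping.keys w)"
proof -
  have "prod_encode (k, l) \<in> Poly_Mapping.keys (tvec v w) \<longleftrightarrow>
        k \<in> Poly_Mapping.keys v \<and> l \<in> Poly_Mapping.keys w" for k l
    by (simp add: in_keys_iff)
  then have "n \<in> Poly_Mapping.keys (tvec v w) \<longleftrightarrow>
        n \<in> prod_encode ` (Poly_Mapping.keys v \<times> Poly_Mapping.keys w)" for n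
    by (cases "prod_decode n")
       (metis (no_types, lifting) SigmaE SigmaI image_iff prod.inject prod_decode_inverse prod_encode_inverse)
  then show ?thesis by blast
qed

definition psgn :: "bmodule \<Rightarrow> nat \<Rightarrow> complex" where
  "psgn M n = (if odd_vec M n then - 1 else 1)"

text \<open>The grading operator turns the sign of the super tensor product into a linear map, so
  that the coproduct formula holds for arbitrary vectors and not only for homogeneous ones.\<close>

definition par :: "bmodule \<Rightarrow> vec \<Rightarrow> vec" where
  "par M = lin (\<lambda>n. smul (psgn M n) (bvec n))"

lemma par_bvec [simp]: "par M (bvec n) = smul (psgn M n) (bvec n)"
  by (simp add: par_def)

lemma lookup_par [simp]: "Poly_Mapping.lookup (par M v) k = psgn M k * Poly_Mapping.lookup v k"
proof -
  have "Poly_Mapping.lookup (par M v) k =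
    (\<Sum>n\<in>Poly_Mapping.keys v. if n = k then psgn M k * Poly_Mapping.lookup v k else 0)"
    unfolding par_def lookup_lin by (rule sum.cong) (auto simp: lookup_single)
  then show ?thesis by (simp add: in_keys_iff)
qed

lemma par_eq_smul_iff: "par M v = smul c v \<longleftrightarrow> (\<forall>k\<in>Poly_Mapping.keys v. psgn M k = c)"
  by (auto simp: poly_mapping_eq_iff fun_eq_iff in_keys_iff)

lemma tensor_simps [simp]:
  "basis (tensor M N) = prod_encode ` (basis M \<times> basis N)"
  "odd_vec (tensor M N) (prod_encode (k, l)) \<longleftrightarrow> odd_vec M k \<noteq> odd_vec N l"
  "Eact (tensor M N) i (prod_encode (k, l)) =
     smul (Kev N i l) (tvec (Eact M i k) (bvec l)) + smul (psgn M k) (tvec (bvec k) (Eact N i l))"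
  "Kev (tensor M N) i (prod_encode (k, l)) = Kev M i k * Kev N i l"
  by (simp_all add: tensor_def psgn_def del: smul_simps(1))

lemma Eop_tensor:
  "Eop (tensor M N) i (tvec v w) = tvec (Eop M i v) (Kop N i w) + tvec (par M v) (Eop N i w)"
  by (simp add: Eop_def Kop_def par_def lin_tvec tvec_lin_lin lin_fun_add lin_fun_smul
      del: smul_simps(1) tvec_bvec)

lemma Eop_linear:
  "Eop M i (v + w) = Eop M i v + Eop M i w" "Eop M i (smul c v) = smul c (Eop M i v)"
  "Eop M i (v - w) = Eop M i v - Eop M i w" "Eop M i 0 = 0"
  by (simp_all add: Eop_def lin_add lin_smul lin_diff)

lemma tensor_keys_Eact:
  assumes "k \<in> basis M" "l \<in> basis N" and n: "n \<in> Poly_Mapping.keys (Eact (tensor M N) i (prod_encode (k, l)))"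
  obtains k' where "k' \<in> Poly_Mapping.keys (Eact M i k)" "n = prod_encode (k', l)"
    | l' where "l' \<in> Poly_Mapping.keys (Eact N i l)" "n = prod_encode (k, l')"
proof -
  have "n \<in> Poly_Mapping.keys (smul (Kev N i l) (tvec (Eact M i k) (bvec l))) \<union>
     Poly_Mapping.keys (smul (psgn M k) (tvec (bvec k) (Eact N i l)))"
    using n unfolding tensor_simps by (rule subsetD[OF Poly_Mapping.keys_add])
  then have "n \<in> Poly_Mapping.keys (tvec (Eact M i k) (bvec l)) \<or>
     n \<in> Poly_Mapping.keys (tvec (bvec k) (Eact N i l))"
    using keys_smul by blast
  then show thesis using that by (auto simp: keys_tvec)
qed

lemma par_Eop:
  assumes "is_bmodule q M" "v \<in> vspace M"
  shows "par M (Eop M i v) = smul (- 1) (Eop M i (par M v))"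
proof -
  have "par M (Eact M i n) = smul (- psgn M n) (Eact M i n)" if "n \<in> basis M" for n
    using that assms(1) unfolding par_eq_smul_iff is_bmodule_iff by (auto simp: psgn_def)
  then show ?thesis
    unfolding par_def Eop_def lin_lin lin_fun_smul[symmetric]
    by (intro lin_eq_on_vspace[OF assms(2)]) simp
qed

text \<open>Monomials in the generators applied to a vector; \<open>u\<close> is read from the
  right. Applied to a basis vector they stay homogeneous, so \<open>Kop\<close> and
  \<open>par\<close> act on them by scalars.\<close>

fun word :: "bmodule \<Rightarrow> node list \<Rightarrow> vec \<Rightarrow> vec" where
  "word M [] v = v"
| "word M (i # u) v = Eop M i (word M u v)"

lemma Kop_word:
  assumes "is_bmodule q M" "n \<in> basis M"
  shows "word M u (bvec n) \<in> vspace M"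
    and "Kop M i (word M u (bvec n)) = smul (Kev M i n * (\<Prod>j\<leftarrow>u. q powi cartan i j)) (word M u (bvec n))"
    and "par M (word M u (bvec n)) = smul (psgn M n * (- 1) ^ length u) (word M u (bvec n))"
proof -
  show V: "word M u (bvec n) \<in> vspace M" for u
    using assms by (induction u) (simp_all add: Eop_vspace)
  show "Kop M i (word M u (bvec n)) = smul (Kev M i n * (\<Prod>j\<leftarrow>u. q powi cartan i j)) (word M u (bvec n))"
  proof (induction u)
    case (Cons j u)
    have "Kop M i (Eop M j (word M u (bvec n))) = smul (q powi cartan i j) (Eop M j (Kop M i (word M u (bvec n))))"
      using assms V[of u] unfolding is_bmodule_def by blast
    then show ?case using Cons by (simp add: Eop_linear mult_ac)
  qed simp
  show "par M (word M u (bvec n)) = smul (psgn M n * (- 1) ^ length u) (word M u (bvec n))"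
    by (induction u) (simp_all add: par_Eop[OF assms(1)] V Eop_linear mult_ac)
qed

text \<open>Factor the sum of cubes; \<open>q ^ 4 \<noteq> 1\<close> keeps the denominator
  \<open>q + inverse q\<close> away from zero.\<close>

lemma qthree_eq:
  assumes "q \<noteq> 0" "q ^ 4 \<noteq> 1"
  shows "qthree q = q\<^sup>2 - 1 + inverse q ^ 2"
proof -
  have "q + inverse q \<noteq> 0"
  proof
    assume "q + inverse q = 0"
    then have "q * q = - 1" using assms(1) by (simp add: field_simps eq_neg_iff_add_eq_0)
    then have "q ^ 4 = 1" by (simp add: power4_eq_xxxx)
    with assms show False by simp
  qed
  moreover have "q ^ 3 + inverse q ^ 3 = (q\<^sup>2 - 1 + inverse q ^ 2) * (q + inverse q)"
  proof -
    have "q ^ 3 + p ^ 3 = (q\<^sup>2 - 1 + p\<^sup>2) * (q + p)" if "q * p = 1" for p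
    proof -
      have "q ^ 3 + p ^ 3 - (q\<^sup>2 - 1 + p\<^sup>2) * (q + p) = (q + p) * (1 - q * p)"
        by (simp add: algebra_simps power2_eq_square power3_eq_cube)
      with that show ?thesis by simp
    qed
    then show ?thesis using assms(1) by simp
  qed
  ultimately show ?thesis unfolding qthree_def by simp
qed

text \<open>With \<open>X = \<E>\<^sub>i \<otimes> \<K>\<^sub>i\<close> and \<open>Y = 1 \<otimes> \<E>\<^sub>i\<close> one has \<open>XY = - q\<^sup>2 YX\<close>, and the mixed terms of the
  Serre relation cancel identically.\<close>

lemma serre_tensor:
  assumes M: "is_bmodule q M" and N: "is_bmodule q N" and q: "q \<noteq> 0" "q ^ 4 \<noteq> 1"
    and kl: "k \<in> basis M" "l \<in> basis N" and ij: "i \<noteq> j"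
  shows "serre (qthree q) (Eop (tensor M N) i) (Eop (tensor M N) j) (bvec (prod_encode (k, l))) = 0"
proof -
  define P Q c where "P = inverse q ^ 2" and "Q = q\<^sup>2" and "c = qthree q"
  define e where "e = psgn M k"
  have PQ: "Q * P = 1" "c = Q - 1 + P"
    using q by (simp_all add: P_def Q_def c_def qthree_eq flip: power_mult_distrib)
  then have PQ_cancel: "P * Q = 1" "P * (Q * z) = z" "Q * (P * z) = z" for z
    by (simp_all add: mult.commute mult.left_commute)
  have cartan: "q powi cartan i i = Q" "q powi cartan j j = Q" "q powi cartan i j = P" "q powi cartan j i = P"
    using ij by (auto simp: cartan_def P_def Q_def power_int_minus power_inverse)
  have ee: "e = 1 \<or> e = - 1"
    by (simp add: e_def psgn_def)
  let ?v = "\<lambda>u. word M u (bvec k)" and ?w = "\<lambda>u. word N u (bvec l)"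
  \<comment> \<open>A generator acts either on the left word, collecting the weight of the right
    word, or on the right word, collecting the parity of the left one.\<close>
  have E: "Eop (tensor M N) n (tvec (?v u) (?w u')) =
      smul (Kev N n l * (\<Prod>j\<leftarrow>u'. q powi cartan n j)) (tvec (?v (n # u)) (?w u')) +
      smul (e * (- 1) ^ length u) (tvec (?v u) (?w (n # u')))" for n u u'
    using Kop_word[OF M kl(1), where u = u] Kop_word[OF N kl(2), where u = u'] by (simp add: Eop_tensor e_def)
  have "serre c (Eop M i) (Eop M j) (?v []) = 0"
    using serre_zero[OF M ij] kl by (simp add: c_def)
  \<comment> \<open>The Serre relation of each factor is solved for one word and used as a
    substitution. This disposes of the terms in which all four generators act on the same
    factor.\<close>
  then have sM: "?v [i, i, i, j] = smul c (?v [i, j, i, i]) + ?v [j, i, i, i] - smul c (?v [i, i, j, i])"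
    by (simp add: serre_def algebra_simps)
  have "serre c (Eop N i) (Eop N j) (?w []) = 0"
    using serre_zero[OF N ij] kl by (simp add: c_def)
  then have sN: "?w [i, i, i, j] = smul c (?w [i, j, i, i]) + ?w [j, i, i, i] - smul c (?w [i, i, j, i])"
    by (simp add: serre_def algebra_simps)
  have "serre c (Eop (tensor M N) i) (Eop (tensor M N) j) (tvec (?v []) (?w [])) = 0"
    unfolding serre_def E Eop_linear
    unfolding sM sN
  proof (rule vec_eqI_prod, unfold lookup_add lookup_minus lookup_smul lookup_tvec
      list.map prod_list.Cons prod_list.Nil list.size cartan lookup_zero)
  \<comment> \<open>What is left is a polynomial identity in \<open>P\<close> and \<open>Q\<close>
    with \<open>Q * P = 1\<close>, checked for both parities of the left vector.\<close>
  qed (use ee in \<open>elim disjE; simp_all add: PQ PQ_cancel algebra_simps del: word.simps\<close>)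
  then show ?thesis by (simp add: c_def)
qed

lemma tvec_vspace: "v \<in> vspace M \<Longrightarrow> w \<in> vspace N \<Longrightarrow> tvec v w \<in> vspace (tensor M N)"
  unfolding vspace_def keys_tvec tensor_simps mem_Collect_eq by (intro image_mono Sigma_mono)

lemma in_O_bmodule: "in_O q M \<Longrightarrow> is_bmodule q M"
  by (simp add: in_O_def)

text \<open>Apart from the module axioms, category O only constrains labels and eigenvalues. This
  serves submodules, quotients, and a second action on the same labels.\<close>

lemma in_O_subweights:
  assumes M: "in_O q M" and L: "is_bmodule q L" and sub: "basis L \<subseteq> basis M"
    and K: "\<And>i n. n \<in> basis L \<Longrightarrow> Kev L i n = Kev M i n"
  shows "in_O q L"
proof -
  have "finite {n \<in> basis L. Kev L N0 n = a0 \<and> Kev L N1 n = a1}" for a0 a1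
  proof (rule finite_subset)
    show "{n \<in> basis L. Kev L N0 n = a0 \<and> Kev L N1 n = a1} \<subseteq>
        {n \<in> basis M. Kev M N0 n = a0 \<and> Kev M N1 n = a1}"
      using sub K by auto
    show "finite {n \<in> basis M. Kev M N0 n = a0 \<and> Kev M N1 n = a1}"
      using M unfolding in_O_def by blast
  qed
  moreover obtain S where "finite S" "\<And>n. n \<in> basis M \<Longrightarrow> \<exists>(a0, a1)\<in>S. \<exists>k::nat.
        Kev M N0 n = a0 * q ^ (2 * k) \<and> Kev M N1 n = a1 * inverse q ^ (2 * k)"
    using M unfolding in_O_def by blast
  moreover have "\<exists>(a0, a1)\<in>S. \<exists>k::nat.
        Kev L N0 n = a0 * q ^ (2 * k) \<and> Kev L N1 n = a1 * inverse q ^ (2 * k)" if "n \<in> basis L" for n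
    using calculation(3)[of n] sub K that by auto
  ultimately show ?thesis using L unfolding in_O_def by blast
qed

lemma is_bmodule_tensor:
  assumes M: "is_bmodule q M" and N: "is_bmodule q N" and q: "q \<noteq> 0" "q ^ 4 \<noteq> 1"
  shows "is_bmodule q (tensor M N)"
proof -
  have keys: "x \<in> basis (tensor M N) \<and> (odd_vec (tensor M N) x \<longleftrightarrow> \<not> odd_vec (tensor M N) (prod_encode (k, l))) \<and>
      (\<forall>j. Kev (tensor M N) j x = q powi cartan j i * Kev (tensor M N) j (prod_encode (k, l)))"
    if "k \<in> basis M" "l \<in> basis N" "x \<in> Poly_Mapping.keys (Eact (tensor M N) i (prod_encode (k, l)))" for k l i x
    using that(1,2,3)
  proof (rule tensor_keys_Eact)
    fix k' assume k': "k' \<in> Poly_Mapping.keys (Eact M i k)" "x = prod_encode (k', l)"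
    then have "k' \<in> basis M" using M that unfolding is_bmodule_iff vspace_def by blast
    moreover have "odd_vec M k' \<longleftrightarrow> \<not> odd_vec M k" "\<And>j. Kev M j k' = q powi cartan j i * Kev M j k"
      using M that k' unfolding is_bmodule_iff by blast+
    ultimately show ?thesis using k' that by auto
  next
    fix l' assume l': "l' \<in> Poly_Mapping.keys (Eact N i l)" "x = prod_encode (k, l')"
    then have "l' \<in> basis N" using N that unfolding is_bmodule_iff vspace_def by blast
    moreover have "odd_vec N l' \<longleftrightarrow> \<not> odd_vec N l" "\<And>j. Kev N j l' = q powi cartan j i * Kev N j l"
      using N that l' unfolding is_bmodule_iff by blast+
    ultimately show ?thesis using l' that by auto
  qed
  have *: "(\<forall>n\<in>basis (tensor M N). P n) \<longleftrightarrow> (\<forall>k\<in>basis M. \<forall>l\<in>basis N. P (prod_encode (k, l)))" for P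
    by auto
  have "Kev (tensor M N) i (prod_encode (k, l)) \<noteq> 0" if "k \<in> basis M" "l \<in> basis N" for i k l
    using M N that by (simp add: is_bmodule_iff)
  then show ?thesis
    unfolding is_bmodule_iff[of q "tensor M N"] * vspace_def
    using keys serre_tensor[OF M N q] by blast
qed

lemma nonunit_power_inj:
  fixes q :: complex
  assumes "q \<noteq> 0" "\<And>n::nat. n > 0 \<Longrightarrow> q ^ n \<noteq> 1"
  shows "q ^ m = q ^ n \<longleftrightarrow> m = n"
proof -
  have "\<not> m < n" if "q ^ m = q ^ n" for m n
  proof
    assume *: "m < n"
    then have "q ^ n = q ^ m * q ^ (n - m)" by (simp flip: power_add)
    then show False using that * assms by simp
  qed
  then show ?thesis by (metis linorder_neqE_nat)
qed

text \<open>In a product of two cones the weight fixes the total depth \<open>i + j\<close>, because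
  \<open>q\<close> is not a root of unity. So only finitely many pairs of weight spaces contribute
  to one weight space of the tensor product.\<close>

lemma in_O_tensor:
  assumes M: "in_O q M" and N: "in_O q N" and q: "q \<noteq> 0" "\<And>n::nat. n > 0 \<Longrightarrow> q ^ n \<noteq> 1"
  shows "in_O q (tensor M N)"
proof -
  note bM = in_O_bmodule[OF M] and bN = in_O_bmodule[OF N]
  obtain S where S: "finite S" "\<And>n. n \<in> basis M \<Longrightarrow> \<exists>(a0, a1)\<in>S. \<exists>k::nat.
        Kev M N0 n = a0 * q ^ (2 * k) \<and> Kev M N1 n = a1 * inverse q ^ (2 * k)"
    using M unfolding in_O_def by blast
  obtain T where T: "finite T" "\<And>n. n \<in> basis N \<Longrightarrow> \<exists>(a0, a1)\<in>T. \<exists>k::nat.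
        Kev N N0 n = a0 * q ^ (2 * k) \<and> Kev N N1 n = a1 * inverse q ^ (2 * k)"
    using N unfolding in_O_def by blast
  define WM where "WM = (\<lambda>s k. {n \<in> basis M. Kev M N0 n = fst s * q ^ (2 * k) \<and> Kev M N1 n = snd s * inverse q ^ (2 * k)})"
  define WN where "WN = (\<lambda>s k. {n \<in> basis N. Kev N N0 n = fst s * q ^ (2 * k) \<and> Kev N N1 n = snd s * inverse q ^ (2 * k)})"
  have fin: "finite (WM s k)" "finite (WN s k)" for s and k :: nat
    using M N unfolding in_O_def WM_def WN_def by blast+
  have cov: "\<exists>s\<in>S. \<exists>k. n \<in> WM s k" if "n \<in> basis M" for n
    using S(2)[OF that] that by (simp add: WM_def case_prod_unfold)
  have cov': "\<exists>s\<in>T. \<exists>k. n \<in> WN s k" if "n \<in> basis N" for n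
    using T(2)[OF that] that by (simp add: WN_def case_prod_unfold)
  have "is_bmodule q (tensor M N)"
    using bM bN q by (intro is_bmodule_tensor) auto
  moreover have "finite {n \<in> basis (tensor M N). Kev (tensor M N) N0 n = a0 \<and> Kev (tensor M N) N1 n = a1}"
    (is "finite ?A") for a0 a1
  proof -
    \<comment> \<open>Pairs of depths in the cones \<open>s\<close> and \<open>t\<close> that can
      produce the weight \<open>a0\<close>. Recording \<open>a0 \<noteq> 0\<close> forces the apex
      factors to be nonzero, so that they can be cancelled.\<close>
    define D :: "complex \<times> complex \<Rightarrow> complex \<times> complex \<Rightarrow> (nat \<times> nat) set"
      where "D = (\<lambda>s t. {(i, j). fst s * fst t * q ^ (2 * (i + j)) = a0 \<and> a0 \<noteq> 0})"
    have "finite (D s t)" for s t :: "complex \<times> complex"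
    proof (cases "D s t = {}")
      case False
      then obtain i j where ij: "(i, j) \<in> D s t" by auto
      have "D s t \<subseteq> {..i + j} \<times> {..i + j}"
      proof
        fix x assume "x \<in> D s t"
        then obtain i' j' where x: "x = (i', j')" and eq: "q ^ (2 * (i + j)) = q ^ (2 * (i' + j'))"
          using ij by (auto simp: D_def)
        have "i + j = i' + j'" using eq nonunit_power_inj[OF q] by simp
        then show "x \<in> {..i + j} \<times> {..i + j}" using x by auto
      qed
      then show ?thesis using finite_subset by blast
    qed auto
    then have "finite (prod_encode ` (\<Union>s\<in>S. \<Union>t\<in>T. \<Union>(i, j)\<in>D s t. WM s i \<times> WN t j))"
      using S(1) T(1) fin by (auto intro!: finite_imageI finite_UN_I)
    moreover have "?A \<subseteq> prod_encode ` (\<Union>s\<in>S. \<Union>t\<in>T. \<Union>(i, j)\<in>D s t. WM s i \<times> WN t j)"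
    proof
      fix x assume x: "x \<in> ?A"
      then obtain k l where kl: "x = prod_encode (k, l)" "k \<in> basis M" "l \<in> basis N" by auto
      obtain s i where s: "s \<in> S" "k \<in> WM s i" using cov kl by blast
      obtain t j where t: "t \<in> T" "l \<in> WN t j" using cov' kl by blast
      have "Kev M N0 k \<noteq> 0" "Kev N N0 l \<noteq> 0"
        using kl bM bN by (auto simp: is_bmodule_iff)
      moreover have "Kev M N0 k * Kev N N0 l = a0" using x kl by simp
      ultimately have "a0 \<noteq> 0" by auto
      then have "(i, j) \<in> D s t"
        using s t \<open>Kev M N0 k * Kev N N0 l = a0\<close>
        by (simp add: D_def WM_def WN_def power_add algebra_simps)
      then show "x \<in> prod_encode ` (\<Union>s\<in>S. \<Union>t\<in>T. \<Union>(i, j)\<in>D s t. WM s i \<times> WN t j)"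
        using s t unfolding kl(1) by blast
    qed
    ultimately show ?thesis using finite_subset by blast
  qed
  moreover have "\<exists>(a0, a1)\<in>(\<lambda>(s, t). (fst s * fst t, snd s * snd t)) ` (S \<times> T). \<exists>k::nat.
        Kev (tensor M N) N0 n = a0 * q ^ (2 * k) \<and> Kev (tensor M N) N1 n = a1 * inverse q ^ (2 * k)"
    if "n \<in> basis (tensor M N)" for n
  proof -
    from that obtain k l where kl: "n = prod_encode (k, l)" "k \<in> basis M" "l \<in> basis N" by auto
    obtain s i where s: "s \<in> S" "k \<in> WM s i" using cov kl by blast
    obtain t j where t: "t \<in> T" "l \<in> WN t j" using cov' kl by blast
    have "Kev (tensor M N) N0 n = fst s * fst t * q ^ (2 * (i + j)) \<and>
        Kev (tensor M N) N1 n = snd s * snd t * inverse q ^ (2 * (i + j))"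
      using s t kl by (simp add: WM_def WN_def power_add algebra_simps)
    moreover have "(fst s * fst t, snd s * snd t) \<in> (\<lambda>(s, t). (fst s * fst t, snd s * snd t)) ` (S \<times> T)"
      using s(1) t(1) by (intro image_eqI[of _ _ "(s, t)"]) auto
    ultimately show ?thesis by (intro bexI) (simp only: prod.case, blast)
  qed
  ultimately show ?thesis
    unfolding in_O_def using S(1) T(1) finite_imageI[OF finite_cartesian_product]
    by (intro conjI allI exI[of _ "(\<lambda>(s, t). (fst s * fst t, snd s * snd t)) ` (S \<times> T)"]) auto
qed

definition tmap :: "(nat \<Rightarrow> vec) \<Rightarrow> (nat \<Rightarrow> vec) \<Rightarrow> nat \<Rightarrow> vec" where
  "tmap f g n = (case prod_decode n of (k, l) \<Rightarrow> tvec (f k) (g l))"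

lemma tmap_simp [simp]: "tmap f g (prod_encode (k, l)) = tvec (f k) (g l)"
  by (simp add: tmap_def)

lemma lin_tmap [simp]: "lin (tmap f g) (tvec v w) = tvec (lin f v) (lin g w)"
  by (simp add: lin_tvec tvec_lin_lin)

text \<open>Both maps are even and preserve weights, so they commute with the parity operator and
  the \<open>Kop\<close> that occur in the coproduct.\<close>

lemma tmap_bhom:
  assumes f: "f \<in> bhom L M" and g: "g \<in> bhom P Q"
  shows "tmap f g \<in> bhom (tensor L P) (tensor M Q)"
proof -
  have "lin (tmap f g) (Eact (tensor L P) i (prod_encode (k, l))) = Eop (tensor M Q) i (tmap f g (prod_encode (k, l)))"
    if kl: "k \<in> basis L" "l \<in> basis P" for i k l
  proof -
    have "Kop Q i (g l) = smul (Kev P i l) (g l)" "par M (f k) = smul (psgn L k) (f k)"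
      using f g kl unfolding Kop_eq_smul_iff par_eq_smul_iff bhom_iff psgn_def by auto
    moreover have "lin f (Eact L i k) = Eop M i (f k)" "lin g (Eact P i l) = Eop Q i (g l)"
      using f g kl unfolding bhom_iff by auto
    ultimately show ?thesis by (simp add: Eop_tensor lin_add lin_smul)
  qed
  moreover have "\<forall>k\<in>basis L. f k \<in> vspace M" "\<forall>l\<in>basis P. g l \<in> vspace Q"
    using f g unfolding bhom_iff by blast+
  then have "tmap f g n \<in> vspace (tensor M Q)" if "n \<in> basis (tensor L P)" for n
    using that by (auto intro!: tvec_vspace)
  moreover have "odd_vec M k' = odd_vec L k" "Kev M i k' = Kev L i k"
    if "k \<in> basis L" "k' \<in> Poly_Mapping.keys (f k)" for k k' i
    using f that unfolding bhom_iff by blast+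
  moreover have "odd_vec Q l' = odd_vec P l" "Kev Q i l' = Kev P i l"
    if "l \<in> basis P" "l' \<in> Poly_Mapping.keys (g l)" for l l' i
    using g that unfolding bhom_iff by blast+
  ultimately show ?thesis unfolding bhom_iff by (auto simp: keys_tvec)
qed

lemma bvec_bhom: "bvec \<in> bhom M M"
  by (simp add: bhom_iff Eop_def)

section \<open>Short exact sequences\<close>

text \<open>Exactness expressed by equations, with linear splittings \<open>f'\<close> and
  \<open>g'\<close> that need not be module maps. Unlike kernels and images, such equations survive
  tensoring with an identity map without further argument.\<close>

definition split_exact ::
  "bmodule \<Rightarrow> bmodule \<Rightarrow> bmodule \<Rightarrow> (nat \<Rightarrow> vec) \<Rightarrow> (nat \<Rightarrow> vec) \<Rightarrow> (nat \<Rightarrow> vec) \<Rightarrow> (nat \<Rightarrow> vec) \<Rightarrow> bool" where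
  "split_exact L M N f g f' g' \<longleftrightarrow> f \<in> bhom L M \<and> g \<in> bhom M N \<and>
     (\<forall>n\<in>basis M. f' n \<in> vspace L) \<and> (\<forall>n\<in>basis N. g' n \<in> vspace M) \<and>
     (\<forall>n\<in>basis L. lin f' (f n) = bvec n) \<and> (\<forall>n\<in>basis N. lin g (g' n) = bvec n) \<and>
     (\<forall>n\<in>basis L. lin g (f n) = 0) \<and> (\<forall>n\<in>basis M. lin f (f' n) + lin g' (g n) = bvec n)"

lemma vspace_bhom: "f \<in> bhom L M \<Longrightarrow> v \<in> vspace L \<Longrightarrow> lin f v \<in> vspace M"
  by (rule vspace_lin) (auto simp: bhom_iff)

lemma lin_section:
  assumes "v \<in> vspace M" "\<And>n. n \<in> basis M \<Longrightarrow> lin f (g n) = bvec n"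
  shows "lin f (lin g v) = v"
  unfolding lin_lin using lin_eq_on_vspace[OF assms(1), of "\<lambda>n. lin f (g n)" bvec] assms(2) by simp

lemma split_exact_imp_short_exact:
  assumes "split_exact L M N f g f' g'"
  shows "short_exact L M N"
proof -
  have f: "f \<in> bhom L M" and g: "g \<in> bhom M N" and f': "\<And>n. n \<in> basis M \<Longrightarrow> f' n \<in> vspace L"
    and g': "\<And>n. n \<in> basis N \<Longrightarrow> g' n \<in> vspace M"
    and ff: "\<And>n. n \<in> basis L \<Longrightarrow> lin f' (f n) = bvec n"
    and gg: "\<And>n. n \<in> basis N \<Longrightarrow> lin g (g' n) = bvec n"
    and gf: "\<And>n. n \<in> basis L \<Longrightarrow> lin g (f n) = 0"
    and id: "\<And>n. n \<in> basis M \<Longrightarrow> lin f (f' n) + lin g' (g n) = bvec n"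
    using assms unfolding split_exact_def by blast+
  have "inj_on (lin f) (vspace L)"
    by (rule inj_on_inverseI[of _ "lin f'"]) (rule lin_section[OF _ ff])
  moreover have "lin f ` vspace L = {v \<in> vspace M. lin g v = 0}"
  proof (intro equalityI subsetI)
    fix w assume "w \<in> lin f ` vspace L"
    then obtain v where v: "v \<in> vspace L" "w = lin f v" by blast
    have "lin g w = lin (\<lambda>_. 0) v"
      unfolding v(2) lin_lin by (rule lin_eq_on_vspace[OF v(1)]) (rule gf)
    then show "w \<in> {v \<in> vspace M. lin g v = 0}"
      using vspace_bhom[OF f] v by simp
  next
    fix w assume w: "w \<in> {v \<in> vspace M. lin g v = 0}"
    then have "lin f (lin f' w) + lin g' (lin g w) = lin bvec w"
      unfolding lin_lin lin_fun_add[symmetric] by (intro lin_eq_on_vspace[of _ M]) (auto simp: id)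
    then have "w = lin f (lin f' w)" using w by simp
    moreover have "lin f' w \<in> vspace L" using w by (intro vspace_lin[OF _ f']) auto
    ultimately show "w \<in> lin f ` vspace L" by blast
  qed
  moreover have "lin g ` vspace M = vspace N"
  proof (intro equalityI subsetI)
    fix w assume "w \<in> vspace N"
    then have "w = lin g (lin g' w)" "lin g' w \<in> vspace M"
      by (auto simp: lin_section gg g' intro: vspace_lin)
    then show "w \<in> lin g ` vspace M" by blast
  qed (use vspace_bhom[OF g] in blast)
  ultimately show ?thesis using f g unfolding short_exact_def by blast
qed

lemma short_exact_imp_split_exact:
  assumes "short_exact L M N"
  obtains f g f' g' where "split_exact L M N f g f' g'"
proof -
  obtain f g where f: "f \<in> bhom L M" and g: "g \<in> bhom M N"
    and inj: "inj_on (lin f) (vspace L)"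
    and ker: "lin f ` vspace L = {v \<in> vspace M. lin g v = 0}"
    and surj: "lin g ` vspace M = vspace N"
    using assms unfolding short_exact_def by blast
  have "\<exists>v\<in>vspace M. lin g v = bvec n" if "n \<in> basis N" for n
  proof -
    have "bvec n \<in> lin g ` vspace M" using surj that by simp
    then show ?thesis by force
  qed
  then obtain g' where g': "\<And>n. n \<in> basis N \<Longrightarrow> g' n \<in> vspace M \<and> lin g (g' n) = bvec n"
    by metis
  have f_vs: "f n \<in> vspace M" if "n \<in> basis L" for n
    using f that unfolding bhom_iff by blast
  have g_vs: "g n \<in> vspace N" if "n \<in> basis M" for n
    using g that unfolding bhom_iff by blast
  have gf: "lin g (f n) = 0" if "n \<in> basis L" for n
    using ker that by (metis (mono_tags, lifting) imageI lin_single mem_Collect_eq smul_simps(4) vspace_bvec)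
  \<comment> \<open>Removing the lifted image of \<open>bvec n\<close> leaves a vector of the kernel
    of \<open>g\<close>, hence of the image of \<open>f\<close>; this yields the retraction
    \<open>f'\<close>.\<close>
  have "\<exists>v\<in>vspace L. lin f v = bvec n - lin g' (g n)" if n: "n \<in> basis M" for n
  proof -
    have "lin g (lin g' (g n)) = g n"
      by (rule lin_section[OF g_vs[OF n]]) (use g' in blast)
    then have "bvec n - lin g' (g n) \<in> {v \<in> vspace M. lin g v = 0}"
      using n g' g_vs[OF n] by (auto simp: lin_diff intro!: vspace_diff vspace_lin)
    then show ?thesis unfolding ker[symmetric] by force
  qed
  then obtain f' where f': "\<And>n. n \<in> basis M \<Longrightarrow> f' n \<in> vspace L \<and> lin f (f' n) = bvec n - lin g' (g n)"
    by metis
  have "lin f' (f n) = bvec n" if n: "n \<in> basis L" for n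
  proof (rule inj_onD[OF inj])
    have "lin f (lin f' (f n)) = lin (\<lambda>m. bvec m - lin g' (g m)) (f n)"
      unfolding lin_lin by (rule lin_eq_on_vspace[OF f_vs[OF n]]) (use f' in blast)
    also have "\<dots> = f n - lin g' (lin g (f n))"
      by (simp add: lin_fun_diff lin_lin)
    finally show "lin f (lin f' (f n)) = lin f (bvec n)"
      by (simp add: gf n)
    show "lin f' (f n) \<in> vspace L"
      using f' f_vs[OF n] by (blast intro: vspace_lin)
  qed (use n in simp)
  then have "split_exact L M N f g f' g'"
    unfolding split_exact_def using f g f' g' gf by auto
  then show thesis by (rule that)
qed

text \<open>The tensor product is exact because the equations of a linear splitting are preserved by
  \<open>tmap _ bvec\<close>.\<close>

lemma short_exact_tensor_right:
  assumes "short_exact L M N"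
  shows "short_exact (tensor L P) (tensor M P) (tensor N P)"
proof -
  obtain f g f' g' where "split_exact L M N f g f' g'"
    using short_exact_imp_split_exact[OF assms] .
  then have "split_exact (tensor L P) (tensor M P) (tensor N P)
      (tmap f bvec) (tmap g bvec) (tmap f' bvec) (tmap g' bvec)"
    unfolding split_exact_def using tmap_bhom[OF _ bvec_bhom]
    by (auto simp flip: tvec_linear(1) intro!: tvec_vspace)
  then show ?thesis by (rule split_exact_imp_short_exact)
qed

lemma short_exact_tensor_left:
  assumes "short_exact L M N"
  shows "short_exact (tensor P L) (tensor P M) (tensor P N)"
proof -
  obtain f g f' g' where "split_exact L M N f g f' g'"
    using short_exact_imp_split_exact[OF assms] .
  then have "split_exact (tensor P L) (tensor P M) (tensor P N)
      (tmap bvec f) (tmap bvec g) (tmap bvec f') (tmap bvec g')"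
    unfolding split_exact_def using tmap_bhom[OF bvec_bhom]
    by (auto simp flip: tvec_linear(2) intro!: tvec_vspace)
  then show ?thesis by (rule split_exact_imp_short_exact)
qed

text \<open>An isomorphism between \<open>L\<close> and \<open>M\<close> is always expressed as a
  short exact sequence with this third term, so that it is directly a relation of the Grothendieck
  group. Parity and weights are dummy values.\<close>

definition zero_bmodule :: bmodule where
  "zero_bmodule = \<lparr>basis = {}, odd_vec = odd, Eact = (\<lambda>_ _. 0), Kev = (\<lambda>_ _. 1)\<rparr>"

lemma in_O_zero_bmodule: "in_O q zero_bmodule"
  unfolding in_O_def is_bmodule_iff by (auto simp: zero_bmodule_def)

lemma short_exact_bij:
  assumes f: "f \<in> bhom L M"
    and inj: "\<And>v. v \<in> vspace L \<Longrightarrow> lin f v = 0 \<Longrightarrow> v = 0"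
    and surj: "\<And>n. n \<in> basis M \<Longrightarrow> bvec n \<in> lin f ` vspace L"
  shows "short_exact L M zero_bmodule"
proof -
  have "\<exists>v. v \<in> vspace L \<and> lin f v = bvec n" if "n \<in> basis M" for n
    using surj[OF that] by force
  then obtain f' where f': "\<And>n. n \<in> basis M \<Longrightarrow> f' n \<in> vspace L \<and> lin f (f' n) = bvec n"
    by metis
  have "lin f' (f n) = bvec n" if n: "n \<in> basis L" for n
  proof -
    have fn: "f n \<in> vspace M" using f n unfolding bhom_iff by blast
    have "lin f (lin f' (f n)) = f n"
      by (rule lin_section[OF fn]) (use f' in blast)
    then have "lin f (lin f' (f n) - bvec n) = 0" by (simp add: lin_diff)
    moreover have "lin f' (f n) - bvec n \<in> vspace L"
      using n f' fn by (auto intro!: vspace_diff vspace_lin)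
    ultimately show ?thesis using inj by fastforce
  qed
  moreover have "(\<lambda>_. 0) \<in> bhom M zero_bmodule"
    by (simp add: bhom_iff Eop_linear)
  ultimately have "split_exact L M zero_bmodule f (\<lambda>_. 0) f' (\<lambda>_. 0)"
    unfolding split_exact_def using f f' by (auto simp: zero_bmodule_def)
  then show ?thesis by (rule split_exact_imp_short_exact)
qed

lemma lookup_lin_monomial:
  assumes "v \<in> vspace L" "inj_on \<phi> (basis L)" "n \<in> basis L"
  shows "Poly_Mapping.lookup (lin (\<lambda>n. smul (c n) (bvec (\<phi> n))) v) (\<phi> n) = c n * Poly_Mapping.lookup v n"
proof -
  have "Poly_Mapping.lookup (lin (\<lambda>n. smul (c n) (bvec (\<phi> n))) v) (\<phi> n) =
     (\<Sum>k\<in>Poly_Mapping.keys v. if k = n then c n * Poly_Mapping.lookup v n else 0)"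
    unfolding lookup_lin
  proof (rule sum.cong)
    fix k assume "k \<in> Poly_Mapping.keys v"
    then have "k \<in> basis L" using assms(1) by (auto simp: vspace_def)
    then have "\<phi> k = \<phi> n \<longleftrightarrow> k = n" using assms(2,3) by (auto dest: inj_onD)
    then show "Poly_Mapping.lookup v k * Poly_Mapping.lookup (smul (c k) (bvec (\<phi> k))) (\<phi> n) =
        (if k = n then c n * Poly_Mapping.lookup v n else 0)"
      by (auto simp: lookup_single)
  qed simp
  then show ?thesis by (simp add: in_keys_iff)
qed

text \<open>Isomorphisms that relabel and rescale basis vectors. Most identifications below have
  this form; the change to the basis \<open>cyc\<close> does not.\<close>

lemma short_exact_monomial:
  assumes bij: "bij_betw \<phi> (basis L) (basis M)"
    and c: "\<And>n. n \<in> basis L \<Longrightarrow> c n \<noteq> 0"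
    and odd: "\<And>n. n \<in> basis L \<Longrightarrow> odd_vec M (\<phi> n) = odd_vec L n"
    and K: "\<And>i n. n \<in> basis L \<Longrightarrow> Kev M i (\<phi> n) = Kev L i n"
    and E: "\<And>i n. n \<in> basis L \<Longrightarrow>
      lin (\<lambda>n. smul (c n) (bvec (\<phi> n))) (Eact L i n) = smul (c n) (Eact M i (\<phi> n))"
  shows "short_exact L M zero_bmodule"
proof (rule short_exact_bij)
  let ?f = "\<lambda>n. smul (c n) (bvec (\<phi> n))"
  have keys: "k = \<phi> n" if "k \<in> Poly_Mapping.keys (?f n)" for k n
    using that by (simp split: if_splits)
  have "\<phi> n \<in> basis M" if "n \<in> basis L" for n
    using bij that by (auto simp: bij_betw_def)
  then show "?f \<in> bhom L M"
    unfolding bhom_iff using keys odd K E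
    by (auto simp: Eop_linear vspace_smul simp del: smul_simps(1) dest!: keys)
next
  fix v assume v: "v \<in> vspace L" "lin (\<lambda>n. smul (c n) (bvec (\<phi> n))) v = 0"
  have "Poly_Mapping.lookup v n = 0" for n
  proof (cases "n \<in> basis L")
    case True
    have "c n * Poly_Mapping.lookup v n = 0"
      using lookup_lin_monomial[OF v(1) bij_betw_imp_inj_on[OF bij] True, of c] v(2) by simp
    with c True show ?thesis by simp
  next
    case False
    with v(1) show ?thesis by (auto simp: vspace_def in_keys_iff)
  qed
  then show "v = 0" by (intro poly_mapping_eqI) simp
next
  fix m assume "m \<in> basis M"
  then obtain n where n: "n \<in> basis L" "m = \<phi> n" using bij by (auto simp: bij_betw_def)
  have "bvec m = lin (\<lambda>n. smul (c n) (bvec (\<phi> n))) (smul (inverse (c n)) (bvec n))"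
    using c[OF n(1)] n(2) by simp
  moreover have "smul (inverse (c n)) (bvec n) \<in> vspace L"
    using n(1) by (intro vspace_smul) simp
  ultimately show "bvec m \<in> lin (\<lambda>n. smul (c n) (bvec (\<phi> n))) ` vspace L" by blast
qed

(* The simp rule single_one would hide bvec 0 as the unit of the ring of polynomial mappings. *)
declare single_one [simp del]

lemma short_exact_relabel:
  assumes "bij_betw \<phi> (basis L) (basis M)"
    and "\<And>n. n \<in> basis L \<Longrightarrow> odd_vec M (\<phi> n) = odd_vec L n"
    and "\<And>i n. n \<in> basis L \<Longrightarrow> Kev M i (\<phi> n) = Kev L i n"
    and "\<And>i n. n \<in> basis L \<Longrightarrow> lin (\<lambda>n. bvec (\<phi> n)) (Eact L i n) = Eact M i (\<phi> n)"
  shows "short_exact L M zero_bmodule"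
  by (rule short_exact_monomial[of \<phi> _ _ "\<lambda>_. 1"]) (use assms in simp_all)

text \<open>Nested label pairs are merely re-bracketed. This respects the action because the
  coproduct is coassociative and parities add, so the signs agree.\<close>

lemma short_exact_assoc:
  "short_exact (tensor (tensor M N) P) (tensor M (tensor N P)) zero_bmodule"
proof -
  define \<phi> where "\<phi> n = (case prod_decode n of (m, l) \<Rightarrow> case prod_decode m of (j, k) \<Rightarrow>
     prod_encode (j, prod_encode (k, l)))" for n
  have [simp]: "\<phi> (prod_encode (prod_encode (j, k), l)) = prod_encode (j, prod_encode (k, l))" for j k l
    by (simp add: \<phi>_def)
  have [simp]: "lin (\<lambda>n. bvec (\<phi> n)) (tvec (tvec u v) w) = tvec u (tvec v w)" for u v w
    by (simp add: lin_tvec) (simp add: tvec_def lin_lin)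
  have [simp]: "lin (\<lambda>n. bvec (\<phi> n)) (tvec (bvec (prod_encode (j, k))) w) = tvec (bvec j) (tvec (bvec k) w)"
    "lin (\<lambda>n. bvec (\<phi> n)) (tvec (tvec u v) (bvec l)) = tvec u (tvec v (bvec l))" for j k l u v w
    by (simp_all flip: tvec_bvec)
  have "bij_betw \<phi> (basis (tensor (tensor M N) P)) (basis (tensor M (tensor N P)))"
    unfolding bij_betw_def inj_on_def by (fastforce simp: image_iff)
  then show ?thesis
    by (rule short_exact_relabel)
       (auto simp: lin_add lin_smul smul_add psgn_def mult_ac add_ac)
qed

lemma short_exact_unit_left: "short_exact (tensor (U_mod bs False 0) M) M zero_bmodule"
proof -
  define \<phi> where "\<phi> n = snd (prod_decode n)" for n
  have [simp]: "\<phi> (prod_encode (j, k)) = k" for j k by (simp add: \<phi>_def)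
  have "bij_betw \<phi> (basis (tensor (U_mod bs False 0) M)) (basis M)"
    unfolding bij_betw_def inj_on_def by (auto simp: image_iff U_mod_def)
  then show ?thesis
    by (rule short_exact_relabel)
       (auto simp: lin_add lin_smul U_mod_def psgn_def lin_tvec qpow_def split: node.split)
qed

lemma short_exact_unit_right: "short_exact (tensor M (U_mod bs False 0)) M zero_bmodule"
proof -
  define \<phi> where "\<phi> n = fst (prod_decode n)" for n
  have [simp]: "\<phi> (prod_encode (j, k)) = j" for j k by (simp add: \<phi>_def)
  have "bij_betw \<phi> (basis (tensor M (U_mod bs False 0))) (basis M)"
    unfolding bij_betw_def inj_on_def by (auto simp: image_iff U_mod_def)
  then show ?thesis
    by (rule short_exact_relabel)
       (auto simp: lin_add lin_smul U_mod_def psgn_def lin_tvec qpow_def split: node.split)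
qed

lemma qpow_simps [simp]: "qpow b 0 = 1" "qpow b x \<noteq> 0"
  by (simp_all add: qpow_def)

lemma qpow_add: "qpow b (x + y) = qpow b x * qpow b y"
  by (simp add: qpow_def algebra_simps flip: exp_add)

lemma qpow_minus: "qpow b (- x) = inverse (qpow b x)"
  by (simp add: qpow_def exp_minus)

lemma qpow_of_nat: "qpow b (of_nat n * x) = qpow b x ^ n"
  by (simp add: qpow_def mult_ac flip: exp_of_nat_mult)

lemma in_O_U_mod: "in_O q (U_mod bs e p)"
  unfolding in_O_def is_bmodule_iff
proof (intro conjI allI)
  show "\<exists>S. finite S \<and> (\<forall>n\<in>basis (U_mod bs e p). \<exists>(a0, a1)\<in>S. \<exists>k::nat.
        Kev (U_mod bs e p) N0 n = a0 * q ^ (2 * k) \<and> Kev (U_mod bs e p) N1 n = a1 * inverse q ^ (2 * k))"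
    by (rule exI[of _ "{(Kev (U_mod bs e p) N0 0, Kev (U_mod bs e p) N1 0)}"])
       (auto simp: U_mod_def intro!: exI[of _ 0])
qed (auto simp: U_mod_def serre_def Eop_linear split: node.split)

section \<open>The Grothendieck ring\<close>

locale generic_parameter =
  fixes b :: complex
  assumes generic: "\<And>n::nat. n > 0 \<Longrightarrow> qpow b 1 ^ n \<noteq> 1"
begin

lemma tensor_objects: "M \<in> objects b \<Longrightarrow> N \<in> objects b \<Longrightarrow> tensor M N \<in> objects b"
  using generic by (simp add: objects_def in_O_tensor)

lemma zero_objects [simp]: "zero_bmodule \<in> objects b"
  by (simp add: objects_def in_O_zero_bmodule)

lemma U_objects [simp]: "U_mod bs e p \<in> objects b"
  by (simp add: objects_def in_O_U_mod)

abbreviation "F \<equiv> {x. Poly_Mapping.keys x \<subseteq> objects b}"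
abbreviation "I \<equiv> ses_relations b"
abbreviation "fm \<equiv> monoid.mult (free_ring b)"

lemma F_closed:
  "0 \<in> F" "x \<in> F \<Longrightarrow> y \<in> F \<Longrightarrow> x + y \<in> F" "x \<in> F \<Longrightarrow> y \<in> F \<Longrightarrow> x - y \<in> F" "x \<in> F \<Longrightarrow> - x \<in> F"
  "M \<in> objects b \<Longrightarrow> frag_of M \<in> F"
  using Poly_Mapping.keys_add[of x y] keys_diff[of x y] by auto

lemma fm_of: "fm (frag_of M) (frag_of N) = frag_of (tensor M N)"
  by (simp add: free_ring_def)

lemma fm_zero: "fm 0 y = 0" "fm x 0 = 0"
proof -
  show "fm 0 y = 0" by (simp add: free_ring_def)
  show "fm x 0 = 0"
    by (simp add: free_ring_def) (rule frag_extend_eq_0, simp)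
qed

lemma fm_diff_left: "fm (x - y) z = fm x z - fm y z"
  by (simp add: free_ring_def frag_extend_diff)

lemma fm_diff_right: "fm x (y - z) = fm x y - fm x z"
proof -
  have "frag_extend (\<lambda>M. f M - g M) x = frag_extend f x - frag_extend g x"
    for f g :: "bmodule \<Rightarrow> bmodule \<Rightarrow>\<^sub>0 int"
    using subset_UNIV by (induction x rule: frag_induction) (simp_all add: frag_extend_diff)
  then show ?thesis by (simp add: free_ring_def frag_extend_diff)
qed

lemma fm_add_left: "fm (x + y) z = fm x z + fm y z"
  using fm_diff_left[of "x + y" y z] by (simp add: algebra_simps)

lemma fm_add_right: "fm x (y + z) = fm x y + fm x z"
  using fm_diff_right[of x "y + z" z] by (simp add: algebra_simps)

lemma fm_closed:
  assumes "x \<in> F" "y \<in> F"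
  shows "fm x y \<in> F"
proof -
  have "Poly_Mapping.keys y \<subseteq> objects b" using assms(2) by simp
  then have 1: "fm (frag_of M) y \<in> F" if "M \<in> objects b" for M
  proof (induction y rule: frag_induction)
    case (one N)
    then show ?case using that tensor_objects by (simp add: fm_of)
  next
    case (diff x y)
    then show ?case unfolding fm_diff_right by (rule F_closed(3))
  qed (simp add: fm_zero)
  have "Poly_Mapping.keys x \<subseteq> objects b" using assms(1) by simp
  then show ?thesis
  proof (induction x rule: frag_induction)
    case (diff x y)
    then show ?case unfolding fm_diff_left by (rule F_closed(3))
  qed (use 1 in \<open>simp_all add: fm_zero\<close>)
qed

lemma generators_subset:
  "{frag_of M - frag_of L - frag_of N | L M N.
     L \<in> objects b \<and> M \<in> objects b \<and> N \<in> objects b \<and> short_exact L M N} \<subseteq> F"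
proof
  fix x assume "x \<in> {frag_of M - frag_of L - frag_of N | L M N.
     L \<in> objects b \<and> M \<in> objects b \<and> N \<in> objects b \<and> short_exact L M N}"
  then obtain L M N where "x = frag_of M - frag_of L - frag_of N"
    "L \<in> objects b" "M \<in> objects b" "N \<in> objects b" by blast
  then show "x \<in> F" by (simp only: F_closed)
qed

lemma carrier_F: "carrier (free_Abelian_group (objects b)) = F"
  by auto

lemma subgroup_I: "subgroup I (free_Abelian_group (objects b))"
  unfolding ses_relations_def
  by (rule group.generate_is_subgroup) (simp, unfold carrier_F, rule generators_subset)

lemma I_subset: "I \<subseteq> F"
  using subgroup.subset[OF subgroup_I] unfolding carrier_F .

lemma I_zero: "0 \<in> I"
  using subgroup.one_closed[OF subgroup_I] by simp

lemma I_minus: "x \<in> I \<Longrightarrow> - x \<in> I"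
  using subgroup.m_inv_closed[OF subgroup_I, of x] I_subset by auto

lemma I_add: "x \<in> I \<Longrightarrow> y \<in> I \<Longrightarrow> x + y \<in> I"
  using subgroup.m_closed[OF subgroup_I, of x y] by simp

lemma I_diff: "x \<in> I \<Longrightarrow> y \<in> I \<Longrightarrow> x - y \<in> I"
  using I_add[OF _ I_minus, of x y] by simp

lemma I_short_exact:
  assumes "L \<in> objects b" "M \<in> objects b" "N \<in> objects b" "short_exact L M N"
  shows "frag_of M - frag_of L - frag_of N \<in> I"
  unfolding ses_relations_def by (rule generate.incl) (use assms in blast)

lemma I_iso:
  assumes "short_exact L M zero_bmodule" "L \<in> objects b" "M \<in> objects b"
  shows "frag_of M - frag_of L \<in> I" "frag_of L - frag_of M \<in> I"
proof -
  have "short_exact zero_bmodule zero_bmodule zero_bmodule"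
    by (rule short_exact_bij[OF bvec_bhom]) (auto simp: zero_bmodule_def)
  \<comment> \<open>This relation is \<open>- [0]\<close>. Once \<open>[0]\<close> itself is a
    relation, a sequence with third term zero identifies \<open>[L]\<close> with
    \<open>[M]\<close>.\<close>
  then have "frag_of zero_bmodule - frag_of zero_bmodule - frag_of zero_bmodule \<in> I"
    by (intro I_short_exact) auto
  then have "frag_of zero_bmodule \<in> I" using I_minus by fastforce
  from I_add[OF I_short_exact[OF assms(2,3) _ assms(1)] this]
  show "frag_of M - frag_of L \<in> I" by simp
  from I_minus[OF this] show "frag_of L - frag_of M \<in> I" by simp
qed

lemma I_induct [consumes 1, case_names gen zero minus add]:
  assumes x: "x \<in> I"
    and "\<And>L M N. L \<in> objects b \<Longrightarrow> M \<in> objects b \<Longrightarrow> N \<in> objects b \<Longrightarrow> short_exact L M N \<Longrightarrow>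
        P (frag_of M - frag_of L - frag_of N)"
    and "P 0" "\<And>x. P x \<Longrightarrow> P (- x)" "\<And>x y. P x \<Longrightarrow> P y \<Longrightarrow> P (x + y)"
  shows "P x"
  using x unfolding ses_relations_def
proof (induction rule: generate.induct)
  case (inv h)
  then have "h \<in> F" using generators_subset by blast
  then have "inv\<^bsub>free_Abelian_group (objects b)\<^esub> h = - h" by simp
  moreover have "P h" using inv assms(2) by blast
  ultimately show ?case using assms(4) by simp
qed (use assms in auto)

text \<open>The relations absorb products on both sides because tensoring is exact in each argument;
  biadditivity reduces the claim to generators.\<close>

lemma I_mult:
  assumes x: "x \<in> I" and y: "y \<in> F"
  shows "fm x y \<in> I" "fm y x \<in> I"
proof -
  have y: "Poly_Mapping.keys y \<subseteq> objects b" using y by simp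
  show "fm x y \<in> I" using x
  proof (induction rule: I_induct)
    case (gen L M N)
    show ?case using y
    proof (induction y rule: frag_induction)
      case (one P)
      have "frag_of (tensor M P) - frag_of (tensor L P) - frag_of (tensor N P) \<in> I"
        using gen one by (intro I_short_exact tensor_objects short_exact_tensor_right)
      then show ?case by (simp add: fm_diff_left fm_of)
    qed (auto simp: fm_zero fm_diff_right I_zero intro: I_diff)
  next
    case (minus x)
    then show ?case using fm_diff_left[of 0 x] by (simp add: fm_zero I_minus)
  qed (auto simp: fm_zero fm_add_left I_zero intro: I_add)
  show "fm y x \<in> I" using x
  proof (induction rule: I_induct)
    case (gen L M N)
    show ?case using y
    proof (induction y rule: frag_induction)
      case (one P)
      have "frag_of (tensor P M) - frag_of (tensor P L) - frag_of (tensor P N) \<in> I"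
        using gen one by (intro I_short_exact tensor_objects short_exact_tensor_left)
      then show ?case by (simp add: fm_diff_right fm_of)
    qed (auto simp: fm_zero fm_diff_left I_zero intro: I_diff)
  next
    case (minus x)
    then show ?case using fm_diff_right[of y 0 x] by (simp add: fm_zero I_minus)
  qed (auto simp: fm_zero fm_add_right I_zero intro: I_add)
qed

text \<open>Both sides are additive in each argument, so three nested inductions lead to single
  objects, where the associator is an isomorphism.\<close>

lemma I_assoc:
  assumes "x \<in> F" "y \<in> F" "z \<in> F"
  shows "fm (fm x y) z - fm x (fm y z) \<in> I"
proof -
  have D: "a - c - (b' - d) \<in> I" if "a - b' \<in> I" "c - d \<in> I" for a b' c d
    using I_diff[OF that] by (simp add: algebra_simps)
  have keys: "Poly_Mapping.keys x \<subseteq> objects b" "Poly_Mapping.keys y \<subseteq> objects b" "Poly_Mapping.keys z \<subseteq> objects b"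
    using assms by auto
  have 1: "fm (fm (frag_of M) (frag_of N)) z - fm (frag_of M) (fm (frag_of N) z) \<in> I"
    if "M \<in> objects b" "N \<in> objects b" for M N
    using keys(3)
    by (induction z rule: frag_induction)
       (auto simp: fm_zero fm_diff_right I_zero fm_of intro!: D I_iso(2) short_exact_assoc tensor_objects that)
  have 2: "fm (fm (frag_of M) y) z - fm (frag_of M) (fm y z) \<in> I" if "M \<in> objects b" for M
    using keys(2)
    by (induction y rule: frag_induction)
       (auto simp: fm_zero fm_diff_right fm_diff_left I_zero intro!: D 1 that)
  show ?thesis
    using keys(1)
    by (induction x rule: frag_induction)
       (auto simp: fm_zero fm_diff_left I_zero intro!: D 2)
qed

lemma I_unit:
  assumes "x \<in> F"
  shows "fm (frag_of (U_mod b False 0)) x - x \<in> I" "fm x (frag_of (U_mod b False 0)) - x \<in> I"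
proof -
  have D: "a - c - (b' - d) \<in> I" if "a - b' \<in> I" "c - d \<in> I" for a b' c d
    using I_diff[OF that] by (simp add: algebra_simps)
  have keys: "Poly_Mapping.keys x \<subseteq> objects b" using assms by simp
  show "fm (frag_of (U_mod b False 0)) x - x \<in> I" using keys
    by (induction x rule: frag_induction)
       (auto simp: fm_zero fm_diff_right I_zero fm_of intro!: D I_iso(2) short_exact_unit_left tensor_objects)
  show "fm x (frag_of (U_mod b False 0)) - x \<in> I" using keys
    by (induction x rule: frag_induction)
       (auto simp: fm_zero fm_diff_left I_zero fm_of intro!: D I_iso(2) short_exact_unit_right tensor_objects)
qed

section \<open>The quotient ring\<close>

abbreviation "coset x \<equiv> I +>\<^bsub>free_ring b\<^esub> x"

lemma coset_def': "coset x = {h + x | h. h \<in> I}"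
  by (auto simp: a_r_coset_def r_coset_def free_ring_def)

lemma coset_eq_iff: "coset x = coset y \<longleftrightarrow> x - y \<in> I"
proof
  assume "coset x = coset y"
  moreover have "x \<in> coset x" unfolding coset_def' using I_zero by force
  ultimately obtain h where "x = h + y" "h \<in> I" unfolding coset_def' by blast
  then show "x - y \<in> I" by simp
next
  assume *: "x - y \<in> I"
  have sub: "coset x \<subseteq> coset y" if "x - y \<in> I" for x y
  proof
    fix z assume "z \<in> coset x"
    then obtain h where "z = h + x" "h \<in> I" unfolding coset_def' by blast
    then have "z = (h + (x - y)) + y" "h + (x - y) \<in> I" using I_add that by simp_all
    then show "z \<in> coset y" unfolding coset_def' by blast
  qed
  from sub[OF *] sub[of y x] I_minus[OF *] show "coset x = coset y" by simp
qed

lemma carrier_groth: "carrier (groth b) = coset ` F"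
  by (auto simp: groth_def FactRing_def A_RCOSETS_def' free_ring_def a_r_coset_def)

lemma zero_groth: "\<zero>\<^bsub>groth b\<^esub> = coset 0"
  by (auto simp: groth_def FactRing_def coset_def')

lemma one_groth: "\<one>\<^bsub>groth b\<^esub> = coset (frag_of (U_mod b False 0))"
  by (simp add: groth_def FactRing_def free_ring_def a_r_coset_def)

lemma add_groth: "coset x \<oplus>\<^bsub>groth b\<^esub> coset y = coset (x + y)"
proof -
  have "coset x \<oplus>\<^bsub>groth b\<^esub> coset y = {u + v | u v. u \<in> coset x \<and> v \<in> coset y}"
    by (auto simp: groth_def FactRing_def set_add_def' free_ring_def)
  also have "\<dots> = coset (x + y)"
  proof (intro equalityI subsetI)
    fix z assume "z \<in> {u + v | u v. u \<in> coset x \<and> v \<in> coset y}"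
    then obtain h k where "h \<in> I" "k \<in> I" "z = (h + x) + (k + y)" unfolding coset_def' by blast
    then have "z = (h + k) + (x + y)" "h + k \<in> I" using I_add by simp_all
    then show "z \<in> coset (x + y)" unfolding coset_def' by blast
  next
    fix z assume "z \<in> coset (x + y)"
    then obtain h where "h \<in> I" "z = (h + x) + (0 + y)" unfolding coset_def' by (auto simp: add.assoc)
    then show "z \<in> {u + v | u v. u \<in> coset x \<and> v \<in> coset y}" unfolding coset_def' using I_zero by blast
  qed
  finally show ?thesis .
qed

text \<open>The product in the quotient is by definition a union over all pairs of representatives.
  The ideal property of \<open>I\<close> makes all these cosets equal, so the union
  collapses.\<close>

lemma mult_groth:
  assumes x: "x \<in> F" and y: "y \<in> F"
  shows "coset x \<otimes>\<^bsub>groth b\<^esub> coset y = coset (fm x y)"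
proof -
  have *: "coset (fm u v) = coset (fm x y)" if u: "u \<in> coset x" and v: "v \<in> coset y" for u v
  proof -
    obtain h where h: "h \<in> I" "u = h + x" using u unfolding coset_def' by blast
    obtain k where k: "k \<in> I" "v = k + y" using v unfolding coset_def' by blast
    have "v \<in> F" unfolding k(2) by (rule F_closed(2)[OF subsetD[OF I_subset k(1)] y])
    from I_add[OF I_mult(1)[OF h(1) this] I_mult(2)[OF k(1) x]]
    have "fm h v + fm x k \<in> I" .
    moreover have "fm u v - fm x y = fm h v + fm x k"
      unfolding h(2) k(2) by (simp add: fm_add_left fm_add_right)
    ultimately show ?thesis unfolding coset_eq_iff by simp
  qed
  have "coset x \<otimes>\<^bsub>groth b\<^esub> coset y = (\<Union>u\<in>coset x. \<Union>v\<in>coset y. coset (fm u v))"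
    by (simp add: groth_def FactRing_def rcoset_mult_def)
  also have "\<dots> = (\<Union>u\<in>coset x. \<Union>v\<in>coset y. coset (fm x y))"
    by (intro SUP_cong refl *)
  also have "\<dots> = coset (fm x y)"
  proof -
    have "coset x \<noteq> {}" "coset y \<noteq> {}" unfolding coset_def' using I_zero by blast+
    then show ?thesis by (simp only: UN_constant if_False)
  qed
  finally show ?thesis .
qed

lemma coset_cases:
  assumes "x \<in> carrier (groth b)"
  obtains u where "u \<in> F" "x = coset u"
  using assms unfolding carrier_groth by blast

lemma coset_closed: "u \<in> F \<Longrightarrow> coset u \<in> carrier (groth b)"
  unfolding carrier_groth by blast

text \<open>The multiplication of \<open>free_ring b\<close> is associative and unital only up to
  isomorphism of modules. Each multiplicative law is therefore checked on representatives as
  membership in \<open>I\<close>, by \<open>I_assoc\<close> and \<open>I_unit\<close>.\<close>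

lemma ring_groth: "ring (groth b)"
proof (rule ringI)
  let ?e = "frag_of (U_mod b False 0)"
  have e: "?e \<in> F" by (rule F_closed(5)) simp
  show "abelian_group (groth b)"
  proof (rule abelian_groupI; (unfold zero_groth)?)
    fix x assume "x \<in> carrier (groth b)"
    then obtain u where u: "u \<in> F" "x = coset u" by (rule coset_cases)
    show "coset 0 \<oplus>\<^bsub>groth b\<^esub> x = x" unfolding u(2) add_groth by simp
    have "coset (- u) \<oplus>\<^bsub>groth b\<^esub> x = coset 0" unfolding u(2) add_groth by simp
    with coset_closed[OF F_closed(4)[OF u(1)]]
    show "\<exists>y\<in>carrier (groth b). y \<oplus>\<^bsub>groth b\<^esub> x = coset 0" by blast
    fix y assume "y \<in> carrier (groth b)"
    then obtain v where v: "v \<in> F" "y = coset v" by (rule coset_cases)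
    show "x \<oplus>\<^bsub>groth b\<^esub> y \<in> carrier (groth b)"
      unfolding u(2) v(2) add_groth by (rule coset_closed[OF F_closed(2)[OF u(1) v(1)]])
    show "x \<oplus>\<^bsub>groth b\<^esub> y = y \<oplus>\<^bsub>groth b\<^esub> x"
      unfolding u(2) v(2) add_groth by (simp only: add.commute)
    fix z assume "z \<in> carrier (groth b)"
    then obtain w where w: "w \<in> F" "z = coset w" by (rule coset_cases)
    show "x \<oplus>\<^bsub>groth b\<^esub> y \<oplus>\<^bsub>groth b\<^esub> z = x \<oplus>\<^bsub>groth b\<^esub> (y \<oplus>\<^bsub>groth b\<^esub> z)"
      unfolding u(2) v(2) w(2) add_groth by (simp only: add.assoc)
  qed (rule coset_closed[OF F_closed(1)])
  show "Group.monoid (groth b)"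
  proof (rule monoidI; (unfold one_groth)?)
    fix x assume "x \<in> carrier (groth b)"
    then obtain u where u: "u \<in> F" "x = coset u" by (rule coset_cases)
    show "coset ?e \<otimes>\<^bsub>groth b\<^esub> x = x" "x \<otimes>\<^bsub>groth b\<^esub> coset ?e = x"
      unfolding u(2) mult_groth[OF e u(1)] mult_groth[OF u(1) e] coset_eq_iff
      by (rule I_unit[OF u(1)])+
    fix y assume "y \<in> carrier (groth b)"
    then obtain v where v: "v \<in> F" "y = coset v" by (rule coset_cases)
    show "x \<otimes>\<^bsub>groth b\<^esub> y \<in> carrier (groth b)"
      unfolding u(2) v(2) mult_groth[OF u(1) v(1)] by (rule coset_closed[OF fm_closed[OF u(1) v(1)]])
    fix z assume "z \<in> carrier (groth b)"
    then obtain w where w: "w \<in> F" "z = coset w" by (rule coset_cases)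
    show "x \<otimes>\<^bsub>groth b\<^esub> y \<otimes>\<^bsub>groth b\<^esub> z = x \<otimes>\<^bsub>groth b\<^esub> (y \<otimes>\<^bsub>groth b\<^esub> z)"
      unfolding u(2) v(2) w(2) mult_groth[OF u(1) v(1)] mult_groth[OF v(1) w(1)]
        mult_groth[OF fm_closed[OF u(1) v(1)] w(1)] mult_groth[OF u(1) fm_closed[OF v(1) w(1)]] coset_eq_iff
      by (rule I_assoc[OF u(1) v(1) w(1)])
  qed (rule coset_closed[OF e])
  fix x y z assume x: "x \<in> carrier (groth b)" and y: "y \<in> carrier (groth b)" and z: "z \<in> carrier (groth b)"
  obtain u where u: "u \<in> F" "x = coset u" using x by (rule coset_cases)
  obtain v where v: "v \<in> F" "y = coset v" using y by (rule coset_cases)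
  obtain w where w: "w \<in> F" "z = coset w" using z by (rule coset_cases)
  show "(x \<oplus>\<^bsub>groth b\<^esub> y) \<otimes>\<^bsub>groth b\<^esub> z = x \<otimes>\<^bsub>groth b\<^esub> z \<oplus>\<^bsub>groth b\<^esub> y \<otimes>\<^bsub>groth b\<^esub> z"
    unfolding u(2) v(2) w(2) add_groth mult_groth[OF F_closed(2)[OF u(1) v(1)] w(1)]
      mult_groth[OF u(1) w(1)] mult_groth[OF v(1) w(1)] fm_add_left ..
  show "z \<otimes>\<^bsub>groth b\<^esub> (x \<oplus>\<^bsub>groth b\<^esub> y) = z \<otimes>\<^bsub>groth b\<^esub> x \<oplus>\<^bsub>groth b\<^esub> z \<otimes>\<^bsub>groth b\<^esub> y"
    unfolding u(2) v(2) w(2) add_groth mult_groth[OF w(1) F_closed(2)[OF u(1) v(1)]]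
      mult_groth[OF w(1) u(1)] mult_groth[OF w(1) v(1)] fm_add_right ..
qed

lemma cls_closed [simp]: "M \<in> objects b \<Longrightarrow> cls b M \<in> carrier (groth b)"
  unfolding cls_def by (rule coset_closed[OF F_closed(5)])

lemma cls_tensor: "M \<in> objects b \<Longrightarrow> N \<in> objects b \<Longrightarrow> cls b (tensor M N) = cls b M \<otimes>\<^bsub>groth b\<^esub> cls b N"
  unfolding cls_def by (simp only: mult_groth F_closed(5) fm_of)

lemma cls_short_exact:
  assumes "L \<in> objects b" "M \<in> objects b" "N \<in> objects b" "short_exact L M N"
  shows "cls b M = cls b L \<oplus>\<^bsub>groth b\<^esub> cls b N"
  unfolding cls_def add_groth coset_eq_iff using I_short_exact[OF assms] by (simp add: algebra_simps)

lemma cls_iso: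
  assumes "short_exact L M zero_bmodule" "L \<in> objects b" "M \<in> objects b"
  shows "cls b L = cls b M"
  unfolding cls_def coset_eq_iff by (rule I_iso(2)[OF assms])

text \<open>All eigenvalues of \<open>U_0\<close> are zeroth powers, hence 1, so the unit written
  with \<open>b\<close> agrees with the one written with the parameter of the other modules.\<close>

lemma one_eq_cls: "\<one>\<^bsub>groth b\<^esub> = cls b (U_mod bs False 0)"
proof -
  have "U_mod bs False 0 = U_mod b False 0"
    by (simp add: U_mod_def fun_eq_iff split: node.split)
  then show ?thesis by (simp add: one_groth cls_def)
qed

end

lemma Eop_single [simp]: "Eop M i (Poly_Mapping.single n a) = smul a (Eact M i n)"
  by (simp add: Eop_def)

section \<open>Submodules, quotients and the graded module\<close>

lemma serre_intertwine:
  assumes "v \<in> V" "\<And>v. v \<in> V \<Longrightarrow> A v \<in> V" "\<And>v. v \<in> V \<Longrightarrow> B v \<in> V"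
    and "\<And>v. v \<in> V \<Longrightarrow> lin f (A v) = A' (lin f v)" "\<And>v. v \<in> V \<Longrightarrow> lin f (B v) = B' (lin f v)"
  shows "serre c A' B' (lin f v) = lin f (serre c A B v)"
  using assms by (simp add: serre_def lin_add lin_diff lin_smul)

lemma Eop_intertwine:
  assumes "v \<in> vspace L" "\<And>n. n \<in> basis L \<Longrightarrow> lin f (Eact L i n) = Eop M i (f n)"
  shows "lin f (Eop L i v) = Eop M i (lin f v)"
  using assms unfolding Eop_def lin_lin by (intro lin_eq_on_vspace)

lemma bvec_nonzero [simp]: "bvec n \<noteq> 0"
  by (metis lookup_single_eq lookup_zero zero_neq_one)

text \<open>An injective intertwiner reflects relations: each axiom holds on \<open>L\<close>
  because it holds after applying \<open>f\<close>. This supplies the Serre relations for an action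
  given by formulas in a new basis.\<close>

lemma is_bmodule_pullback:
  assumes M: "is_bmodule q M" and f: "f \<in> bhom L M"
    and inj: "\<And>v. v \<in> vspace L \<Longrightarrow> lin f v = 0 \<Longrightarrow> v = 0"
    and L: "\<And>i n. n \<in> basis L \<Longrightarrow> Eact L i n \<in> vspace L"
  shows "is_bmodule q L"
proof -
  have eqI: "v = w" if "v \<in> vspace L" "w \<in> vspace L" "lin f v = lin f w" for v w
    using inj[of "v - w"] that by (simp add: vspace_diff lin_diff)
  have fE: "lin f (Eop L i v) = Eop M i (lin f v)" and fK: "lin f (Kop L i v) = Kop M i (lin f v)"
    if "v \<in> vspace L" for i v
    using f that unfolding bhom_def by blast+
  have Evs: "Eop L i v \<in> vspace L" if "v \<in> vspace L" for i v
    unfolding Eop_def using that L by (rule vspace_lin)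
  have Kvs: "Kop L i v \<in> vspace L" if "v \<in> vspace L" for i v
    using that unfolding vspace_def by (auto simp: in_keys_iff)
  have pvs: "par L v \<in> vspace L" if "v \<in> vspace L" for v
    using that unfolding vspace_def by (auto simp: in_keys_iff)
  have p: "par M (f n) = smul (psgn L n) (f n)" if "n \<in> basis L" for n
    using f that unfolding bhom_iff par_eq_smul_iff psgn_def by auto
  have fpar: "lin f (par L v) = par M (lin f v)" if "v \<in> vspace L" for v
    using that p unfolding par_def lin_lin
    by (auto simp: lin_smul simp flip: par_def intro!: lin_eq_on_vspace)
  have fv: "f n \<in> vspace M" if "n \<in> basis L" for n using f that unfolding bhom_iff by blast
  have 1: "odd_vec L k \<longleftrightarrow> \<not> odd_vec L n" if "n \<in> basis L" "k \<in> Poly_Mapping.keys (Eact L i n)" for i n k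
  proof -
    have "par L (Eop L i (bvec n)) = smul (- psgn L n) (Eop L i (bvec n))"
    proof (rule eqI)
      have "par M (Eop M i (f n)) = smul (- psgn L n) (Eop M i (f n))"
        using par_Eop[OF M fv[OF that(1)]] by (simp add: p that Eop_linear)
      then show "lin f (par L (Eop L i (bvec n))) = lin f (smul (- psgn L n) (Eop L i (bvec n)))"
        using that by (simp add: fpar L lin_smul fE[of "bvec n", simplified])
    qed (use that L in \<open>auto intro!: pvs vspace_smul\<close>)
    then have "psgn L k = - psgn L n"
      using that unfolding par_eq_smul_iff by simp
    then show ?thesis by (simp add: psgn_def split: if_splits)
  qed
  have 2: "Kev L i n \<noteq> 0" if "n \<in> basis L" for i n
  proof -
    have "f n \<noteq> 0" using inj[of "bvec n"] that by auto
    then obtain k where k: "k \<in> Poly_Mapping.keys (f n)" by fastforce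
    then have "k \<in> basis M" using fv[OF that] by (auto simp: vspace_def)
    then have "Kev M i k \<noteq> 0" using M by (auto simp: is_bmodule_iff)
    then show ?thesis using f that k by (auto simp: bhom_iff)
  qed
  have 3: "Kev L i k = q powi cartan i j * Kev L i n" if "n \<in> basis L" "k \<in> Poly_Mapping.keys (Eact L j n)" for i j n k
  proof -
    have "Kop L i (Eop L j (bvec n)) = smul (q powi cartan i j) (Eop L j (Kop L i (bvec n)))"
    proof (rule eqI)
      have "Kop M i (Eop M j (f n)) = smul (q powi cartan i j) (Eop M j (Kop M i (f n)))"
        using M fv[OF that(1)] unfolding is_bmodule_def by blast
      moreover have bn: "bvec n \<in> vspace L" using that by simp
      ultimately show "lin f (Kop L i (Eop L j (bvec n))) = lin f (smul (q powi cartan i j) (Eop L j (Kop L i (bvec n))))"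
        unfolding lin_smul fK[OF Evs[OF bn]] fE[OF bn] fE[OF Kvs[OF bn]] fK[OF bn] by simp
    qed (use that L in \<open>auto simp del: Kop_bvec intro!: Kvs vspace_smul Evs\<close>)
    then show ?thesis using that by (simp add: Kop_eq_smul_iff)
  qed
  have 4: "serre (qthree q) (Eop L i) (Eop L j) (bvec n) = 0" if "n \<in> basis L" "i \<noteq> j" for i j n
  proof (rule inj)
    show "lin f (serre (qthree q) (Eop L i) (Eop L j) (bvec n)) = 0"
      using serre_intertwine[of "bvec n" "vspace L" "Eop L i" "Eop L j" f "Eop M i" "Eop M j"]
        serre_zero[OF M that(2) fv[OF that(1)]] that Evs fE by simp
    show "serre (qthree q) (Eop L i) (Eop L j) (bvec n) \<in> vspace L"
      unfolding serre_def using that by (intro vspace_diff vspace_add vspace_smul Evs) simp_all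
  qed
  show ?thesis unfolding is_bmodule_iff using 1 2 3 4 L by blast
qed

definition restr :: "nat set \<Rightarrow> vec \<Rightarrow> vec" where
  "restr T = lin (\<lambda>n. if n \<in> T then bvec n else 0)"

lemma restr_zero [simp]: "restr T 0 = 0"
  by (simp add: restr_def)

lemma lookup_restr [simp]:
  "Poly_Mapping.lookup (restr T v) k = (if k \<in> T then Poly_Mapping.lookup v k else 0)"
proof -
  have "Poly_Mapping.lookup (restr T v) k =
    (\<Sum>n\<in>Poly_Mapping.keys v. if n = k then (if k \<in> T then Poly_Mapping.lookup v k else 0) else 0)"
    unfolding restr_def lookup_lin by (rule sum.cong) (auto simp: lookup_single)
  then show ?thesis by (simp add: in_keys_iff)
qed

lemma keys_restr [simp]: "Poly_Mapping.keys (restr T v) = Poly_Mapping.keys v \<inter> T"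
  by (auto simp: in_keys_iff split: if_splits)

text \<open>Only submodules spanned by basis labels occur, since every filtration below is adapted
  to the chosen basis.\<close>

definition closed_under :: "bmodule \<Rightarrow> nat set \<Rightarrow> bool" where
  "closed_under M S \<longleftrightarrow> (\<forall>i. \<forall>n\<in>basis M \<inter> S. Poly_Mapping.keys (Eact M i n) \<subseteq> S)"

definition sub_mod :: "bmodule \<Rightarrow> nat set \<Rightarrow> bmodule" where
  "sub_mod M S = M\<lparr>basis := basis M \<inter> S\<rparr>"

text \<open>The complementary labels represent the cosets; truncation of the action is reduction
  modulo the span of \<open>S\<close>.\<close>

definition quo_mod :: "bmodule \<Rightarrow> nat set \<Rightarrow> bmodule" where
  "quo_mod M S = M\<lparr>basis := basis M - S, Eact := (\<lambda>i n. restr (- S) (Eact M i n))\<rparr>"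

lemma sub_mod_simps [simp]:
  "basis (sub_mod M S) = basis M \<inter> S" "odd_vec (sub_mod M S) = odd_vec M"
  "Eact (sub_mod M S) = Eact M" "Kev (sub_mod M S) = Kev M"
  by (simp_all add: sub_mod_def)

lemma quo_mod_simps [simp]:
  "basis (quo_mod M S) = basis M - S" "odd_vec (quo_mod M S) = odd_vec M"
  "Eact (quo_mod M S) i n = restr (- S) (Eact M i n)" "Kev (quo_mod M S) = Kev M"
  by (simp_all add: quo_mod_def)

lemma is_bmodule_sub_mod:
  assumes "is_bmodule q M" "closed_under M S"
  shows "is_bmodule q (sub_mod M S)"
proof -
  have "Eop (sub_mod M S) = Eop M" by (simp add: fun_eq_iff Eop_def)
  then show ?thesis
    using assms unfolding is_bmodule_iff closed_under_def vspace_def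
    by (simp add: Ball_def)
qed

text \<open>Truncation is the quotient map. It is compatible with the action because vectors in the
  span of \<open>S\<close> never leave it, and this carries the Serre relations over to the
  quotient.\<close>

lemma restr_Eop:
  assumes "closed_under M S" "v \<in> vspace M"
  shows "restr (- S) (Eop M i v) = Eop (quo_mod M S) i (restr (- S) v)"
  unfolding restr_def
proof (rule Eop_intertwine[OF assms(2)])
  fix n assume n: "n \<in> basis M"
  show "lin (\<lambda>n. if n \<in> - S then bvec n else 0) (Eact M i n) =
      Eop (quo_mod M S) i (if n \<in> - S then bvec n else 0)"
    unfolding restr_def[symmetric]
  proof (cases "n \<in> S")
    case True
    then have "Poly_Mapping.keys (restr (- S) (Eact M i n)) = {}"
      using assms(1) n by (auto simp: closed_under_def)
    then have "restr (- S) (Eact M i n) = 0" by (simp only: keys_eq_empty)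
    then show "restr (- S) (Eact M i n) = Eop (quo_mod M S) i (if n \<in> - S then bvec n else 0)"
      using True by (simp add: Eop_linear)
  qed simp
qed

lemma is_bmodule_quo_mod:
  assumes M: "is_bmodule q M" and S: "closed_under M S"
  shows "is_bmodule q (quo_mod M S)"
proof -
  have "serre (qthree q) (Eop (quo_mod M S) i) (Eop (quo_mod M S) j) (bvec n) = 0"
    if "n \<in> basis M - S" "i \<noteq> j" for i j n
  proof -
    have "restr (- S) (bvec n) = bvec n"
      using that by (simp add: restr_def)
    then show ?thesis
      using serre_intertwine[of "bvec n" "vspace M" "Eop M i" "Eop M j" "\<lambda>n. if n \<in> - S then bvec n else 0"
          "Eop (quo_mod M S) i" "Eop (quo_mod M S) j" "qthree q", folded restr_def]
        serre_zero[OF M that(2), of "bvec n"] restr_Eop[OF S] Eop_vspace[OF M] that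
      by (simp add: restr_def)
  qed
  then show ?thesis
    using M unfolding is_bmodule_iff vspace_def
    by (auto simp: Ball_def subset_iff)
qed

lemma short_exact_sub_quo:
  assumes M: "is_bmodule q M" and S: "closed_under M S"
  shows "short_exact (sub_mod M S) M (quo_mod M S)"
proof -
  define g where "g n = (if n \<in> - S then bvec n else 0)" for n
  define f' where "f' n = (if n \<in> S then bvec n else 0)" for n
  have "bvec \<in> bhom (sub_mod M S) M"
    by (simp add: bhom_iff Eop_def)
  moreover have "lin g (Eact M i n) = Eop (quo_mod M S) i (g n)" if "n \<in> basis M" for i n
    using restr_Eop[OF S, of "bvec n" i] that by (simp add: restr_def g_def[abs_def])
  then have "g \<in> bhom M (quo_mod M S)"
    unfolding bhom_iff by (auto simp: g_def)
  ultimately have "split_exact (sub_mod M S) M (quo_mod M S) bvec g f' bvec"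
    unfolding split_exact_def by (auto simp: g_def f'_def)
  then show ?thesis by (rule split_exact_imp_short_exact)
qed

section \<open>Direct sums and the Eilenberg swindle\<close>

lemma direct_sum_simps [simp]:
  "prod_encode (m, k) \<in> basis (direct_sum M) \<longleftrightarrow> k \<in> basis (M m)"
  "odd_vec (direct_sum M) (prod_encode (m, k)) = odd_vec (M m) k"
  "Eact (direct_sum M) i (prod_encode (m, k)) = tvec (bvec m) (Eact (M m) i k)"
  "Kev (direct_sum M) i (prod_encode (m, k)) = Kev (M m) i k"
  by (auto simp: direct_sum_def tvec_def)

lemma prod_encode_cases:
  obtains k l where "n = prod_encode (k, l)"
  by (metis prod_decode_inverse surj_pair)

lemma ball_direct_sum: "(\<forall>n\<in>basis (direct_sum M). P n) \<longleftrightarrow> (\<forall>m. \<forall>k\<in>basis (M m). P (prod_encode (m, k)))"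
  by (auto simp: direct_sum_def)

lemma is_bmodule_direct_sum:
  assumes M: "\<And>m. is_bmodule q (M m)"
  shows "is_bmodule q (direct_sum M)"
proof -
  have E: "lin (\<lambda>l. bvec (prod_encode (m, l))) (Eop (M m) i v) =
      Eop (direct_sum M) i (lin (\<lambda>l. bvec (prod_encode (m, l))) v)" if "v \<in> vspace (M m)" for i m v
    using that by (rule Eop_intertwine) (simp add: tvec_def)
  have "serre (qthree q) (Eop (direct_sum M) i) (Eop (direct_sum M) j) (bvec (prod_encode (m, k))) = 0"
    if "k \<in> basis (M m)" "i \<noteq> j" for i j m k
    using serre_intertwine[of "bvec k" "vspace (M m)" "Eop (M m) i" "Eop (M m) j"
        "\<lambda>l. bvec (prod_encode (m, l))" "Eop (direct_sum M) i" "Eop (direct_sum M) j" "qthree q"]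
      serre_zero[OF M that(2), of "bvec k" m] Eop_vspace[OF M] E that by simp
  then show ?thesis
    using M unfolding is_bmodule_iff ball_direct_sum vspace_def
    by (auto simp: keys_tvec subset_iff)
qed

text \<open>For an exhaustive filtration by height, this is \<open>\<Oplus>\<^sub>k M/M\<^bsub><k\<^esub>\<close>. As \<open>M/M\<^bsub><k\<^esub>\<close> has no
  vectors of height below \<open>k\<close>, its weight spaces are finite-dimensional.\<close>

definition filtration_sum :: "bmodule \<Rightarrow> (nat \<Rightarrow> nat) \<Rightarrow> bmodule" where
  "filtration_sum M h = direct_sum (\<lambda>k. quo_mod M {n. h n < k})"

text \<open>The layer of height \<open>k\<close> is realised inside the \<open>k\<close>-th summand
  as the vectors of height exactly \<open>k\<close>. Presenting the graded module as a submodule of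
  \<open>filtration_sum\<close> makes its membership in category O automatic.\<close>

definition graded :: "bmodule \<Rightarrow> (nat \<Rightarrow> nat) \<Rightarrow> bmodule" where
  "graded M h = sub_mod (filtration_sum M h) {n. case prod_decode n of (k, l) \<Rightarrow> h l = k}"

lemma restr_tvec: "restr T (tvec (bvec k) v) = tvec (bvec k) (restr {l. prod_encode (k, l) \<in> T} v)"
  by (rule vec_eqI_prod) (auto simp: lookup_single when_def)

lemma restr_restr: "restr T (restr T' v) = restr (T \<inter> T') v"
  by (rule poly_mapping_eqI) auto

lemma restr_id: "Poly_Mapping.keys v \<subseteq> T \<Longrightarrow> restr T v = v"
  by (rule poly_mapping_eqI) (auto simp: in_keys_iff)

lemma in_O_filtration_sum:
  assumes M: "in_O q M"
    and h: "\<And>i n k. n \<in> basis M \<Longrightarrow> k \<in> Poly_Mapping.keys (Eact M i n) \<Longrightarrow> h k \<le> h n"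
  shows "in_O q (filtration_sum M h)"
proof -
  have "closed_under M {n. h n < k}" for k
    unfolding closed_under_def using h by fastforce
  then have "is_bmodule q (filtration_sum M h)"
    unfolding filtration_sum_def using in_O_bmodule[OF M]
    by (intro is_bmodule_direct_sum is_bmodule_quo_mod)
  moreover have "finite {n \<in> basis (filtration_sum M h). Kev (filtration_sum M h) N0 n = a0 \<and> Kev (filtration_sum M h) N1 n = a1}"
    (is "finite ?A") for a0 a1
  proof -
    let ?B = "{n \<in> basis M. Kev M N0 n = a0 \<and> Kev M N1 n = a1}"
    \<comment> \<open>The label \<open>n\<close> survives in the summands \<open>0, ..., h n\<close>
      only, so it is counted finitely often.\<close>
    have "\<forall>n\<in>basis (filtration_sum M h). n \<in> ?A \<longrightarrow> n \<in> prod_encode ` (\<Union>n\<in>?B. {..h n} \<times> {n})"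
      unfolding filtration_sum_def ball_direct_sum by auto
    moreover have "finite ?B" using M unfolding in_O_def by blast
    ultimately show ?thesis
      by (intro finite_subset[of ?A "prod_encode ` (\<Union>n\<in>?B. {..h n} \<times> {n})"]) (blast, simp)
  qed
  moreover have "\<exists>S. finite S \<and> (\<forall>n\<in>basis (filtration_sum M h). \<exists>(a0, a1)\<in>S. \<exists>k::nat.
        Kev (filtration_sum M h) N0 n = a0 * q ^ (2 * k) \<and> Kev (filtration_sum M h) N1 n = a1 * inverse q ^ (2 * k))"
  proof -
    obtain S where "finite S" and S: "\<And>n. n \<in> basis M \<Longrightarrow> \<exists>(a0, a1)\<in>S. \<exists>k::nat.
        Kev M N0 n = a0 * q ^ (2 * k) \<and> Kev M N1 n = a1 * inverse q ^ (2 * k)"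
      using M unfolding in_O_def by blast
    then show ?thesis
      by (intro exI[of _ S]) (simp add: filtration_sum_def ball_direct_sum)
  qed
  ultimately show ?thesis unfolding in_O_def by blast
qed

lemma closed_under_filtration_sum:
  assumes h: "\<And>i n k. n \<in> basis M \<Longrightarrow> k \<in> Poly_Mapping.keys (Eact M i n) \<Longrightarrow> h k \<le> h n"
  shows "closed_under (filtration_sum M h) {n. case prod_decode n of (k, l) \<Rightarrow> h l = k}"
    and "closed_under (filtration_sum M h) {n. fst (prod_decode n) \<noteq> 0}"
proof -
  have *: "(\<forall>n\<in>basis (direct_sum N) \<inter> S. P n) \<longleftrightarrow> (\<forall>n\<in>basis (direct_sum N). n \<in> S \<longrightarrow> P n)" for N S P
    by blast
  show "closed_under (filtration_sum M h) {n. case prod_decode n of (k, l) \<Rightarrow> h l = k}"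
    unfolding closed_under_def filtration_sum_def * ball_direct_sum
    using h by (fastforce simp: keys_tvec)
  show "closed_under (filtration_sum M h) {n. fst (prod_decode n) \<noteq> 0}"
    unfolding closed_under_def filtration_sum_def * ball_direct_sum by (auto simp: keys_tvec)
qed

lemma (in generic_parameter) sub_mod_objects:
  "M \<in> objects b \<Longrightarrow> closed_under M S \<Longrightarrow> sub_mod M S \<in> objects b"
  unfolding objects_def using in_O_subweights[of _ M "sub_mod M S"]
  by (auto simp: is_bmodule_sub_mod in_O_bmodule)

lemma (in generic_parameter) quo_mod_objects:
  "M \<in> objects b \<Longrightarrow> closed_under M S \<Longrightarrow> quo_mod M S \<in> objects b"
  unfolding objects_def using in_O_subweights[of _ M "quo_mod M S"]
  by (auto simp: is_bmodule_quo_mod in_O_bmodule)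

lemma (in generic_parameter) cls_sub_quo:
  assumes M: "M \<in> objects b" and S: "closed_under M S"
  shows "cls b M = cls b (sub_mod M S) \<oplus>\<^bsub>groth b\<^esub> cls b (quo_mod M S)"
  using assms short_exact_sub_quo[OF in_O_bmodule S]
  by (intro cls_short_exact sub_mod_objects quo_mod_objects) (auto simp: objects_def)

text \<open>An Eilenberg swindle: splitting off the submodules \<open>M\<^bsub>\<le>k\<^esub>/M\<^bsub><k\<^esub>\<close> of the summands of
  \<open>\<Oplus>\<^sub>k M/M\<^bsub><k\<^esub>\<close> leaves the same module as removing the summand \<open>M/M\<^bsub><0\<^esub> = M\<close>.\<close>

lemma (in generic_parameter) cls_graded:
  assumes M: "M \<in> objects b"
    and h: "\<And>i n k. n \<in> basis M \<Longrightarrow> k \<in> Poly_Mapping.keys (Eact M i n) \<Longrightarrow> h k \<le> h n"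
  shows "graded M h \<in> objects b" "cls b (graded M h) = cls b M"
proof -
  interpret ring "groth b" by (rule ring_groth)
  let ?P = "filtration_sum M h"
  define S where "S = {n. case prod_decode n of (k, l) \<Rightarrow> h l = k}"
  define T where "T = {n. fst (prod_decode n) \<noteq> 0}"
  have P: "?P \<in> objects b"
    using in_O_filtration_sum[of _ M h] h M by (simp add: objects_def)
  have S: "closed_under ?P S" and T: "closed_under ?P T"
    unfolding S_def T_def by (rule closed_under_filtration_sum, erule (1) h)+
  have graded: "graded M h = sub_mod ?P S" by (simp add: graded_def S_def)
  show "graded M h \<in> objects b" unfolding graded by (rule sub_mod_objects[OF P S])
  note obj = sub_mod_objects[OF P S] sub_mod_objects[OF P T] quo_mod_objects[OF P S] quo_mod_objects[OF P T]
  have S_iff [simp]: "prod_encode (k, l) \<in> S \<longleftrightarrow> h l = k" for k l by (simp add: S_def)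
  have T_iff [simp]: "prod_encode (k, l) \<in> T \<longleftrightarrow> k \<noteq> 0" for k l by (simp add: T_def)
  have P_iff [simp]: "prod_encode (k, l) \<in> basis ?P \<longleftrightarrow> l \<in> basis M \<and> k \<le> h l" for k l
    by (auto simp: filtration_sum_def)
  have P_simps [simp]: "odd_vec ?P (prod_encode (k, l)) = odd_vec M l"
    "Kev ?P i (prod_encode (k, l)) = Kev M i l"
    "Eact ?P i (prod_encode (k, l)) = tvec (bvec k) (restr {n. k \<le> h n} (Eact M i l))" for i k l
    by (simp_all add: filtration_sum_def Collect_neg_eq[symmetric] not_less)
  \<comment> \<open>In each summand, dividing out the bottom layer of height \<open>k\<close> turns
    the \<open>k\<close>-th quotient of \<open>M\<close> into the next one; hence
    \<open>\<phi>\<close> raises the summand index by one.\<close>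
  have "short_exact (quo_mod ?P S) (sub_mod ?P T) zero_bmodule"
  proof -
    define \<phi> where "\<phi> n = (case prod_decode n of (k, l) \<Rightarrow> prod_encode (Suc k, l))" for n
    have [simp]: "\<phi> (prod_encode (k, l)) = prod_encode (Suc k, l)" for k l by (simp add: \<phi>_def)
    have dom: "n \<in> basis ?P - S \<longleftrightarrow> (\<exists>k l. n = prod_encode (k, l) \<and> l \<in> basis M \<and> k < h l)" for n
      by (cases n rule: prod_encode_cases) auto
    have cod: "n \<in> basis ?P \<inter> T \<longleftrightarrow> (\<exists>k l. n = prod_encode (Suc k, l) \<and> l \<in> basis M \<and> k < h l)" for n
    proof (cases n rule: prod_encode_cases)
      case (1 k l)
      then show ?thesis by (cases k) auto
    qed
    have "bij_betw \<phi> (basis (quo_mod ?P S)) (basis (sub_mod ?P T))"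
    proof (rule bij_betw_imageI)
      show "inj_on \<phi> (basis (quo_mod ?P S))"
        unfolding inj_on_def quo_mod_simps dom Ball_def by auto
      show "\<phi> ` basis (quo_mod ?P S) = basis (sub_mod ?P T)"
      proof (intro equalityI subsetI)
        fix n assume "n \<in> basis (sub_mod ?P T)"
        then obtain k l where "n = \<phi> (prod_encode (k, l))" "l \<in> basis M" "k < h l"
          unfolding sub_mod_simps cod by auto
        moreover from this have "prod_encode (k, l) \<in> basis (quo_mod ?P S)" by simp
        ultimately show "n \<in> \<phi> ` basis (quo_mod ?P S)" by blast
      qed (unfold quo_mod_simps sub_mod_simps cod dom image_iff Bex_def, auto)
    qed
    then show ?thesis
    proof (rule short_exact_relabel)
      fix i n assume "n \<in> basis (quo_mod ?P S)"
      then obtain k l where n: "n = prod_encode (k, l)"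
        unfolding quo_mod_simps dom by blast
      have "{l. h l \<noteq> k} \<inter> {n. k \<le> h n} = {n. Suc k \<le> h n}" by auto
      then show "lin (\<lambda>n. bvec (\<phi> n)) (Eact (quo_mod ?P S) i n) = Eact (sub_mod ?P T) i (\<phi> n)"
        by (simp add: n restr_tvec restr_restr lin_tvec) (simp add: tvec_def)
      show "odd_vec (sub_mod ?P T) (\<phi> n) = odd_vec (quo_mod ?P S) n"
        "Kev (sub_mod ?P T) i (\<phi> n) = Kev (quo_mod ?P S) i n"
        by (simp_all add: n)
    qed
  qed
  then have 1: "cls b (quo_mod ?P S) = cls b (sub_mod ?P T)" by (rule cls_iso) (rule obj)+
  \<comment> \<open>No height lies below 0, so the summand with index 0 is \<open>M\<close> without
    truncation.\<close>
  have "short_exact M (quo_mod ?P T) zero_bmodule"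
  proof (rule short_exact_relabel)
    show "bij_betw (\<lambda>l. prod_encode (0, l)) (basis M) (basis (quo_mod ?P T))"
    proof (rule bij_betw_imageI)
      show "(\<lambda>l. prod_encode (0, l)) ` basis M = basis (quo_mod ?P T)"
      proof (intro equalityI subsetI)
        fix n assume "n \<in> basis (quo_mod ?P T)"
        then show "n \<in> (\<lambda>l. prod_encode (0, l)) ` basis M"
          by (cases n rule: prod_encode_cases) auto
      qed auto
    qed (simp add: inj_on_def)
    fix i n
    have "lin (\<lambda>n. bvec (prod_encode (0, n))) v = tvec (bvec 0) v" for v by (simp add: tvec_def)
    then show "lin (\<lambda>n. bvec (prod_encode (0, n))) (Eact M i n) = Eact (quo_mod ?P T) i (prod_encode (0, n))"
      by (simp add: restr_tvec restr_id)
  qed simp_all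
  then have 2: "cls b M = cls b (quo_mod ?P T)" by (rule cls_iso) (rule M obj)+
  \<comment> \<open>The class of the whole sum is computed in two ways, and the common infinite
    remainder is then cancelled.\<close>
  have "cls b (graded M h) \<oplus>\<^bsub>groth b\<^esub> cls b (sub_mod ?P T) = cls b M \<oplus>\<^bsub>groth b\<^esub> cls b (sub_mod ?P T)"
    using cls_sub_quo[OF P S] cls_sub_quo[OF P T] obj unfolding graded 1 2 by (simp add: a_comm)
  then show "cls b (graded M h) = cls b M"
    using obj M unfolding graded by (subst (asm) add.right_cancel) simp_all
qed

section \<open>The representations as objects of \<open>\<O>\<close>\<close>

text \<open>On a single ladder a Serre relation on \<open>bvec n\<close> is one scalar equation. Up
  to a common factor it involves \<open>\<alpha>\<close> and \<open>\<beta>\<close> only through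
  \<open>p\<close>, and with \<open>c = qthree q\<close> it reads
  \<open>p k + c p(k+1) = c p(k+2) + p(k+3)\<close>. The characteristic polynomial is (x - 1)(x +
  q^2)(x + q^-2), which explains the assumed shape of \<open>p\<close>. The prefundamental modules,
  \<open>V_mod\<close> and \<open>W_mod\<close> are all of this kind.\<close>

lemma in_O_ladder:
  assumes q: "q \<noteq> 0" "\<And>n::nat. n > 0 \<Longrightarrow> q ^ n \<noteq> 1"
    and M: "odd_vec M = odd" "\<And>k. Eact M N0 k = smul (\<alpha> k) (bvec (Suc k))"
      "\<And>k. Eact M N1 k = smul (\<beta> k) (bvec (k - 1))"
      "\<And>k. Kev M N0 k = \<kappa>' * q ^ (2 * k)" "\<And>k. Kev M N1 k = \<kappa>'' * inverse q ^ (2 * k)"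
    and \<kappa>: "\<kappa>' \<noteq> 0" "\<kappa>'' \<noteq> 0"
    and up: "\<And>k. k \<in> basis M \<Longrightarrow> \<alpha> k \<noteq> 0 \<Longrightarrow> Suc k \<in> basis M"
    and down: "\<And>k. Suc k \<in> basis M \<Longrightarrow> k \<in> basis M"
    and \<beta>: "\<beta> 0 = 0"
    and p: "\<And>k. p (Suc k) = \<alpha> k * \<beta> (Suc k)" "\<And>k. p k = A + B * (- (q\<^sup>2)) ^ k + C * (- (inverse q ^ 2)) ^ k" "p 0 = 0"
  shows "in_O q M"
proof -
  let ?c = "qthree q"
  define P Q where "P = inverse q ^ 2" and "Q = q\<^sup>2"
  have PQ: "P * Q = 1" using q by (simp add: P_def Q_def flip: power_mult_distrib)
  have c: "?c = Q - 1 + P" using qthree_eq[of q] q by (simp add: P_def Q_def)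
  have Q: "1 + ?c * (- Q) = ?c * (- Q) ^ 2 + (- Q) ^ 3"
  proof -
    have "1 + (Q - 1 + P) * (- Q) - ((Q - 1 + P) * (- Q) ^ 2 + (- Q) ^ 3) = (1 - P * Q) * (1 + Q)"
      by (simp add: algebra_simps power2_eq_square power3_eq_cube)
    then show ?thesis using PQ by (simp add: c)
  qed
  have P: "1 + ?c * (- P) = ?c * (- P) ^ 2 + (- P) ^ 3"
  proof -
    have "1 + (Q - 1 + P) * (- P) - ((Q - 1 + P) * (- P) ^ 2 + (- P) ^ 3) = (1 - P * Q) * (1 + P)"
      by (simp add: algebra_simps power2_eq_square power3_eq_cube)
    then show ?thesis using PQ by (simp add: c)
  qed
  \<comment> \<open>The constant solution 1 satisfies the recurrence trivially; the two other roots
    contribute the factors that vanish by \<open>Q\<close> and \<open>P\<close>.\<close>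
  have rec: "p k + ?c * p (Suc k) = ?c * p (Suc (Suc k)) + p (Suc (Suc (Suc k)))" for k
  proof -
    have "p k + ?c * p (Suc k) - (?c * p (Suc (Suc k)) + p (Suc (Suc (Suc k)))) =
       B * (- Q) ^ k * (1 + ?c * (- Q) - (?c * (- Q) ^ 2 + (- Q) ^ 3)) +
       C * (- P) ^ k * (1 + ?c * (- P) - (?c * (- P) ^ 2 + (- P) ^ 3))"
      unfolding p(2) P_def[symmetric] Q_def[symmetric]
      by (simp add: algebra_simps power2_eq_square power3_eq_cube)
    then show ?thesis using P Q by simp
  qed
  have serre01: "serre ?c (Eop M N0) (Eop M N1) (bvec n) = 0" for n
  proof -
    have "serre ?c (Eop M N0) (Eop M N1) (bvec n) =
       smul (\<alpha> n * \<alpha> (Suc n) * (p n + ?c * p (Suc n) - (?c * p (Suc (Suc n)) + p (Suc (Suc (Suc n))))))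
       (bvec (Suc (Suc n)))"
      by (cases n) (simp_all add: serre_def M \<beta> p(1,3) Eop_linear algebra_simps flip: single_add single_diff)
    then show ?thesis by (simp add: rec)
  qed
  have serre10: "serre ?c (Eop M N1) (Eop M N0) (bvec n) = 0" for n
  proof (cases "n < 2")
    \<comment> \<open>There is no label two steps below \<open>n\<close>. Truncated subtraction
      yields 0 instead, but every such path carries the factor \<open>\<beta> 0 = 0\<close>.\<close>
    case True
    then have "n = 0 \<or> n = 1" by auto
    then show ?thesis by (auto simp: serre_def M \<beta> Eop_linear)
  next
    case False
    then obtain k where k: "n = Suc (Suc k)" by (metis less_2_cases_iff old.nat.exhaust One_nat_def)
    have "serre ?c (Eop M N1) (Eop M N0) (bvec n) =
       smul (- \<beta> n * \<beta> (Suc k) * (p k + ?c * p (Suc k) - (?c * p (Suc (Suc k)) + p (Suc (Suc (Suc k))))))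
       (bvec k)"
      by (cases k) (simp_all add: k serre_def M \<beta> p(1,3) Eop_linear algebra_simps flip: single_add single_diff single_uminus)
    then show ?thesis by (simp add: rec)
  qed
  have "is_bmodule q M"
    unfolding is_bmodule_iff
  proof (intro conjI allI ballI impI)
    fix i n assume n: "n \<in> basis M"
    have down': "\<beta> n \<noteq> 0 \<Longrightarrow> n \<noteq> 0 \<and> n - 1 \<in> basis M"
      using \<beta> down[of "n - 1"] n by (cases n) auto
    show "Eact M i n \<in> vspace M"
      using up[OF n] down' by (cases i) (auto simp: M vspace_def)
    show "odd_vec M k \<longleftrightarrow> \<not> odd_vec M n" if "k \<in> Poly_Mapping.keys (Eact M i n)" for k
      using that down' by (cases i) (auto simp: M split: if_splits)
    show "Kev M i n \<noteq> 0" using \<kappa> q by (cases i) (simp_all add: M)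
    fix j
    show "Kev M i k = q powi cartan i j * Kev M i n" if "k \<in> Poly_Mapping.keys (Eact M j n)" for k
    proof (cases j)
      case N0
      then have "k = Suc n" using that by (simp add: M split: if_splits)
      then show ?thesis
        using N0 q by (cases i) (simp_all add: M cartan_def power_int_minus power2_eq_square field_simps)
    next
      case N1
      then have "k = n - 1" "\<beta> n \<noteq> 0" using that by (simp_all add: M split: if_splits)
      then obtain m where "n = Suc m" "k = m" using \<beta> by (cases n) auto
      then show ?thesis
        using N1 q by (cases i) (simp_all add: M cartan_def power_int_minus power2_eq_square field_simps)
    qed
    assume "i \<noteq> j"
    then show "serre ?c (Eop M i) (Eop M j) (bvec n) = 0"
      using serre01 serre10 by (cases i; cases j) auto
  qed
  moreover have "finite {n \<in> basis M. Kev M N0 n = a0 \<and> Kev M N1 n = a1}" (is "finite ?A") for a0 a1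
  proof (cases "?A = {}")
    case False
    then obtain n where n: "\<kappa>' * q ^ (2 * n) = a0" by (auto simp: M)
    have "?A \<subseteq> {n}"
    proof
      fix m assume "m \<in> ?A"
      then have "q ^ (2 * m) = q ^ (2 * n)" using n \<kappa> by (auto simp: M)
      then show "m \<in> {n}" using nonunit_power_inj[OF q] by simp
    qed
    then show ?thesis using finite_subset by blast
  next
    case True
    then show ?thesis by (simp only: finite.emptyI)
  qed
  ultimately show ?thesis unfolding in_O_def
    by (intro conjI allI exI[of _ "{(\<kappa>', \<kappa>'')}"]) (auto simp: M)
qed

lemma osc_closed:
  assumes "r \<noteq> 0" "1 + r\<^sup>2 \<noteq> 0"
  shows "osc r k = - (r\<^sup>2 / (1 + r\<^sup>2)\<^sup>2) * (1 - (- (r\<^sup>2)) ^ k)"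
proof (induction k)
  case (Suc k)
  have "r + inverse r = (1 + r\<^sup>2) / r"
    using assms(1) by (simp add: field_simps power2_eq_square)
  then have "osc r (Suc k) = - (r\<^sup>2 / (1 + r\<^sup>2)) - r\<^sup>2 * osc r k"
    by (simp add: algebra_simps power2_eq_square)
  also have "\<dots> = - (r\<^sup>2 / (1 + r\<^sup>2)\<^sup>2) * (1 - (- (r\<^sup>2)) ^ Suc k)"
    unfolding Suc using assms(2) by (simp add: divide_simps) (simp add: algebra_simps power2_eq_square power4_eq_xxxx)
  finally show ?case .
qed simp

locale star_parameter = generic_parameter +
  fixes bs :: complex
  assumes star: "b\<^sup>2 = bs\<^sup>2 + 1 / 2"
begin

abbreviation "q \<equiv> qpow b 1"

lemma one_plus_q2: "1 + q\<^sup>2 \<noteq> 0" "1 + (inverse q)\<^sup>2 \<noteq> 0"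
proof -
  have 4: "q ^ 4 \<noteq> 1" using generic[of 4] by simp
  show "1 + q\<^sup>2 \<noteq> 0"
  proof
    assume "1 + q\<^sup>2 = 0"
    then have "q\<^sup>2 = - 1" by (simp add: eq_neg_iff_add_eq_0 add.commute)
    then have "(q\<^sup>2)\<^sup>2 = 1" by simp
    with 4 show False by simp
  qed
  then show "1 + (inverse q)\<^sup>2 \<noteq> 0"
    by (simp add: field_simps)
qed

lemma qpow_b_even: "qpow b (2 * of_nat k) = q ^ (2 * k)" "qpow b (- (2 * of_nat k)) = inverse q ^ (2 * k)"
proof -
  show *: "qpow b (2 * of_nat k) = q ^ (2 * k)"
    using qpow_of_nat[of b "2 * k" 1] by simp
  show "qpow b (- (2 * of_nat k)) = inverse q ^ (2 * k)"
    unfolding qpow_minus * by (simp add: power_inverse)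
qed

lemma qpow_bs_two: "qpow bs 2 = - (q\<^sup>2)"
proof -
  have "qpow bs 2 = (qpow bs 1)\<^sup>2" using qpow_of_nat[of bs 2 1] by simp
  then show ?thesis by (simp add: qpow_star[OF star] power_mult_distrib)
qed

lemma qpow_bs_even: "qpow bs (2 * of_nat k) = (- 1) ^ k * q ^ (2 * k)"
  "qpow bs (- (2 * of_nat k)) = (- 1) ^ k * inverse q ^ (2 * k)"
proof -
  show *: "qpow bs (2 * of_nat k) = (- 1) ^ k * q ^ (2 * k)"
  proof -
    have "qpow bs (2 * of_nat k) = qpow bs (of_nat k * 2)" by (simp only: mult.commute)
    also have "\<dots> = (- (q\<^sup>2)) ^ k" by (simp only: qpow_of_nat qpow_bs_two)
    finally show ?thesis by (simp only: power_minus[of "q\<^sup>2" k] power_mult)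
  qed
  show "qpow bs (- (2 * of_nat k)) = (- 1) ^ k * inverse q ^ (2 * k)"
    unfolding qpow_minus * by (simp add: power_inverse flip: power_inverse[of "- 1"])
qed

lemma qpow_bs_one: "qpow bs 1 - qpow bs (- 1) \<noteq> 0"
proof
  assume "qpow bs 1 - qpow bs (- 1) = 0"
  then have "qpow bs 1 = inverse (qpow bs 1)" by (simp add: qpow_minus)
  then have "qpow bs 1 * qpow bs 1 = 1" by (metis qpow_simps(2) right_inverse)
  then have "- (q\<^sup>2) = 1" using qpow_bs_two qpow_add[of bs 1 1] by simp
  then show False using one_plus_q2(1) by (metis add.right_inverse minus_minus)
qed

lemma qnum_zero [simp]: "qnum bs 0 = 0"
  by (simp add: qnum_def)

lemma qnum_minus: "qnum bs (- x) = - qnum bs x"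
  by (simp add: qnum_def minus_divide_left)

text \<open>A zero would give \<open>q_*^(2k) = 1\<close>; squaring removes the sign between powers
  of q_*^2 and q^2 and leaves \<open>q ^ (4 * k) = 1\<close>.\<close>

lemma qnum_nonzero:
  assumes "k > 0"
  shows "qnum bs (of_nat k) \<noteq> 0"
proof
  assume "qnum bs (of_nat k) = 0"
  then have "qpow bs (of_nat k) = inverse (qpow bs (of_nat k))"
    using qpow_bs_one by (simp add: qnum_def qpow_minus)
  then have "qpow bs (of_nat k) * qpow bs (of_nat k) = 1" by (metis qpow_simps(2) right_inverse)
  then have "(- 1) ^ k * q ^ (2 * k) = 1"
    using qpow_bs_even(1)[of k] by (simp flip: qpow_add)
  then have "((- 1) ^ k * q ^ (2 * k))\<^sup>2 = 1" by simp
  then have "q ^ (4 * k) = 1" by (simp add: power_mult_distrib flip: power_mult)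
  with generic[of "4 * k"] assms show False by simp
qed

text \<open>Expanding the product leaves a constant and the powers q_*^(2k), q_*^(-2k). Since q_*^2
  = -q^2, these are the roots required by \<open>in_O_ladder\<close>.\<close>

lemma qnum_product_eq:
  "qnum bs (of_nat k) * qnum bs (z - of_nat k + 1) =
     (qpow bs (z + 1) + qpow bs (- (z + 1))) / (qpow bs 1 - qpow bs (- 1))\<^sup>2 +
     (- qpow bs (- (z + 1)) / (qpow bs 1 - qpow bs (- 1))\<^sup>2) * (- (q\<^sup>2)) ^ k +
     (- qpow bs (z + 1) / (qpow bs 1 - qpow bs (- 1))\<^sup>2) * (- (inverse q ^ 2)) ^ k"
proof -
  let ?d = "qpow bs 1 - qpow bs (- 1)"
  have "- (q\<^sup>2) = (- 1) * q\<^sup>2" "- (inverse q ^ 2) = (- 1) * inverse q ^ 2" by simp_all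
  then have e: "(- (q\<^sup>2)) ^ k = qpow bs (2 * of_nat k)" "(- (inverse q ^ 2)) ^ k = qpow bs (- (2 * of_nat k))"
    unfolding qpow_bs_even by (simp_all only: power_mult_distrib power_mult)
  have "(qpow bs (of_nat k) - qpow bs (- of_nat k)) * (qpow bs (z - of_nat k + 1) - qpow bs (- (z - of_nat k + 1)))
     = (qpow bs (z + 1) + qpow bs (- (z + 1))) - qpow bs (- (z + 1)) * qpow bs (2 * of_nat k) - qpow bs (z + 1) * qpow bs (- (2 * of_nat k))"
    unfolding ring_distribs left_diff_distrib right_diff_distrib qpow_add[symmetric] by (simp add: algebra_simps)
  then show ?thesis
    unfolding e qnum_def times_divide_times_eq
    by (simp add: power2_eq_square diff_divide_distrib add_divide_distrib)
qed

lemma qnum_product: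
  obtains A B C where
    "\<And>k. qnum bs (of_nat k) * qnum bs (z - of_nat k + 1) =
       A + B * (- (q\<^sup>2)) ^ k + C * (- (inverse q ^ 2)) ^ k"
  by (rule that) (rule qnum_product_eq)

text \<open>The Verma type evaluation module with highest weight exponent \<open>z\<close>. All
  \<open>q\<close>-numbers are put into the action of \<open>N1\<close>, so \<open>N0\<close> is a
  plain shift up to \<open>\<mu>\<close>; no denominators arise and every complex \<open>z\<close>
  is allowed, in particular \<open>- s - 2\<close>.\<close>

definition V_mod :: "complex \<Rightarrow> complex \<Rightarrow> bmodule" where
  "V_mod z \<mu> = \<lparr>basis = UNIV, odd_vec = odd,
     Eact = (\<lambda>i k. case i of
        N1 \<Rightarrow> smul (\<mu> * (qnum bs (of_nat k) * qnum bs (z - of_nat k + 1))) (bvec (k - 1))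
      | N0 \<Rightarrow> smul \<mu> (bvec (Suc k))),
     Kev = (\<lambda>i k. case i of
        N1 \<Rightarrow> (- 1) ^ k * qpow bs (z - 2 * of_nat k)
      | N0 \<Rightarrow> (- 1) ^ k * qpow bs (- (z - 2 * of_nat k)))\<rparr>"

text \<open>The sign \<open>(- 1) ^ k\<close> of the super modules is absorbed by q_*^(2k), so the
  weights lie in a single cone generated by powers of \<open>q\<close>.\<close>

lemma sign_Kev:
  "(- 1) ^ k * qpow bs (z - 2 * of_nat k) = qpow bs z * inverse q ^ (2 * k)"
  "(- 1) ^ k * qpow bs (2 * of_nat k - z) = qpow bs (- z) * q ^ (2 * k)"
proof -
  have "(- 1) ^ k * qpow bs (z + - (2 * of_nat k)) = qpow bs z * inverse q ^ (2 * k)"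
    unfolding qpow_add qpow_bs_even by (simp flip: power_mult_distrib)
  then show "(- 1) ^ k * qpow bs (z - 2 * of_nat k) = qpow bs z * inverse q ^ (2 * k)" by simp
  have "(- 1) ^ k * qpow bs (- z + 2 * of_nat k) = qpow bs (- z) * q ^ (2 * k)"
    unfolding qpow_add qpow_bs_even by (simp flip: power_mult_distrib)
  then show "(- 1) ^ k * qpow bs (2 * of_nat k - z) = qpow bs (- z) * q ^ (2 * k)" by simp
qed

lemma V_objects: "V_mod z \<mu> \<in> objects b"
proof -
  obtain A B C where ABC: "\<And>k. qnum bs (of_nat k) * qnum bs (z - of_nat k + 1) =
       A + B * (- (q\<^sup>2)) ^ k + C * (- (inverse q ^ 2)) ^ k"
    using qnum_product[of z] by blast
  have p: "\<mu> * \<mu> * (qnum bs (of_nat k) * qnum bs (z - of_nat k + 1)) =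
       \<mu> * \<mu> * A + \<mu> * \<mu> * B * (- (q\<^sup>2)) ^ k + \<mu> * \<mu> * C * (- (inverse q ^ 2)) ^ k" for k
    unfolding ABC by (simp only: ring_distribs mult.assoc)
  show ?thesis unfolding objects_def mem_Collect_eq
    by (rule in_O_ladder[where \<alpha> = "\<lambda>_. \<mu>" and \<beta> = "\<lambda>k. \<mu> * (qnum bs (of_nat k) * qnum bs (z - of_nat k + 1))"
        and \<kappa>' = "qpow bs (- z)" and \<kappa>'' = "qpow bs z"
        and p = "\<lambda>k. \<mu> * \<mu> * (qnum bs (of_nat k) * qnum bs (z - of_nat k + 1))"])
      (rule p | erule generic | simp add: V_mod_def sign_Kev)+
qed

lemma W_objects: "W_mod bs s \<mu> \<in> objects b"
proof -
  obtain A B C where ABC: "\<And>k. qnum bs (of_nat k) * qnum bs (of_nat s - of_nat k + 1) =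
       A + B * (- (q\<^sup>2)) ^ k + C * (- (inverse q ^ 2)) ^ k"
    using qnum_product[of "of_nat s"] by blast
  have p: "\<mu> * \<mu> * (qnum bs (of_nat k) * qnum bs (of_nat s - of_nat k + 1)) =
       \<mu> * \<mu> * A + \<mu> * \<mu> * B * (- (q\<^sup>2)) ^ k + \<mu> * \<mu> * C * (- (inverse q ^ 2)) ^ k" for k
    unfolding ABC by (simp only: ring_distribs mult.assoc)
  \<comment> \<open>At the top label \<open>k = s\<close> the coefficient is the
    \<open>q\<close>-number of 0, so the action does not leave the finite basis.\<close>
  have up: "Suc k \<le> s" if "k \<le> s" "qnum bs (of_nat s - of_nat k) \<noteq> 0" for k
    using that by (cases "k = s") auto
  show ?thesis unfolding objects_def mem_Collect_eq
    by (rule in_O_ladder[where \<alpha> = "\<lambda>k. \<mu> * qnum bs (of_nat s - of_nat k)" and \<beta> = "\<lambda>k. \<mu> * qnum bs (of_nat k)"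
        and \<kappa>' = "qpow bs (- of_nat s)" and \<kappa>'' = "qpow bs (of_nat s)"
        and p = "\<lambda>k. \<mu> * \<mu> * (qnum bs (of_nat k) * qnum bs (of_nat s - of_nat k + 1))"])
      (rule p | erule generic | simp add: W_mod_def sign_Kev up)+
qed

lemma rho_plus_objects: "rho_plus b \<mu> \<in> objects b"
proof -
  obtain a where osc: "\<And>k. osc (inverse q) k = a * (1 - (- (inverse q ^ 2)) ^ k)"
    using osc_closed[OF nonzero_imp_inverse_nonzero[OF qpow_simps(2)] one_plus_q2(2)] by blast
  have p: "\<mu> * \<mu> * osc (inverse q) k = \<mu> * \<mu> * a + 0 * (- (q\<^sup>2)) ^ k + (- (\<mu> * \<mu> * a)) * (- (inverse q ^ 2)) ^ k" for k
    unfolding osc by (simp add: algebra_simps)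
  show ?thesis unfolding objects_def mem_Collect_eq
    by (rule in_O_ladder[where \<alpha> = "\<lambda>k. \<mu>" and \<beta> = "\<lambda>k. \<mu> * osc (inverse q) k" and \<kappa>' = 1 and \<kappa>'' = 1
        and p = "\<lambda>k. \<mu> * \<mu> * osc (inverse q) k"])
      (rule p | erule generic | simp add: rho_plus_def create_def annihilate_def qpow_b_even qpow_minus[of b 1] del: osc.simps(2))+
qed

lemma rho_minus_objects: "rho_minus b \<mu> \<in> objects b"
proof -
  obtain a where osc: "\<And>k. osc q k = a * (1 - (- (q\<^sup>2)) ^ k)"
    using osc_closed[OF qpow_simps(2) one_plus_q2(1)] by blast
  have p: "\<mu> * \<mu> * osc q k = \<mu> * \<mu> * a + (- (\<mu> * \<mu> * a)) * (- (q\<^sup>2)) ^ k + 0 * (- (inverse q ^ 2)) ^ k" for k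
    unfolding osc by (simp add: algebra_simps)
  show ?thesis unfolding objects_def mem_Collect_eq
    by (rule in_O_ladder[where \<alpha> = "\<lambda>k. \<mu>" and \<beta> = "\<lambda>k. \<mu> * osc q k" and \<kappa>' = 1 and \<kappa>'' = 1
        and p = "\<lambda>k. \<mu> * \<mu> * osc q k"])
      (rule p | erule generic | simp add: rho_minus_def create_def annihilate_def qpow_b_even del: osc.simps(2))+
qed

section \<open>The series \<open>f\<^sub>p\<close>\<close>

abbreviation "U \<equiv> U_mod bs"

definition U_sum :: "int \<Rightarrow> bmodule" where
  "U_sum p = direct_sum (\<lambda>m. U (odd m) (- p - 2 * int m))"

lemma U_simps [simp]:
  "basis (U e p) = {0}" "odd_vec (U e p) n = e" "Eact (U e p) i n = 0"
  "Kev (U e p) N0 n = (if e then - 1 else 1) * qpow bs (- of_int p)"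
  "Kev (U e p) N1 n = (if e then - 1 else 1) * qpow bs (of_int p)"
  by (simp_all add: U_mod_def)

lemma short_exact_diagonal:
  assumes "bij_betw \<phi> (basis L) (basis M)"
    and "\<And>n. n \<in> basis L \<Longrightarrow> odd_vec M (\<phi> n) = odd_vec L n"
    and "\<And>i n. n \<in> basis L \<Longrightarrow> Kev M i (\<phi> n) = Kev L i n"
    and "\<And>i n. n \<in> basis L \<Longrightarrow> Eact L i n = 0" "\<And>i n. n \<in> basis M \<Longrightarrow> Eact M i n = 0"
  shows "short_exact L M zero_bmodule"
  using assms bij_betwE[OF assms(1)] by (intro short_exact_relabel[of \<phi>]) auto

lemma basis_U_sum: "basis (U_sum p) = range (\<lambda>m. prod_encode (m, 0))"
  by (auto simp: U_sum_def direct_sum_def)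

lemma U_sum_simps [simp]:
  "odd_vec (U_sum p) (prod_encode (m, k)) = odd m" "Eact (U_sum p) i (prod_encode (m, k)) = 0"
  "Kev (U_sum p) N0 (prod_encode (m, k)) = qpow bs (of_int p) * q ^ (2 * m)"
  "Kev (U_sum p) N1 (prod_encode (m, k)) = qpow bs (- of_int p) * inverse q ^ (2 * m)"
proof -
  have *: "(if odd m then - 1 else 1) = (- 1 :: complex) ^ m" by simp
  show "odd_vec (U_sum p) (prod_encode (m, k)) = odd m" "Eact (U_sum p) i (prod_encode (m, k)) = 0"
    by (simp_all add: U_sum_def)
  show "Kev (U_sum p) N0 (prod_encode (m, k)) = qpow bs (of_int p) * q ^ (2 * m)"
    "Kev (U_sum p) N1 (prod_encode (m, k)) = qpow bs (- of_int p) * inverse q ^ (2 * m)"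
    using sign_Kev[of m "- of_int p"] by (simp_all add: U_sum_def * algebra_simps)
qed

lemma U_sum_objects [simp]: "U_sum p \<in> objects b"
proof -
  have "is_bmodule q (U_sum p)"
    unfolding U_sum_def by (intro is_bmodule_direct_sum in_O_bmodule in_O_U_mod)
  moreover have "finite {n \<in> basis (U_sum p). Kev (U_sum p) N0 n = a0 \<and> Kev (U_sum p) N1 n = a1}" (is "finite ?A") for a0 a1
  proof (cases "?A = {}")
    case False
    then obtain m where m: "qpow bs (of_int p) * q ^ (2 * m) = a0" by (auto simp: basis_U_sum)
    have "?A \<subseteq> {prod_encode (m, 0)}"
      using m nonunit_power_inj[OF qpow_simps(2) generic] by (auto simp: basis_U_sum)
    then show ?thesis using finite_subset by blast
  next
    case True
    then show ?thesis by (simp only: finite.emptyI)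
  qed
  ultimately show ?thesis unfolding objects_def in_O_def
    by (auto simp: basis_U_sum intro!: exI[of _ "{(qpow bs (of_int p), qpow bs (- of_int p))}"])
qed

lemma cls_U_mult: "cls b (U e p) \<otimes>\<^bsub>groth b\<^esub> cls b (U e' p') = cls b (U (e \<noteq> e') (p + p'))"
proof -
  have "short_exact (tensor (U e p) (U e' p')) (U (e \<noteq> e') (p + p')) zero_bmodule"
  proof (rule short_exact_diagonal[of "\<lambda>_. 0"])
    show "bij_betw (\<lambda>_. 0) (basis (tensor (U e p) (U e' p'))) (basis (U (e \<noteq> e') (p + p')))"
      by (simp add: bij_betw_def)
    fix i n assume n: "n \<in> basis (tensor (U e p) (U e' p'))"
    show "Kev (U (e \<noteq> e') (p + p')) i 0 = Kev (tensor (U e p) (U e' p')) i n"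
      using n by (cases i) (auto simp flip: qpow_add)
  qed auto
  from cls_iso[OF this] show ?thesis by (simp add: tensor_objects cls_tensor)
qed

lemma cls_U_U_sum:
  "cls b (U False p) \<otimes>\<^bsub>groth b\<^esub> cls b (U_sum p') = cls b (U_sum (p' - p))"
proof -
  have "short_exact (tensor (U False p) (U_sum p')) (U_sum (p' - p)) zero_bmodule"
  proof (rule short_exact_diagonal[of "\<lambda>n. snd (prod_decode n)"])
    show "bij_betw (\<lambda>n. snd (prod_decode n)) (basis (tensor (U False p) (U_sum p'))) (basis (U_sum (p' - p)))"
      by (rule bij_betw_imageI) (auto simp: inj_on_def basis_U_sum image_iff)
    fix i n assume "n \<in> basis (tensor (U False p) (U_sum p'))"
    then show "Kev (U_sum (p' - p)) i (snd (prod_decode n)) = Kev (tensor (U False p) (U_sum p')) i n"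
      by (cases i) (auto simp: basis_U_sum simp flip: qpow_add)
  qed (auto simp: basis_U_sum)
  from cls_iso[OF this] show ?thesis by (simp add: tensor_objects cls_tensor)
qed

text \<open>With all \<open>Eact\<close> zero, the flip of the two factors is a module map. This is
  the one commutation needed to reorder the inverse of the series and the power of sigma in the
  final identity.\<close>

lemma cls_sigma_U_sum:
  "cls b (U True 0) \<otimes>\<^bsub>groth b\<^esub> cls b (U_sum p) = cls b (U_sum p) \<otimes>\<^bsub>groth b\<^esub> cls b (U True 0)"
proof -
  define \<phi> where "\<phi> n = (case prod_decode n of (k, l) \<Rightarrow> prod_encode (l, k))" for n
  have [simp]: "\<phi> (prod_encode (k, l)) = prod_encode (l, k)" for k l by (simp add: \<phi>_def)
  have "short_exact (tensor (U True 0) (U_sum p)) (tensor (U_sum p) (U True 0)) zero_bmodule"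
  proof (rule short_exact_diagonal[of \<phi>])
    show "bij_betw \<phi> (basis (tensor (U True 0) (U_sum p))) (basis (tensor (U_sum p) (U True 0)))"
      by (rule bij_betw_imageI) (auto simp: inj_on_def image_iff)
  qed (auto simp: basis_U_sum mult.commute)
  from cls_iso[OF this] show ?thesis by (simp add: tensor_objects cls_tensor)
qed

text \<open>Splitting off the term \<open>m = 0\<close> leaves the series multiplied by sigma times
  \<open>U_{-2}\<close>. Both orders of multiplication are provided because a two-sided inverse is
  to be derived from them.\<close>

lemma cls_U_sum_shift:
  "cls b (U_sum p) = cls b (U True (- 2)) \<otimes>\<^bsub>groth b\<^esub> cls b (U_sum p) \<oplus>\<^bsub>groth b\<^esub> cls b (U False (- p))"
  "cls b (U_sum p) = cls b (U_sum p) \<otimes>\<^bsub>groth b\<^esub> cls b (U True (- 2)) \<oplus>\<^bsub>groth b\<^esub> cls b (U False (- p))"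
proof -
  let ?S = "{n. fst (prod_decode n) \<noteq> 0}"
  have S: "closed_under (U_sum p) ?S"
    by (auto simp: closed_under_def basis_U_sum)
  have pow: "q ^ (2 * Suc m) = q\<^sup>2 * q ^ (2 * m)" "inverse q ^ (2 * Suc m) = inverse q ^ 2 * inverse q ^ (2 * m)" for m
    by (simp_all add: power2_eq_square)
  have two: "qpow bs (- 2) = - (inverse q ^ 2)"
    by (simp add: qpow_minus qpow_bs_two power_inverse)
  have rhs: "n \<in> basis (sub_mod (U_sum p) ?S) \<longleftrightarrow> (\<exists>m. n = prod_encode (Suc m, 0))" for n
    by (cases n rule: prod_encode_cases) (auto simp: basis_U_sum gr0_conv_Suc)
  have 1: "cls b (tensor (U True (- 2)) (U_sum p)) = cls b (sub_mod (U_sum p) ?S)"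
  proof (rule cls_iso)
    define \<phi> where "\<phi> n = (case prod_decode n of (k, l) \<Rightarrow> case prod_decode l of (m, l) \<Rightarrow> prod_encode (Suc m, l))" for n
    have [simp]: "\<phi> (prod_encode (k, prod_encode (m, l))) = prod_encode (Suc m, l)" for k l m by (simp add: \<phi>_def)
    show "short_exact (tensor (U True (- 2)) (U_sum p)) (sub_mod (U_sum p) ?S) zero_bmodule"
    proof (rule short_exact_diagonal[of \<phi>])
      show "bij_betw \<phi> (basis (tensor (U True (- 2)) (U_sum p))) (basis (sub_mod (U_sum p) ?S))"
        unfolding bij_betw_def set_eq_iff rhs by (auto simp: inj_on_def basis_U_sum image_iff)
      fix i n assume "n \<in> basis (tensor (U True (- 2)) (U_sum p))"
      then show "Kev (sub_mod (U_sum p) ?S) i (\<phi> n) = Kev (tensor (U True (- 2)) (U_sum p)) i n"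
        by (cases i) (auto simp: basis_U_sum qpow_bs_two two pow simp del: power_Suc mult_Suc_right)
    qed (auto simp: basis_U_sum)
  qed (use S in \<open>simp_all add: tensor_objects sub_mod_objects\<close>)
  have 2: "cls b (tensor (U_sum p) (U True (- 2))) = cls b (sub_mod (U_sum p) ?S)"
  proof (rule cls_iso)
    define \<phi> where "\<phi> n = (case prod_decode n of (l, k) \<Rightarrow> case prod_decode l of (m, l) \<Rightarrow> prod_encode (Suc m, l))" for n
    have [simp]: "\<phi> (prod_encode (prod_encode (m, l), k)) = prod_encode (Suc m, l)" for k l m by (simp add: \<phi>_def)
    show "short_exact (tensor (U_sum p) (U True (- 2))) (sub_mod (U_sum p) ?S) zero_bmodule"
    proof (rule short_exact_diagonal[of \<phi>])
      show "bij_betw \<phi> (basis (tensor (U_sum p) (U True (- 2)))) (basis (sub_mod (U_sum p) ?S))"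
        unfolding bij_betw_def set_eq_iff rhs by (auto simp: inj_on_def basis_U_sum image_iff)
      fix i n assume "n \<in> basis (tensor (U_sum p) (U True (- 2)))"
      then show "Kev (sub_mod (U_sum p) ?S) i (\<phi> n) = Kev (tensor (U_sum p) (U True (- 2))) i n"
        by (cases i) (auto simp: basis_U_sum qpow_bs_two two pow simp del: power_Suc mult_Suc_right)
    qed (auto simp: basis_U_sum)
  qed (use S in \<open>simp_all add: tensor_objects sub_mod_objects\<close>)
  have 3: "cls b (quo_mod (U_sum p) ?S) = cls b (U False (- p))"
  proof (rule cls_iso)
    have n: "n \<in> basis (quo_mod (U_sum p) ?S) \<longleftrightarrow> n = prod_encode (0, 0)" for n
      by (cases n rule: prod_encode_cases) (auto simp: basis_U_sum)
    show "short_exact (quo_mod (U_sum p) ?S) (U False (- p)) zero_bmodule"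
    proof (rule short_exact_diagonal[of "\<lambda>_. 0"])
      show "bij_betw (\<lambda>_. 0) (basis (quo_mod (U_sum p) ?S)) (basis (U False (- p)))"
      proof -
        have "basis (quo_mod (U_sum p) ?S) = {prod_encode (0, 0)}" using n by blast
        then show ?thesis by (simp only: U_simps) (simp add: bij_betw_def)
      qed
      fix i m assume "m \<in> basis (quo_mod (U_sum p) ?S)"
      then have m: "m = prod_encode (0, 0)" unfolding n .
      show "odd_vec (U False (- p)) 0 = odd_vec (quo_mod (U_sum p) ?S) m"
        "Kev (U False (- p)) i 0 = Kev (quo_mod (U_sum p) ?S) i m"
        "Eact (quo_mod (U_sum p) ?S) i m = 0"
        by (cases i; simp add: m)+
    qed simp
  qed (use S in \<open>simp_all add: quo_mod_objects\<close>)
  have "cls b (U_sum p) = cls b (sub_mod (U_sum p) ?S) \<oplus>\<^bsub>groth b\<^esub> cls b (quo_mod (U_sum p) ?S)"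
    by (rule cls_sub_quo[OF U_sum_objects S])
  then show "cls b (U_sum p) = cls b (U True (- 2)) \<otimes>\<^bsub>groth b\<^esub> cls b (U_sum p) \<oplus>\<^bsub>groth b\<^esub> cls b (U False (- p))"
    "cls b (U_sum p) = cls b (U_sum p) \<otimes>\<^bsub>groth b\<^esub> cls b (U True (- 2)) \<oplus>\<^bsub>groth b\<^esub> cls b (U False (- p))"
    using 1 2 3 by (simp_all add: cls_tensor)
qed


abbreviation "qi \<equiv> inverse q"

section \<open>Decomposition of \<open>\<rho>\<^sub>+ \<otimes> \<rho>\<^sub>-\<close>\<close>

lemma osc_Suc:
  "osc qi (Suc k) = - (qi\<^sup>2) * osc qi k - 1 / (1 + q\<^sup>2)"
  "osc q (Suc k) = - (q\<^sup>2) * osc q k - q\<^sup>2 / (1 + q\<^sup>2)"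
proof -
  have osc: "osc r (Suc k) = - (r / (r + inverse r)) - r\<^sup>2 * osc r k" for r
    by (simp add: algebra_simps power2_eq_square)
  have "qi + inverse qi = (1 + q\<^sup>2) * qi" "q + qi = (1 + q\<^sup>2) * qi"
    by (simp_all add: algebra_simps power2_eq_square)
  then show "osc qi (Suc k) = - (qi\<^sup>2) * osc qi k - 1 / (1 + q\<^sup>2)"
    "osc q (Suc k) = - (q\<^sup>2) * osc q k - q\<^sup>2 / (1 + q\<^sup>2)"
    unfolding osc by (simp_all add: power2_eq_square divide_inverse mult_ac)
qed

text \<open>\<open>Ehat\<close> is E_0 on the tensor product divided by the spectral parameter;
  \<open>Chat\<close> and \<open>Dhat\<close> are the summands of E_1 on the left and on the right
  factor, likewise divided. \<open>g\<close> and \<open>g'\<close> are the relative shifts of the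
  factors. Dividing keeps the basis constructed from \<open>Ehat\<close> intact when the parameter
  is 0.\<close>

definition Ehat :: "complex \<Rightarrow> complex \<Rightarrow> nat \<Rightarrow> vec" where
  "Ehat g g' n = (case prod_decode n of (k, l) \<Rightarrow>
     Poly_Mapping.single (prod_encode (Suc k, l)) (g * q ^ (2 * l)) +
     Poly_Mapping.single (prod_encode (k, Suc l)) ((- 1) ^ k * g'))"

definition Chat :: "complex \<Rightarrow> nat \<Rightarrow> vec" where
  "Chat g n = (case prod_decode n of (k, l) \<Rightarrow>
     Poly_Mapping.single (prod_encode (k - 1, l)) (g * qi ^ (2 * l) * osc qi k))"

definition Dhat :: "complex \<Rightarrow> nat \<Rightarrow> vec" where
  "Dhat g' n = (case prod_decode n of (k, l) \<Rightarrow>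
     Poly_Mapping.single (prod_encode (k, l - 1)) ((- 1) ^ k * g' * osc q l))"

lemma hat_simps [simp]:
  "Ehat g g' (prod_encode (k, l)) =
     Poly_Mapping.single (prod_encode (Suc k, l)) (g * q ^ (2 * l)) +
     Poly_Mapping.single (prod_encode (k, Suc l)) ((- 1) ^ k * g')"
  "Chat g (prod_encode (k, l)) = Poly_Mapping.single (prod_encode (k - 1, l)) (g * qi ^ (2 * l) * osc qi k)"
  "Dhat g' (prod_encode (k, l)) = Poly_Mapping.single (prod_encode (k, l - 1)) ((- 1) ^ k * g' * osc q l)"
  by (simp_all add: Ehat_def Chat_def Dhat_def)

text \<open>Past the left summand of \<open>Ehat\<close>, \<open>Chat\<close> produces the
  oscillator constant; past the right one it only picks up a factor. Both times the factor is
  \<open>- (qi^2)\<close>, so \<open>Ehat\<close> need not be split any further.\<close>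

lemma Chat_Ehat:
  "lin (Chat g) (Ehat g g' n) =
     smul (- (qi\<^sup>2)) (lin (Ehat g g') (Chat g n)) - smul (g\<^sup>2 / (1 + q\<^sup>2)) (bvec n)"
proof (cases n rule: prod_encode_cases)
  case (1 k l)
  have qq: "q ^ m * qi ^ m = 1" for m by (simp flip: power_mult_distrib)
  have a: "g * q ^ (2 * l) * (g * qi ^ (2 * l) * osc qi (Suc k)) =
     - (qi\<^sup>2) * (g * qi ^ (2 * l) * osc qi k * (g * q ^ (2 * l))) - g\<^sup>2 / (1 + q\<^sup>2)"
  proof -
    have e: "g * q ^ (2 * l) * (g * qi ^ (2 * l) * osc qi (Suc k)) = (q ^ (2 * l) * qi ^ (2 * l)) * (g\<^sup>2 * osc qi (Suc k))"
      "g * qi ^ (2 * l) * osc qi k * (g * q ^ (2 * l)) = (q ^ (2 * l) * qi ^ (2 * l)) * (g\<^sup>2 * osc qi k)"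
      by (simp_all only: power2_eq_square mult_ac)
    show ?thesis unfolding e unfolding qq osc_Suc by (simp add: algebra_simps)
  qed
  have b: "(- 1) ^ k * g' * (g * qi ^ (2 * Suc l) * osc qi k) =
     - (qi\<^sup>2) * (g * qi ^ (2 * l) * osc qi k * ((- 1) ^ (k - 1) * g'))"
    by (cases k) (simp_all add: power2_eq_square del: osc.simps(2))
  have "lin (Chat g) (Ehat g g' n) =
     Poly_Mapping.single (prod_encode (k, l)) (g * q ^ (2 * l) * (g * qi ^ (2 * l) * osc qi (Suc k))) +
     Poly_Mapping.single (prod_encode (k - 1, Suc l)) ((- 1) ^ k * g' * (g * qi ^ (2 * Suc l) * osc qi k))"
    by (simp add: 1 lin_add del: osc.simps power_Suc mult_Suc_right)
  also have "\<dots> = smul (- (qi\<^sup>2)) (lin (Ehat g g') (Chat g n)) - smul (g\<^sup>2 / (1 + q\<^sup>2)) (bvec n)"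
    unfolding a b single_diff by (cases k) (simp_all add: 1 smul_add mult_ac del: osc.simps(2))
  finally show ?thesis .
qed

text \<open>Mirror image of \<open>Chat_Ehat\<close>: the oscillator constant now comes from the
  right summand, and the common factor is \<open>- (q^2)\<close>.\<close>

lemma Dhat_Ehat:
  "lin (Dhat g') (Ehat g g' n) =
     smul (- (q\<^sup>2)) (lin (Ehat g g') (Dhat g' n)) - smul (g'\<^sup>2 * q\<^sup>2 / (1 + q\<^sup>2)) (bvec n)"
proof (cases n rule: prod_encode_cases)
  case (1 k l)
  have a: "(- 1) ^ k * g' * ((- 1) ^ k * g' * osc q (Suc l)) =
     - (q\<^sup>2) * ((- 1) ^ k * g' * osc q l * ((- 1) ^ k * g')) - g'\<^sup>2 * q\<^sup>2 / (1 + q\<^sup>2)"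
  proof -
    have e: "(- 1) ^ k * g' * ((- 1) ^ k * g' * osc q (Suc l)) = ((- 1) ^ k * (- 1) ^ k) * (g'\<^sup>2 * osc q (Suc l))"
      "(- 1) ^ k * g' * osc q l * ((- 1) ^ k * g') = ((- 1) ^ k * (- 1) ^ k) * (g'\<^sup>2 * osc q l)"
      by (simp_all only: power2_eq_square mult_ac)
    show ?thesis unfolding e unfolding osc_Suc by (simp add: algebra_simps flip: power_add)
  qed
  have b: "g * q ^ (2 * l) * ((- 1) ^ Suc k * g' * osc q l) =
     - (q\<^sup>2) * ((- 1) ^ k * g' * osc q l * (g * q ^ (2 * (l - 1))))"
    by (cases l) (simp_all add: power2_eq_square del: osc.simps(2))
  have "lin (Dhat g') (Ehat g g' n) =
     Poly_Mapping.single (prod_encode (Suc k, l - 1)) (g * q ^ (2 * l) * ((- 1) ^ Suc k * g' * osc q l)) +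
     Poly_Mapping.single (prod_encode (k, l)) ((- 1) ^ k * g' * ((- 1) ^ k * g' * osc q (Suc l)))"
    by (simp add: 1 lin_add del: osc.simps power_Suc)
  also have "\<dots> = smul (- (q\<^sup>2)) (lin (Ehat g g') (Dhat g' n)) - smul (g'\<^sup>2 * q\<^sup>2 / (1 + q\<^sup>2)) (bvec n)"
    unfolding a b single_diff by (cases l) (simp_all add: 1 smul_add mult_ac del: osc.simps(2))
  finally show ?thesis .
qed

text \<open>Powers of \<open>Ehat\<close> on \<open>|m> (x) |0>\<close>, with a sign at each step.
  Layer \<open>m\<close> is to become an odd or even one-dimensional module tensored with
  \<open>V_mod\<close>, where E_0 passes a left vector of parity \<open>m\<close>; the sign makes
  the action match this convention.\<close>

primrec cyc :: "complex \<Rightarrow> complex \<Rightarrow> nat \<Rightarrow> nat \<Rightarrow> vec" where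
  "cyc g g' m 0 = bvec (prod_encode (m, 0))"
| "cyc g g' m (Suc j) = smul ((- 1) ^ m) (lin (Ehat g g') (cyc g g' m j))"

lemma Ehat_cyc: "lin (Ehat g g') (cyc g g' m j) = smul ((- 1) ^ m) (cyc g g' m (Suc j))"
  by (simp flip: power_add)

text \<open>Closed form of \<open>1 + x + ... + x ^ (j - 1)\<close>, which accumulates when an
  operator is moved past \<open>j\<close> copies of \<open>Ehat\<close>.\<close>

definition geom :: "complex \<Rightarrow> nat \<Rightarrow> complex" where
  "geom x j = (1 - x ^ j) / (1 - x)"

lemma geom_0 [simp]: "geom x 0 = 0" by (simp add: geom_def)

lemma geom_Suc: "x \<noteq> 1 \<Longrightarrow> geom x (Suc j) = x * geom x j + 1"
  by (simp add: geom_def divide_simps) (simp add: algebra_simps)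

lemma lin_smul_left: "lin (\<lambda>n. smul c (f n) - smul d (h n)) v = smul c (lin f v) - smul d (lin h v)"
  by (simp add: lin_fun_diff lin_fun_smul)

text \<open>Moving \<open>Chat\<close> through all copies of \<open>Ehat\<close> lets it act on
  \<open>|m> (x) |0>\<close>, which lowers \<open>m\<close>; the scalars left behind sum to
  \<open>geom\<close>.\<close>

lemma Chat_cyc:
  "lin (Chat g) (cyc g g' m j) =
     smul (qi ^ (2 * j) * g * osc qi m) (cyc g g' (m - 1) j) -
     smul ((- 1) ^ m * (g\<^sup>2 / (1 + q\<^sup>2)) * geom (- (qi\<^sup>2)) j) (cyc g g' m (j - 1))"
proof (induction j)
  case (Suc j)
  let ?c = "g\<^sup>2 / (1 + q\<^sup>2)" and ?w = "cyc g g'"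
  have ne: "- (qi\<^sup>2) \<noteq> 1"
    using one_plus_q2(2) by (metis add.right_inverse minus_minus)
  have s: "(- 1 :: complex) ^ m * (- 1) ^ m = 1" by (simp flip: power_add)
  have "lin (Chat g) (?w m (Suc j)) = smul ((- 1) ^ m)
      (smul (- (qi\<^sup>2)) (lin (Ehat g g') (lin (Chat g) (?w m j))) - smul ?c (?w m j))"
    by (simp only: cyc.simps lin_smul lin_lin Chat_Ehat lin_smul_left lin_bvec)
  also have "\<dots> = smul ((- 1) ^ m * (- (qi\<^sup>2)) * (qi ^ (2 * j) * g * osc qi m) * (- 1) ^ (m - 1)) (?w (m - 1) (Suc j)) -
      (smul ((- 1) ^ m * (- (qi\<^sup>2)) * ((- 1) ^ m * ?c * geom (- (qi\<^sup>2)) j)) (lin (Ehat g g') (?w m (j - 1))) + smul ((- 1) ^ m * ?c) (?w m j))"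
    unfolding Suc lin_diff lin_smul Ehat_cyc smul_diff smul_simps(5) by (simp add: mult_ac)
  also have "smul ((- 1) ^ m * (- (qi\<^sup>2)) * ((- 1) ^ m * ?c * geom (- (qi\<^sup>2)) j)) (lin (Ehat g g') (?w m (j - 1))) + smul ((- 1) ^ m * ?c) (?w m j)
      = smul ((- 1) ^ m * ?c * geom (- (qi\<^sup>2)) (Suc j)) (?w m j)"
  proof (cases j)
    case 0
    then show ?thesis by (simp add: geom_Suc[OF ne])
  next
    case (Suc i)
    have "(- 1) ^ m * (- (qi\<^sup>2)) * ((- 1) ^ m * ?c * geom (- (qi\<^sup>2)) j) * (- 1) ^ m + (- 1) ^ m * ?c =
       (- 1) ^ m * ?c * (((- 1) ^ m * (- 1) ^ m) * ((- (qi\<^sup>2)) * geom (- (qi\<^sup>2)) j) + 1)"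
      by (simp only: ring_distribs mult_ac mult_1_right mult_1_left)
    then show ?thesis
      unfolding Suc diff_Suc_1 Ehat_cyc smul_simps(5) smul_left_add[symmetric] s by (simp only: geom_Suc[OF ne] mult_1_left)
  qed
  \<comment> \<open>Layers \<open>m\<close> and \<open>m - 1\<close> have opposite signs per step,
    which turns the factor \<open>- (qi^2)\<close> into \<open>qi^2\<close>. For
    \<open>m = 0\<close> both sides vanish with \<open>osc qi 0\<close>.\<close>
  also have "(- 1) ^ m * (- (qi\<^sup>2)) * (qi ^ (2 * j) * g * osc qi m) * (- 1) ^ (m - 1) = qi ^ (2 * Suc j) * g * osc qi m"
    by (cases m) (simp_all add: power2_eq_square del: osc.simps(2) flip: power_add)
  finally show ?case by simp
qed simp

text \<open>The right factor of \<open>|m> (x) |0>\<close> is annihilated, so only the accumulated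
  scalars remain and the layer is unchanged.\<close>

lemma Dhat_cyc:
  "lin (Dhat g') (cyc g g' m j) =
     - smul ((- 1) ^ m * (g'\<^sup>2 * q\<^sup>2 / (1 + q\<^sup>2)) * geom (- (q\<^sup>2)) j) (cyc g g' m (j - 1))"
proof (induction j)
  case (Suc j)
  let ?c = "g'\<^sup>2 * q\<^sup>2 / (1 + q\<^sup>2)" and ?w = "cyc g g'"
  have ne: "- (q\<^sup>2) \<noteq> 1"
    using one_plus_q2(1) by (metis add.right_inverse minus_minus)
  have s: "(- 1 :: complex) ^ m * (- 1) ^ m = 1" by (simp flip: power_add)
  have um: "lin f (- v) = - lin f v" "smul c (- v) = - smul c v" for f c v
    using lin_diff[of f 0 v] smul_diff[of c 0 v] by simp_all
  have "lin (Dhat g') (?w m (Suc j)) = smul ((- 1) ^ m)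
      (smul (- (q\<^sup>2)) (lin (Ehat g g') (lin (Dhat g') (?w m j))) - smul ?c (?w m j))"
    by (simp only: cyc.simps lin_smul lin_lin Dhat_Ehat lin_smul_left lin_bvec)
  also have "\<dots> = - (smul ((- 1) ^ m * (- (q\<^sup>2)) * ((- 1) ^ m * ?c * geom (- (q\<^sup>2)) j)) (lin (Ehat g g') (?w m (j - 1))) + smul ((- 1) ^ m * ?c) (?w m j))"
    unfolding Suc um lin_smul smul_diff smul_simps(5) by (simp add: mult_ac)
  also have "smul ((- 1) ^ m * (- (q\<^sup>2)) * ((- 1) ^ m * ?c * geom (- (q\<^sup>2)) j)) (lin (Ehat g g') (?w m (j - 1))) + smul ((- 1) ^ m * ?c) (?w m j)
      = smul ((- 1) ^ m * ?c * geom (- (q\<^sup>2)) (Suc j)) (?w m j)"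
  proof (cases j)
    case 0
    then show ?thesis by (simp add: geom_Suc[OF ne])
  next
    case (Suc i)
    have "(- 1) ^ m * (- (q\<^sup>2)) * ((- 1) ^ m * ?c * geom (- (q\<^sup>2)) j) * (- 1) ^ m + (- 1) ^ m * ?c =
       (- 1) ^ m * ?c * (((- 1) ^ m * (- 1) ^ m) * ((- (q\<^sup>2)) * geom (- (q\<^sup>2)) j) + 1)"
      by (simp only: ring_distribs mult_ac mult_1_right mult_1_left)
    then show ?thesis
      unfolding Suc diff_Suc_1 Ehat_cyc smul_simps(5) smul_left_add[symmetric] s by (simp only: geom_Suc[OF ne] mult_1_left)
  qed
  finally show ?case by simp
qed simp

section \<open>The vectors \<open>cyc\<close> form a basis\<close>

lemma lookup_Ehat:
  "Poly_Mapping.lookup (lin (Ehat g g') v) (prod_encode (k, l)) =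
     (if k = 0 then 0 else g * q ^ (2 * l) * Poly_Mapping.lookup v (prod_encode (k - 1, l))) +
     (if l = 0 then 0 else (- 1) ^ k * g' * Poly_Mapping.lookup v (prod_encode (k, l - 1)))"
proof -
  let ?x = "prod_encode (k - 1, l)" and ?y = "prod_encode (k, l - 1)"
  have "Poly_Mapping.lookup (Ehat g g' n) (prod_encode (k, l)) =
     (if n = ?x then if k = 0 then 0 else g * q ^ (2 * l) else 0) +
     (if n = ?y then if l = 0 then 0 else (- 1) ^ k * g' else 0)" for n
    by (cases n rule: prod_encode_cases) (auto simp: lookup_add lookup_single when_def)
  then have "Poly_Mapping.lookup (lin (Ehat g g') v) (prod_encode (k, l)) =
     (\<Sum>n\<in>Poly_Mapping.keys v. if n = ?x then Poly_Mapping.lookup v n * (if k = 0 then 0 else g * q ^ (2 * l)) else 0) +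
     (\<Sum>n\<in>Poly_Mapping.keys v. if n = ?y then Poly_Mapping.lookup v n * (if l = 0 then 0 else (- 1) ^ k * g') else 0)"
    unfolding lookup_lin sum.distrib[symmetric] by (intro sum.cong) (auto simp: ring_distribs)
  then show ?thesis by (simp add: in_keys_iff)
qed

text \<open>Every application of \<open>Ehat\<close> raises exactly one of the two indices, so the
  total degree is fixed and the right index is at most the number of applications.\<close>

lemma lookup_cyc:
  "Poly_Mapping.lookup (cyc g g' m j) (prod_encode (k, l)) \<noteq> 0 \<Longrightarrow> k + l = m + j \<and> l \<le> j"
proof (induction j arbitrary: k l)
  case 0
  then show ?case by (auto simp: lookup_single when_def split: if_splits)
next
  case (Suc j)
  then have "k \<noteq> 0 \<and> Poly_Mapping.lookup (cyc g g' m j) (prod_encode (k - 1, l)) \<noteq> 0 \<or>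
     l \<noteq> 0 \<and> Poly_Mapping.lookup (cyc g g' m j) (prod_encode (k, l - 1)) \<noteq> 0"
    by (auto simp: lookup_Ehat split: if_splits)
  then show ?case using Suc.IH[of "k - 1" l] Suc.IH[of k "l - 1"] by auto
qed

text \<open>The extreme label is reached only by using the right summand of \<open>Ehat\<close> each
  time, which gives a power of \<open>g'\<close> up to sign.\<close>

lemma lookup_cyc_diag:
  assumes "g' \<noteq> 0"
  shows "Poly_Mapping.lookup (cyc g g' m j) (prod_encode (m, j)) \<noteq> 0"
proof (induction j)
  case (Suc j)
  have "Poly_Mapping.lookup (cyc g g' m j) (prod_encode (m - 1, Suc j)) = 0"
    using lookup_cyc[of g g' m j "m - 1" "Suc j"] by auto
  then show ?case using Suc assms by (cases "m = 0") (simp_all add: lookup_Ehat)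
qed simp

definition cycmap :: "complex \<Rightarrow> complex \<Rightarrow> nat \<Rightarrow> vec" where
  "cycmap g g' n = (case prod_decode n of (m, j) \<Rightarrow> cyc g g' m j)"

lemma cycmap_simp [simp]: "cycmap g g' (prod_encode (m, j)) = cyc g g' m j"
  by (simp add: cycmap_def)

text \<open>Triangularity: take a label of the support with maximal second index \<open>j\<close>.
  At the position \<open>(m, j)\<close> no other vector contributes, since equality of total degrees
  would force a larger second index or the same label.\<close>

lemma cycmap_inj:
  assumes g': "g' \<noteq> 0" and v: "lin (cycmap g g') v = 0"
  shows "v = 0"
proof (rule ccontr)
  assume "v \<noteq> 0"
  then have ne: "Poly_Mapping.keys v \<noteq> {}" by simp
  let ?h = "\<lambda>n. snd (prod_decode n)"
  have "Max (?h ` Poly_Mapping.keys v) \<in> ?h ` Poly_Mapping.keys v"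
    using ne by (intro Max_in) auto
  then obtain n where n: "n \<in> Poly_Mapping.keys v" "?h n = Max (?h ` Poly_Mapping.keys v)" by auto
  obtain m j where mj: "n = prod_encode (m, j)" by (cases n rule: prod_encode_cases)
  have max: "?h n' \<le> j" if "n' \<in> Poly_Mapping.keys v" for n'
    using Max_ge[of "?h ` Poly_Mapping.keys v" "?h n'"] that n(2) mj by simp
  have "Poly_Mapping.lookup v n' * Poly_Mapping.lookup (cycmap g g' n') n =
      (if n' = n then Poly_Mapping.lookup v n * Poly_Mapping.lookup (cyc g g' m j) n else 0)"
    if n': "n' \<in> Poly_Mapping.keys v" for n'
  proof (cases n' rule: prod_encode_cases)
    case (1 m' j')
    then show ?thesis
      using max[OF n'] lookup_cyc[of g g' m' j' m j] unfolding mj by (cases "j' = j") auto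
  qed
  then have "Poly_Mapping.lookup (lin (cycmap g g') v) n = Poly_Mapping.lookup v n * Poly_Mapping.lookup (cyc g g' m j) n"
    unfolding lookup_lin using n(1) by simp
  then show False using v n(1) lookup_cyc_diag[OF g'] by (simp add: mj in_keys_iff)
qed

text \<open>Triangularity again: \<open>cyc g g' m j\<close> is a nonzero multiple of the basis
  vector \<open>(m, j)\<close> plus vectors with smaller second index, which are reached by
  induction.\<close>

lemma cycmap_surj:
  assumes g': "g' \<noteq> 0"
  shows "bvec (prod_encode (m, j)) \<in> range (lin (cycmap g g'))"
proof (induction j arbitrary: m rule: less_induct)
  case (less j)
  define d where "d = Poly_Mapping.lookup (cyc g g' m j) (prod_encode (m, j))"
  define r where "r = cyc g g' m j - smul d (bvec (prod_encode (m, j)))"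
  have "\<exists>v. lin (cycmap g g') v = bvec n" if "n \<in> Poly_Mapping.keys r" for n
  proof (cases n rule: prod_encode_cases)
    case (1 k l)
    have r: "Poly_Mapping.lookup r (prod_encode (k, l)) \<noteq> 0" using that 1 by (simp add: in_keys_iff)
    then have "(k, l) \<noteq> (m, j)" by (auto simp: r_def d_def lookup_minus)
    then have "Poly_Mapping.lookup (cyc g g' m j) (prod_encode (k, l)) \<noteq> 0"
      using r by (auto simp: r_def lookup_minus lookup_single when_def)
    then have "l < j" using lookup_cyc[of g g' m j k l] \<open>(k, l) \<noteq> (m, j)\<close> by auto
    from less.IH[OF this, of k] show ?thesis unfolding 1 image_iff by metis
  qed
  then obtain p where p: "\<And>n. n \<in> Poly_Mapping.keys r \<Longrightarrow> lin (cycmap g g') (p n) = bvec n" by metis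
  have "lin (cycmap g g') (lin p r) = lin bvec r"
    unfolding lin_lin by (rule lin_cong) (rule p)
  then have "lin (cycmap g g') (smul (inverse d) (bvec (prod_encode (m, j)) - lin p r)) =
      smul (inverse d) (smul d (bvec (prod_encode (m, j))))"
    by (simp add: lin_smul lin_diff r_def)
  also have "\<dots> = bvec (prod_encode (m, j))"
    using lookup_cyc_diag[OF g'] by (simp add: d_def)
  finally show ?case by (metis rangeI)
qed

section \<open>The tensor product in the basis \<open>cyc\<close>\<close>

lemma rho_simps:
  "basis (rho_plus b \<mu>) = UNIV" "odd_vec (rho_plus b \<mu>) = odd"
  "Eact (rho_plus b \<mu>) N0 k = Poly_Mapping.single (Suc k) \<mu>"
  "Eact (rho_plus b \<mu>) N1 k = Poly_Mapping.single (k - 1) (\<mu> * osc qi k)"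
  "Kev (rho_plus b \<mu>) N0 k = q ^ (2 * k)" "Kev (rho_plus b \<mu>) N1 k = qi ^ (2 * k)"
  "basis (rho_minus b \<mu>) = UNIV" "odd_vec (rho_minus b \<mu>) = odd"
  "Eact (rho_minus b \<mu>) N0 k = Poly_Mapping.single (Suc k) \<mu>"
  "Eact (rho_minus b \<mu>) N1 k = Poly_Mapping.single (k - 1) (\<mu> * osc q k)"
  "Kev (rho_minus b \<mu>) N0 k = q ^ (2 * k)" "Kev (rho_minus b \<mu>) N1 k = qi ^ (2 * k)"
  by (simp_all add: rho_plus_def rho_minus_def create_def annihilate_def qpow_b_even qpow_minus[of b 1])

definition rho_tensor :: "complex \<Rightarrow> complex \<Rightarrow> complex \<Rightarrow> bmodule" where
  "rho_tensor g g' lam = tensor (rho_plus b (g * lam)) (rho_minus b (g' * lam))"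

lemma rho_tensor_simps:
  "basis (rho_tensor g g' lam) = UNIV"
  "odd_vec (rho_tensor g g' lam) (prod_encode (k, l)) = odd (k + l)"
  "Kev (rho_tensor g g' lam) N0 (prod_encode (k, l)) = q ^ (2 * (k + l))"
  "Kev (rho_tensor g g' lam) N1 (prod_encode (k, l)) = qi ^ (2 * (k + l))"
  "Eact (rho_tensor g g' lam) N0 n = smul lam (Ehat g g' n)"
  "Eact (rho_tensor g g' lam) N1 n = smul lam (Chat g n + Dhat g' n)"
proof -
  show "basis (rho_tensor g g' lam) = UNIV"
    using surj_prod_encode by (simp add: rho_tensor_def rho_simps)
  show "odd_vec (rho_tensor g g' lam) (prod_encode (k, l)) = odd (k + l)"
    "Kev (rho_tensor g g' lam) N0 (prod_encode (k, l)) = q ^ (2 * (k + l))"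
    "Kev (rho_tensor g g' lam) N1 (prod_encode (k, l)) = qi ^ (2 * (k + l))"
    by (auto simp: rho_tensor_def rho_simps distrib_left power_add)
  have sgn: "psgn (rho_plus b \<mu>) k = (- 1) ^ k" for \<mu> k
    by (simp add: psgn_def rho_simps)
  show "Eact (rho_tensor g g' lam) N0 n = smul lam (Ehat g g' n)"
    "Eact (rho_tensor g g' lam) N1 n = smul lam (Chat g n + Dhat g' n)"
    by (cases n rule: prod_encode_cases; simp add: rho_tensor_def rho_simps sgn tvec_single smul_add mult_ac)+
qed

lemma rho_tensor_objects: "rho_tensor g g' lam \<in> objects b"
  unfolding rho_tensor_def by (intro tensor_objects rho_plus_objects rho_minus_objects)

text \<open>\<open>\<rho>\<^sub>+ \<otimes> \<rho>\<^sub>-\<close> in the basis \<^term>\<open>cyc\<close>, for which \<open>\<E>\<^sub>1\<close> does not raise the first index.\<close>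

definition cyclic_mod :: "complex \<Rightarrow> complex \<Rightarrow> complex \<Rightarrow> complex \<Rightarrow> bmodule" where
  "cyclic_mod g g' z lam = (rho_tensor g g' lam)\<lparr>Eact := (\<lambda>i n. case prod_decode n of (m, j) \<Rightarrow> case i of
       N0 \<Rightarrow> Poly_Mapping.single (prod_encode (m, Suc j)) ((- 1) ^ m * lam)
     | N1 \<Rightarrow> Poly_Mapping.single (prod_encode (m, j - 1)) ((- 1) ^ m * lam * (qnum bs (of_nat j) * qnum bs (z - of_nat j + 1))) +
        Poly_Mapping.single (prod_encode (m - 1, j)) (lam * (qi ^ (2 * j) * g * osc qi m)))\<rparr>"

lemma cyclic_mod_simps [simp]:
  "basis (cyclic_mod g g' z lam) = UNIV"
  "odd_vec (cyclic_mod g g' z lam) = odd_vec (rho_tensor g g' lam)"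
  "Kev (cyclic_mod g g' z lam) = Kev (rho_tensor g g' lam)"
  "Eact (cyclic_mod g g' z lam) N0 (prod_encode (m, j)) = Poly_Mapping.single (prod_encode (m, Suc j)) ((- 1) ^ m * lam)"
  "Eact (cyclic_mod g g' z lam) N1 (prod_encode (m, j)) =
     Poly_Mapping.single (prod_encode (m, j - 1)) ((- 1) ^ m * lam * (qnum bs (of_nat j) * qnum bs (z - of_nat j + 1))) +
     Poly_Mapping.single (prod_encode (m - 1, j)) (lam * (qi ^ (2 * j) * g * osc qi m))"
  by (simp_all add: cyclic_mod_def rho_tensor_simps)

text \<open>This is the reason for the shifts by q_*^((z+1)/2) and its inverse: with these squares
  the scalars left behind by \<open>Chat\<close> and \<open>Dhat\<close> combine into the
  coefficient of \<open>V_mod\<close>.\<close>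

lemma qnum_product_geom:
  assumes g: "g\<^sup>2 = qpow bs (z + 1)" "g'\<^sup>2 = qpow bs (- (z + 1))"
  shows "qnum bs (of_nat j) * qnum bs (z - of_nat j + 1) =
     - (g\<^sup>2 / (1 + q\<^sup>2) * geom (- (qi\<^sup>2)) j + g'\<^sup>2 * q\<^sup>2 / (1 + q\<^sup>2) * geom (- (q\<^sup>2)) j)"
proof -
  define S T where "S = 1 + q\<^sup>2" and "T = 1 + qi\<^sup>2"
  define X Y where "X = (- (q\<^sup>2)) ^ j" and "Y = (- (qi\<^sup>2)) ^ j"
  have ne: "S \<noteq> 0" "T \<noteq> 0" using one_plus_q2 by (simp_all add: S_def T_def)
  have PQ: "q\<^sup>2 * qi\<^sup>2 = 1" by (simp flip: power_mult_distrib)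
  have QT: "q\<^sup>2 = S / T" using ne PQ by (simp add: S_def T_def field_simps)
  \<comment> \<open>As q_*^2 = -q^2, the square of the denominator of \<open>qnum\<close> is the
    negative of the product of the denominators of the oscillator constants for \<open>q\<close> and
    \<open>inverse q\<close>.\<close>
  have "(qpow bs 1 - qpow bs (- 1))\<^sup>2 = qpow bs 2 + qpow bs (- 2) - 2 * (qpow bs 1 * qpow bs (- 1))"
    unfolding power2_eq_square ring_distribs left_diff_distrib right_diff_distrib qpow_add[symmetric] by simp
  also have "\<dots> = - (S * T)"
    using PQ by (simp add: qpow_minus qpow_bs_two S_def T_def algebra_simps power_inverse)
  finally have d: "(qpow bs 1 - qpow bs (- 1))\<^sup>2 = - (S * T)" .
  have "qnum bs (of_nat j) * qnum bs (z - of_nat j + 1) =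
     (g\<^sup>2 + g'\<^sup>2) / - (S * T) + - g'\<^sup>2 / - (S * T) * X + - g\<^sup>2 / - (S * T) * Y"
    unfolding qnum_product_eq d g X_def Y_def ..
  also have "\<dots> = - (g\<^sup>2 / S * ((1 - Y) / T) + g'\<^sup>2 * (S / T) / S * ((1 - X) / S))"
    using ne by (simp add: divide_simps) (simp add: algebra_simps)
  also have "\<dots> = - (g\<^sup>2 / S * geom (- (qi\<^sup>2)) j + g'\<^sup>2 * q\<^sup>2 / S * geom (- (q\<^sup>2)) j)"
    unfolding QT[symmetric] by (simp add: geom_def X_def Y_def S_def T_def)
  finally show ?thesis unfolding S_def .
qed

lemma cycmap_bhom:
  assumes g: "g\<^sup>2 = qpow bs (z + 1)" "g'\<^sup>2 = qpow bs (- (z + 1))"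
  shows "cycmap g g' \<in> bhom (cyclic_mod g g' z lam) (rho_tensor g g' lam)"
proof -
  let ?T = "rho_tensor g g' lam" and ?w = "cyc g g'"
  have E0: "Eop ?T N0 v = smul lam (lin (Ehat g g') v)" for v
    by (simp add: Eop_def ext[OF rho_tensor_simps(5)] lin_fun_smul)
  have E1: "Eop ?T N1 v = smul lam (lin (Chat g) v + lin (Dhat g') v)" for v
    by (simp add: Eop_def ext[OF rho_tensor_simps(6)] lin_fun_smul lin_fun_add)
  have "lin (cycmap g g') (Eact (cyclic_mod g g' z lam) i (prod_encode (m, j))) = Eop ?T i (?w m j)" for i m j
  proof (cases i)
    case N0
    have "(- 1) ^ m * lam * (- 1) ^ m = lam"
      by (simp add: mult.commute[of _ lam] mult.assoc flip: power_add)
    then show ?thesis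
      by (simp only: N0 E0 cyclic_mod_simps lin_single cycmap_simp cyc.simps smul_simps(5))
  next
    case N1
    have "lin (cycmap g g') (Eact (cyclic_mod g g' z lam) i (prod_encode (m, j))) =
      smul ((- 1) ^ m * lam * (qnum bs (of_nat j) * qnum bs (z - of_nat j + 1))) (?w m (j - 1)) +
      smul (lam * (qi ^ (2 * j) * g * osc qi m)) (?w (m - 1) j)"
      by (simp add: N1 lin_add)
    also have "\<dots> = Eop ?T i (?w m j)"
      unfolding qnum_product_geom[OF g] N1 E1 Chat_cyc Dhat_cyc
      by (rule poly_mapping_eqI) (simp add: lookup_add lookup_minus algebra_simps)
    finally show ?thesis .
  qed
  \<comment> \<open>Parity and both eigenvalues depend only on the total degree, so vectors
    supported in a single degree are homogeneous.\<close>
  moreover have "n' \<in> Poly_Mapping.keys (?w m j) \<Longrightarrow> \<exists>k l. n' = prod_encode (k, l) \<and> k + l = m + j" for n' m j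
    using lookup_cyc[of g g' m j] by (cases n' rule: prod_encode_cases) (auto simp: in_keys_iff)
  then have "odd_vec ?T n' = odd_vec ?T (prod_encode (m, j))" "Kev ?T i n' = Kev ?T i (prod_encode (m, j))"
    if "n' \<in> Poly_Mapping.keys (?w m j)" for i n' m j
    using that by (fastforce simp: rho_tensor_simps, cases i) (fastforce simp: rho_tensor_simps)+
  moreover have *: "(\<forall>n\<in>basis (cyclic_mod g g' z lam). P n) \<longleftrightarrow> (\<forall>m j. P (prod_encode (m, j)))" for P
    by (metis UNIV_I cyclic_mod_simps(1) prod_encode_cases)
  ultimately show ?thesis
    unfolding bhom_iff vspace_def * by (auto simp: rho_tensor_simps(1))
qed

text \<open>The Serre relations are inherited from the tensor product along the change of basis, and
  the weights are unchanged.\<close>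

lemma cyclic_mod_objects:
  assumes g: "g\<^sup>2 = qpow bs (z + 1)" "g'\<^sup>2 = qpow bs (- (z + 1))" and g': "g' \<noteq> 0"
  shows "cyclic_mod g g' z lam \<in> objects b"
proof -
  have "is_bmodule q (cyclic_mod g g' z lam)"
    using rho_tensor_objects unfolding objects_def mem_Collect_eq
    by (rule is_bmodule_pullback[OF in_O_bmodule cycmap_bhom[OF g] cycmap_inj[OF g']]) (auto simp: vspace_def)
  then show ?thesis
    using in_O_subweights[of q "rho_tensor g g' lam" "cyclic_mod g g' z lam"] rho_tensor_objects[of g g' lam]
    by (simp add: objects_def rho_tensor_simps(1))
qed

lemma cls_cyclic_mod:
  assumes g: "g\<^sup>2 = qpow bs (z + 1)" "g'\<^sup>2 = qpow bs (- (z + 1))" and g': "g' \<noteq> 0"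
  shows "cls b (cyclic_mod g g' z lam) = cls b (rho_tensor g g' lam)"
proof (rule cls_iso)
  show "short_exact (cyclic_mod g g' z lam) (rho_tensor g g' lam) zero_bmodule"
  proof (rule short_exact_bij[OF cycmap_bhom[OF g] cycmap_inj[OF g']])
    fix n show "bvec n \<in> lin (cycmap g g') ` vspace (cyclic_mod g g' z lam)"
      using cycmap_surj[OF g'] by (cases n rule: prod_encode_cases) (simp add: vspace_def)
  qed
qed (simp_all add: cyclic_mod_objects[OF assms] rho_tensor_objects)


lemma V_simps:
  "basis (V_mod z \<mu>) = UNIV" "odd_vec (V_mod z \<mu>) = odd"
  "Eact (V_mod z \<mu>) N0 k = Poly_Mapping.single (Suc k) \<mu>"
  "Eact (V_mod z \<mu>) N1 k = Poly_Mapping.single (k - 1) (\<mu> * (qnum bs (of_nat k) * qnum bs (z - of_nat k + 1)))"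
  "Kev (V_mod z \<mu>) N0 k = qpow bs (- z) * q ^ (2 * k)" "Kev (V_mod z \<mu>) N1 k = qpow bs z * qi ^ (2 * k)"
  by (simp_all add: V_mod_def sign_Kev)

lemma restr_single: "restr T (Poly_Mapping.single n a) = (if n \<in> T then Poly_Mapping.single n a else 0)"
  by (simp add: restr_def)

lemma restr_add: "restr T (v + w) = restr T v + restr T w"
  by (simp add: restr_def lin_add)

lemma cls_rho_tensor:
  assumes g: "g\<^sup>2 = qpow bs (of_int p + 1)" "g'\<^sup>2 = qpow bs (- (of_int p + 1))" and g': "g' \<noteq> 0"
  shows "cls b (rho_tensor g g' lam) = cls b (U_sum p) \<otimes>\<^bsub>groth b\<^esub> cls b (V_mod (of_int p) lam)"
proof -
  let ?M = "cyclic_mod g g' (of_int p) lam" and ?h = "\<lambda>n. fst (prod_decode n)"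
  note M = cyclic_mod_objects[OF assms]
  have h: "?h k \<le> ?h n" if "k \<in> Poly_Mapping.keys (Eact ?M i n)" for i n k
  proof (cases n rule: prod_encode_cases)
    case (1 m j)
    show ?thesis
    proof (cases i)
      case N1
      have "k = prod_encode (m, j - 1) \<or> k = prod_encode (m - 1, j)"
        using that subsetD[OF Poly_Mapping.keys_add] unfolding 1 N1 cyclic_mod_simps
        by (metis Un_iff empty_iff keys_single singletonD)
      then show ?thesis using 1 by auto
    qed (use that 1 in \<open>auto split: if_splits\<close>)
  qed
  \<comment> \<open>The height \<open>m\<close> of a vector in the graded module equals the index of
    the summand that contains it, so \<open>m\<close> occurs twice in its label.\<close>
  have graded: "n \<in> basis (graded ?M ?h) \<longleftrightarrow> (\<exists>m j. n = prod_encode (m, prod_encode (m, j)))" for n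
  proof (cases n rule: prod_encode_cases)
    case (1 k l)
    then show ?thesis
      by (cases l rule: prod_encode_cases) (auto simp: graded_def filtration_sum_def)
  qed
  define \<phi> where "\<phi> n = (case prod_decode n of (m, l) \<Rightarrow> case prod_decode l of (m', j) \<Rightarrow> prod_encode (prod_encode (m, 0), j))" for n
  have [simp]: "\<phi> (prod_encode (m, prod_encode (m', j))) = prod_encode (prod_encode (m, 0), j)" for m m' j
    by (simp add: \<phi>_def)
  have sgn: "psgn (U_sum p) (prod_encode (m, 0)) = (- 1) ^ m" for m by (simp add: psgn_def)
  have "short_exact (graded ?M ?h) (tensor (U_sum p) (V_mod (of_int p) lam)) zero_bmodule"
  proof (rule short_exact_relabel[of \<phi>])
    show "bij_betw \<phi> (basis (graded ?M ?h)) (basis (tensor (U_sum p) (V_mod (of_int p) lam)))"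
    proof (rule bij_betw_imageI)
      show "inj_on \<phi> (basis (graded ?M ?h))"
      proof (rule inj_onI)
        fix x y assume "x \<in> basis (graded ?M ?h)" "y \<in> basis (graded ?M ?h)" and eq: "\<phi> x = \<phi> y"
        then obtain m j m' j' where "x = prod_encode (m, prod_encode (m, j))" "y = prod_encode (m', prod_encode (m', j'))"
          unfolding graded by blast
        with eq show "x = y" by simp
      qed
      show "\<phi> ` basis (graded ?M ?h) = basis (tensor (U_sum p) (V_mod (of_int p) lam))"
      proof (intro equalityI subsetI)
        fix n assume "n \<in> basis (tensor (U_sum p) (V_mod (of_int p) lam))"
        then obtain m j where "n = prod_encode (prod_encode (m, 0), j)"
          unfolding tensor_simps basis_U_sum by blast
        then have "n = \<phi> (prod_encode (m, prod_encode (m, j)))" by simp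
        moreover have "prod_encode (m, prod_encode (m, j)) \<in> basis (graded ?M ?h)"
          unfolding graded by blast
        ultimately show "n \<in> \<phi> ` basis (graded ?M ?h)" by blast
      next
        fix n assume "n \<in> \<phi> ` basis (graded ?M ?h)"
        then obtain m j where "n = \<phi> (prod_encode (m, prod_encode (m, j)))"
          unfolding image_iff Bex_def graded by blast
        then show "n \<in> basis (tensor (U_sum p) (V_mod (of_int p) lam))"
          by (simp add: basis_U_sum V_simps)
      qed
    qed
    fix i n assume "n \<in> basis (graded ?M ?h)"
    then obtain m j where n: "n = prod_encode (m, prod_encode (m, j))" unfolding graded by blast
    show "odd_vec (tensor (U_sum p) (V_mod (of_int p) lam)) (\<phi> n) = odd_vec (graded ?M ?h) n"
      by (auto simp: n graded_def filtration_sum_def rho_tensor_simps V_simps)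
    show "Kev (tensor (U_sum p) (V_mod (of_int p) lam)) i (\<phi> n) = Kev (graded ?M ?h) i n"
      by (cases i) (simp_all add: n graded_def filtration_sum_def rho_tensor_simps V_simps qpow_minus distrib_left power_add)
    have E: "Eact (graded ?M ?h) i n = tvec (bvec m) (restr {n. m \<le> ?h n} (Eact ?M i (prod_encode (m, j))))"
      by (simp add: n graded_def filtration_sum_def Collect_neg_eq[symmetric] not_less)
    show "lin (\<lambda>n. bvec (\<phi> n)) (Eact (graded ?M ?h) i n) = Eact (tensor (U_sum p) (V_mod (of_int p) lam)) i (\<phi> n)"
    proof (cases i)
      case N0
      then show ?thesis unfolding E by (simp add: n restr_single tvec_single V_simps sgn)
    next
      case N1
      \<comment> \<open>The term lowering \<open>m\<close> dies in the graded module. For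
        \<open>m = 0\<close> truncated subtraction would keep it in the layer, but its coefficient
        contains \<open>osc qi 0 = 0\<close>.\<close>
      have "restr {n. m \<le> ?h n} (Eact ?M i (prod_encode (m, j))) =
          Poly_Mapping.single (prod_encode (m, j - 1)) ((- 1) ^ m * lam * (qnum bs (of_nat j) * qnum bs (of_int p - of_nat j + 1)))"
        unfolding N1 cyclic_mod_simps restr_add restr_single by (cases m) simp_all
      then show ?thesis unfolding E by (simp add: n N1 tvec_single V_simps sgn mult_ac)
    qed
  qed
  then have "cls b (graded ?M ?h) = cls b (tensor (U_sum p) (V_mod (of_int p) lam))"
    by (rule cls_iso) (use cls_graded(1)[OF M h] in \<open>simp_all add: tensor_objects V_objects\<close>)
  then show ?thesis
    using cls_graded(2)[OF M h] cls_cyclic_mod[OF assms] by (simp add: cls_tensor V_objects)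
qed

section \<open>The relation for \<open>W\<^sub>s\<close>\<close>

text \<open>The coefficient of E_1 vanishes at label \<open>s + 1\<close>, so the labels from there
  on span a submodule. Its \<open>q\<close>-numbers agree with those of highest weight exponent
  \<open>- s - 2\<close>, and the labels up to \<open>s\<close> form the quotient.\<close>

lemma cls_V_mod:
  "cls b (V_mod (of_nat s) \<mu>) =
     cls b (U (odd (s + 1)) 0) \<otimes>\<^bsub>groth b\<^esub> cls b (V_mod (- of_nat s - 2) \<mu>) \<oplus>\<^bsub>groth b\<^esub> cls b (W_mod bs s \<mu>)"
proof -
  let ?V = "V_mod (of_nat s) \<mu>" and ?L = "tensor (U (odd (s + 1)) 0) (V_mod (- of_nat s - 2) \<mu>)" and ?S = "{Suc s..}"
  have S: "closed_under ?V ?S"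
    unfolding closed_under_def
  proof (intro allI ballI)
    fix i n assume "n \<in> basis ?V \<inter> ?S"
    then have n: "Suc s \<le> n" by simp
    \<comment> \<open>Only \<open>n = s + 1\<close> could leave the set downwards; its coefficient
      contains the \<open>q\<close>-number of \<open>s - (s + 1) + 1 = 0\<close>.\<close>
    show "Poly_Mapping.keys (Eact ?V i n) \<subseteq> ?S"
      using n by (cases i; cases "n = Suc s") (auto simp: V_simps)
  qed
  note obj = sub_mod_objects[OF V_objects S] quo_mod_objects[OF V_objects S]
  have L: "?L \<in> objects b" by (intro tensor_objects V_objects) simp
  define e :: complex where "e = (- 1) ^ Suc s"
  have e: "e * e = 1" "(if even s then - 1 else 1) = e" by (simp_all add: e_def flip: power_add)
  have e_cancel: "e * (e * x) = x" for x using e(1) by (simp flip: mult.assoc)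
  have 1: "cls b ?L = cls b (sub_mod ?V ?S)"
  proof (rule cls_iso[OF _ L obj(1)])
    define \<phi> where "\<phi> n = snd (prod_decode n) + Suc s" for n
    have [simp]: "\<phi> (prod_encode (k, i)) = i + Suc s" for k i by (simp add: \<phi>_def)
    \<comment> \<open>The left factor of parity \<open>s + 1\<close> gives each generator the sign
      \<open>e\<close>; rescaling the \<open>j\<close>-th vector by \<open>e ^ j\<close> removes
      it.\<close>
    define c where "c n = e ^ snd (prod_decode n)" for n
    have [simp]: "c (prod_encode (k, i)) = e ^ i" for k i by (simp add: c_def)
    have sgn: "psgn (U (even s) 0) 0 = e" by (simp add: psgn_def e_def)
    show "short_exact ?L (sub_mod ?V ?S) zero_bmodule"
    proof (rule short_exact_monomial[of \<phi> _ _ c])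
      show "bij_betw \<phi> (basis ?L) (basis (sub_mod ?V ?S))"
      proof (rule bij_betw_imageI)
        show "\<phi> ` basis ?L = basis (sub_mod ?V ?S)"
        proof (intro equalityI subsetI)
          fix n assume "n \<in> basis (sub_mod ?V ?S)"
          then have "n = \<phi> (prod_encode (0, n - Suc s))" by simp
          then show "n \<in> \<phi> ` basis ?L" by (rule image_eqI) (simp add: V_simps)
        qed (auto simp: V_simps)
      qed (auto simp: inj_on_def)
      fix n assume "n \<in> basis ?L"
      then obtain j where n: "n = prod_encode (0, j)" by auto
      show "c n \<noteq> 0" by (simp add: n e_def)
      show "odd_vec (sub_mod ?V ?S) (\<phi> n) = odd_vec ?L n"
        by (auto simp: n V_simps)
      fix i
      \<comment> \<open>The sign in q_*^(2(s+1)) is again \<open>e\<close>; it cancels the sign of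
        the Cartan generators on the power of sigma.\<close>
      have k: "qpow bs (2 * of_nat (Suc s)) = e * q ^ (2 * Suc s)" "qpow bs (- (2 * of_nat (Suc s))) = e * qi ^ (2 * Suc s)"
        unfolding qpow_bs_even e_def by simp_all
      show "Kev (sub_mod ?V ?S) i (\<phi> n) = Kev ?L i n"
      proof (cases i)
        case N0
        have "qpow bs (- (- of_nat s - 2)) = qpow bs (- of_nat s + 2 * of_nat (Suc s))"
          by (rule arg_cong[where f = "qpow bs"]) (simp add: algebra_simps)
        also have "\<dots> = qpow bs (- of_nat s) * (e * q ^ (2 * Suc s))" unfolding qpow_add k ..
        finally have "e * qpow bs (- (- of_nat s - 2)) = (e * e) * (qpow bs (- of_nat s) * q ^ (2 * Suc s))" by (simp only: mult_ac)
        then show ?thesis using N0 by (simp add: n V_simps e power_add mult_ac)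
      next
        case N1
        have "qpow bs (- of_nat s - 2) = qpow bs (of_nat s + - (2 * of_nat (Suc s)))"
          by (rule arg_cong[where f = "qpow bs"]) (simp add: algebra_simps)
        also have "\<dots> = qpow bs (of_nat s) * (e * qi ^ (2 * Suc s))" unfolding qpow_add k ..
        finally have "e * qpow bs (- of_nat s - 2) = (e * e) * (qpow bs (of_nat s) * qi ^ (2 * Suc s))" by (simp only: mult_ac)
        then show ?thesis using N1 by (simp add: n V_simps e power_add mult_ac)
      qed
      show "lin (\<lambda>n. smul (c n) (bvec (\<phi> n))) (Eact ?L i n) = smul (c n) (Eact (sub_mod ?V ?S) i (\<phi> n))"
      proof (cases i)
        case N0
        then show ?thesis by (simp add: n V_simps tvec_single sgn e_cancel mult_ac)
      next
        case N1
        show ?thesis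
        proof (cases j)
          case 0
          then show ?thesis using N1 by (simp add: n V_simps tvec_single sgn)
        next
          case (Suc k)
          \<comment> \<open>Both products of \<open>q\<close>-numbers are
            \<open>- [j] [j + s + 1]\<close>, by oddness of \<open>qnum\<close>.\<close>
          have "- of_nat s - 2 - of_nat j + 1 = - (of_nat (j + Suc s) :: complex)"
            "of_nat s - of_nat (j + Suc s) + 1 = - (of_nat j :: complex)"
            by simp_all
          then have "qnum bs (of_nat j) * qnum bs (- of_nat s - 2 - of_nat j + 1) =
            qnum bs (of_nat (j + Suc s)) * qnum bs (of_nat s - of_nat (j + Suc s) + 1)"
            by (simp only: qnum_minus mult_minus_right mult_minus_left mult.commute)
          then show ?thesis using N1
            by (simp add: n V_simps tvec_single sgn Suc del: of_nat_Suc of_nat_add) (simp add: mult_ac)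
        qed
      qed
    qed
  qed
  have 2: "cls b (quo_mod ?V ?S) = cls b (W_mod bs s \<mu>)"
  proof (rule cls_iso[OF _ obj(2) W_objects])
    \<comment> \<open>These products convert the constant shift of \<open>V_mod\<close> into the
      coefficients \<open>[s - k]\<close> of \<open>W_mod\<close>. They are nonzero for
      \<open>k \<le> s\<close>; the factor \<open>[0]\<close> would enter only at
      \<open>k = s + 1\<close>.\<close>
    define c where "c k = (\<Prod>i<k. qnum bs (of_nat s - of_nat i))" for k
    show "short_exact (quo_mod ?V ?S) (W_mod bs s \<mu>) zero_bmodule"
    proof (rule short_exact_monomial[of "\<lambda>n. n" _ _ c])
      have B: "basis (quo_mod ?V ?S) = {0..s}" by (auto simp: V_simps)
      show "bij_betw (\<lambda>n. n) (basis (quo_mod ?V ?S)) (basis (W_mod bs s \<mu>))"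
        unfolding B by (simp add: W_mod_def bij_betw_def)
      fix n assume "n \<in> basis (quo_mod ?V ?S)"
      then have n: "n \<le> s" unfolding B by simp
      show "c n \<noteq> 0"
        unfolding c_def
      proof (subst prod_zero_iff, simp, clarify)
        fix i assume "i < n" "qnum bs (of_nat s - of_nat i) = 0"
        with n qnum_nonzero[of "s - i"] show False by (simp add: of_nat_diff)
      qed
      show "odd_vec (W_mod bs s \<mu>) n = odd_vec (quo_mod ?V ?S) n"
        by (simp add: W_mod_def V_simps)
      fix i
      show "Kev (W_mod bs s \<mu>) i n = Kev (quo_mod ?V ?S) i n"
        by (cases i) (simp_all add: W_mod_def V_simps sign_Kev)
      show "lin (\<lambda>n. smul (c n) (bvec n)) (Eact (quo_mod ?V ?S) i n) = smul (c n) (Eact (W_mod bs s \<mu>) i n)"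
      proof (cases i)
        case N0
        then show ?thesis using n
          by (cases "n = s") (simp_all add: W_mod_def V_simps restr_single c_def mult_ac)
      next
        case N1
        then show ?thesis using n
          by (cases n) (simp_all add: W_mod_def V_simps restr_single c_def mult_ac)
      qed
    qed
  qed
  have "cls b ?V = cls b (sub_mod ?V ?S) \<oplus>\<^bsub>groth b\<^esub> cls b (quo_mod ?V ?S)"
    by (rule cls_sub_quo[OF V_objects S])
  then show ?thesis unfolding 2 1[symmetric] by (simp add: cls_tensor V_objects)
qed


text \<open>Both products in the final relation are instances: \<open>p = s\<close> gives the
  exponent \<open>(s + 1) / 2\<close>, and \<open>p = - s - 2\<close> gives its negative, that is,
  interchanged shifts. \<open>qpow\<close> selects the square root needed for
  \<open>cls_rho_tensor\<close>.\<close>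

lemma cls_rho:
  "cls b (rho_plus b (qpow bs ((of_int p + 1) / 2) * lam)) \<otimes>\<^bsub>groth b\<^esub> cls b (rho_minus b (qpow bs (- ((of_int p + 1) / 2)) * lam))
     = cls b (U_sum p) \<otimes>\<^bsub>groth b\<^esub> cls b (V_mod (of_int p) lam)"
proof -
  let ?x = "(of_int p + 1) / 2 :: complex"
  have half: "?x + ?x = of_int p + 1" by (simp flip: mult_2)
  have "(qpow bs ?x)\<^sup>2 = qpow bs (of_int p + 1)" "(qpow bs (- ?x))\<^sup>2 = qpow bs (- (of_int p + 1))"
    by (simp_all only: power2_eq_square qpow_add[symmetric] minus_add_distrib[symmetric] half)
  from cls_rho_tensor[OF this, of lam] show ?thesis
    by (simp add: rho_tensor_def cls_tensor rho_plus_objects rho_minus_objects)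
qed

lemma cls_W_0: "\<one>\<^bsub>groth b\<^esub> = cls b (W_mod bs 0 \<mu>)"
proof -
  have "short_exact (W_mod bs 0 \<mu>) (U False 0) zero_bmodule"
    by (rule short_exact_diagonal[of "\<lambda>_. 0"])
       (auto simp: W_mod_def bij_betw_def split: node.split)
  from cls_iso[OF this] show ?thesis by (simp add: one_eq_cls[of bs] W_objects)
qed

section \<open>Invertibility of the series and the final relation\<close>

lemma f_series_eq: "f_series b bs p = cls b (U_sum p)"
  by (simp add: f_series_def U_sum_def)

lemma sigma_eq: "sigma b bs = cls b (U True 0)"
  by (simp add: sigma_def)

lemma sigma_pow: "sigma b bs [^]\<^bsub>groth b\<^esub> (m :: nat) = cls b (U (odd m) 0)"
proof (induction m)
  case 0
  then show ?case by (simp add: one_eq_cls[of bs])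
next
  case (Suc m)
  then show ?case by (simp add: sigma_eq cls_U_mult)
qed

text \<open>The two shift identities say that the series for \<open>p = 0\<close> is a two-sided
  inverse of \<open>1 - sigma [U_{-2}]\<close>. Every other series is this one multiplied by the
  unit \<open>[U_{-p}]\<close>.\<close>

lemma f_series_unit:
  fixes R (structure)
  defines "R \<equiv> groth b"
  shows "\<one> \<ominus> sigma b bs \<otimes> cls b (U False (- 2)) \<in> Units R"
    and "f_series b bs p = cls b (U False (- p)) \<otimes> inv (\<one> \<ominus> sigma b bs \<otimes> cls b (U False (- 2)))"
    and "f_series b bs p \<in> Units R"
proof -
  interpret ring R unfolding R_def by (rule ring_groth)
  define x where "x = cls b (U True (- 2))"
  define f where "f = cls b (U_sum 0)"
  have car: "x \<in> carrier R" "f \<in> carrier R" by (simp_all add: R_def x_def f_def)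
  have x: "sigma b bs \<otimes> cls b (U False (- 2)) = x"
    by (simp add: R_def x_def sigma_eq cls_U_mult)
  have "f = x \<otimes> f \<oplus> \<one>" "f = f \<otimes> x \<oplus> \<one>"
    using cls_U_sum_shift[of 0] by (simp_all add: R_def x_def f_def one_eq_cls[of bs])
  then have "f \<ominus> x \<otimes> f = \<one>" "f \<ominus> f \<otimes> x = \<one>"
    using car by (metis a_minus_def add.inv_solve_right' a_comm m_closed one_closed a_inv_closed add.m_assoc)+
  then have 1: "(\<one> \<ominus> x) \<otimes> f = \<one>" "f \<otimes> (\<one> \<ominus> x) = \<one>"
    using car by (simp_all add: a_minus_def l_distr r_distr l_minus r_minus)
  have car': "\<one> \<ominus> x \<in> carrier R" using car by simp
  have u: "\<one> \<ominus> x \<in> Units R" unfolding Units_def using 1 car car' by blast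
  then show "\<one> \<ominus> sigma b bs \<otimes> cls b (U False (- 2)) \<in> Units R" unfolding x .
  have inv: "inv (\<one> \<ominus> x) = f" using inv_char[OF car' car(2)] 1 by blast
  have fp: "f_series b bs p = cls b (U False (- p)) \<otimes> f"
    using cls_U_U_sum[of "- p" 0] by (simp add: R_def f_def f_series_eq)
  then show "f_series b bs p = cls b (U False (- p)) \<otimes> inv (\<one> \<ominus> sigma b bs \<otimes> cls b (U False (- 2)))"
    unfolding x inv .
  have "cls b (U False (- p)) \<otimes> cls b (U False p) = \<one>" "cls b (U False p) \<otimes> cls b (U False (- p)) = \<one>"
    by (simp_all add: R_def cls_U_mult one_eq_cls[of bs])
  then have "cls b (U False (- p)) \<in> Units R"
    unfolding Units_def using cls_closed[OF U_objects] by (auto simp: R_def)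
  moreover have "f \<in> Units R" unfolding Units_def using 1 car car' by blast
  ultimately show "f_series b bs p \<in> Units R" unfolding fp by (rule Units_m_closed)
qed

text \<open>Cancelling the series in the two instances of \<open>cls_rho\<close> isolates the
  classes of \<open>V_s\<close> and \<open>V_{-s-2}\<close>; in the second, the power of sigma
  stands between the inverse and the product and is first moved past the series. The difference is
  then given by \<open>cls_V_mod\<close>.\<close>

lemma cls_W_mod:
  fixes R (structure)
  defines "R \<equiv> groth b"
  shows "cls b (W_mod bs s lam) =
     inv (f_series b bs (int s)) \<otimes> cls b (rho_plus b (qpow bs (of_nat s / 2 + 1 / 2) * lam))
                          \<otimes> cls b (rho_minus b (qpow bs (- of_nat s / 2 - 1 / 2) * lam))
     \<ominus> inv (f_series b bs (- int s - 2)) \<otimes> sigma b bs [^] (s + 1)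
                          \<otimes> cls b (rho_plus b (qpow bs (- of_nat s / 2 - 1 / 2) * lam))
                          \<otimes> cls b (rho_minus b (qpow bs (of_nat s / 2 + 1 / 2) * lam))"
proof -
  interpret ring R unfolding R_def by (rule ring_groth)
  define f h where "f = f_series b bs (int s)" and "h = f_series b bs (- int s - 2)"
  define e where "e = cls b (U (odd (s + 1)) 0)"
  define V V' W where "V = cls b (V_mod (of_nat s) lam)" and "V' = cls b (V_mod (- of_nat s - 2) lam)"
    and "W = cls b (W_mod bs s lam)"
  define A B where "A = cls b (rho_plus b (qpow bs (of_nat s / 2 + 1 / 2) * lam))"
    and "B = cls b (rho_minus b (qpow bs (- of_nat s / 2 - 1 / 2) * lam))"
  define C D where "C = cls b (rho_plus b (qpow bs (- of_nat s / 2 - 1 / 2) * lam))"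
    and "D = cls b (rho_minus b (qpow bs (of_nat s / 2 + 1 / 2) * lam))"
  have car [simp]: "e \<in> carrier R" "V \<in> carrier R" "V' \<in> carrier R" "W \<in> carrier R"
    "A \<in> carrier R" "B \<in> carrier R" "C \<in> carrier R" "D \<in> carrier R"
    by (simp_all add: R_def e_def V_def V'_def W_def A_def B_def C_def D_def
        V_objects W_objects rho_plus_objects rho_minus_objects del: odd_Suc_minus_one)
  have f: "f \<in> Units R" and h: "h \<in> Units R"
    unfolding f_def h_def R_def by (rule f_series_unit)+
  then have [simp]: "f \<in> carrier R" "h \<in> carrier R" "inv f \<in> carrier R" "inv h \<in> carrier R"
    by (simp_all add: Units_closed)
  have AB: "A \<otimes> B = f \<otimes> V"
    using cls_rho[of "int s" lam]
    by (simp add: A_def B_def f_def V_def R_def f_series_eq add_divide_distrib)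
  have CD: "C \<otimes> D = h \<otimes> V'"
  proof -
    have e: "(of_int (- int s - 2) + 1) / 2 = (- of_nat s / 2 - 1 / 2 :: complex)"
      "- (- of_nat s / 2 - 1 / 2) = (of_nat s / 2 + 1 / 2 :: complex)"
      by (simp_all add: field_simps)
    show ?thesis
      using cls_rho[of "- int s - 2" lam] unfolding e
      by (simp add: C_def D_def h_def V'_def R_def f_series_eq)
  qed
  have eh: "e \<otimes> h = h \<otimes> e"
  proof (cases "odd (s + 1)")
    case True
    then show ?thesis using cls_sigma_U_sum by (simp add: e_def h_def R_def f_series_eq)
  next
    case False
    then have "e = \<one>" by (simp add: e_def R_def one_eq_cls[of bs])
    then show ?thesis by simp
  qed
  have V: "V = e \<otimes> V' \<oplus> W"
    using cls_V_mod[of s lam] by (simp only: V_def e_def V'_def W_def R_def)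
  have "inv f \<otimes> A \<otimes> B = V"
    using f AB by (simp add: m_assoc) (simp flip: m_assoc)
  moreover have "inv h \<otimes> e \<otimes> C \<otimes> D = e \<otimes> V'"
  proof -
    have "inv h \<otimes> e \<otimes> C \<otimes> D = inv h \<otimes> (e \<otimes> h) \<otimes> V'" using CD by (simp add: m_assoc)
    also have "\<dots> = (inv h \<otimes> h) \<otimes> (e \<otimes> V')" unfolding eh by (simp add: m_assoc)
    finally show ?thesis using h by simp
  qed
  moreover have "V \<ominus> e \<otimes> V' = W"
    unfolding V a_minus_def using a_assoc[of W "e \<otimes> V'" "\<ominus> (e \<otimes> V')"] by (simp add: a_comm r_neg)
  ultimately have "W = inv f \<otimes> A \<otimes> B \<ominus> inv h \<otimes> e \<otimes> C \<otimes> D" by simp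
  then show ?thesis
    unfolding f_def h_def A_def B_def C_def D_def W_def e_def R_def sigma_pow .
qed

end

theorem mainTheorem5:
  fixes b bs lam :: complex and s :: nat and R (structure)
  assumes star: "b\<^sup>2 = bs\<^sup>2 + 1 / 2"
    and generic: "\<And>n::nat. n > 0 \<Longrightarrow> qpow b 1 ^ n \<noteq> 1"
    and R: "R = groth b"
  shows
    "ring R \<and>
     (\<forall>\<mu>. rho_plus b \<mu> \<in> objects b \<and> rho_minus b \<mu> \<in> objects b \<and> W_mod bs s \<mu> \<in> objects b) \<and>
     (\<forall>p. U_mod bs False p \<in> objects b \<and> U_mod bs True p \<in> objects b) \<and>
     (\<forall>p. direct_sum (\<lambda>m. U_mod bs (odd m) (- p - 2 * int m)) \<in> objects b \<and>
        (\<forall>m. cls b (U_mod bs (odd m) (- p - 2 * int m)) =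
               sigma b bs [^] m \<otimes> cls b (U_mod bs False (- p - 2 * int m))) \<and>
        \<one> \<ominus> sigma b bs \<otimes> cls b (U_mod bs False (- 2)) \<in> Units R \<and>
        f_series b bs p = cls b (U_mod bs False (- p)) \<otimes>
                     inv (\<one> \<ominus> sigma b bs \<otimes> cls b (U_mod bs False (- 2))) \<and>
        f_series b bs p \<in> Units R) \<and>
     cls b (W_mod bs s lam) =
       inv (f_series b bs (int s)) \<otimes> cls b (rho_plus b (qpow bs (of_nat s / 2 + 1 / 2) * lam))
                            \<otimes> cls b (rho_minus b (qpow bs (- of_nat s / 2 - 1 / 2) * lam))
       \<ominus> inv (f_series b bs (- int s - 2)) \<otimes> sigma b bs [^] (s + 1)
                            \<otimes> cls b (rho_plus b (qpow bs (- of_nat s / 2 - 1 / 2) * lam))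
                            \<otimes> cls b (rho_minus b (qpow bs (of_nat s / 2 + 1 / 2) * lam)) \<and>
     \<one> = cls b (W_mod bs 0 lam) \<and>
     \<one> = inv (f_series b bs 0) \<otimes> cls b (rho_plus b (qpow bs (1 / 2) * lam))
                        \<otimes> cls b (rho_minus b (qpow bs (- 1 / 2) * lam))
         \<ominus> inv (f_series b bs (- 2)) \<otimes> sigma b bs
                        \<otimes> cls b (rho_plus b (qpow bs (- 1 / 2) * lam))
                        \<otimes> cls b (rho_minus b (qpow bs (1 / 2) * lam))"
proof -
  interpret star_parameter b bs
    by standard (use star generic in auto)
  interpret ring R unfolding R by (rule ring_groth)
  have "sigma b bs \<in> carrier R" by (simp add: R sigma_eq)
  then have p1: "sigma b bs [^] (0 + 1 :: nat) = sigma b bs" by simp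
  have W0: "\<one> = inv (f_series b bs 0) \<otimes> cls b (rho_plus b (qpow bs (1 / 2) * lam))
                        \<otimes> cls b (rho_minus b (qpow bs (- 1 / 2) * lam))
         \<ominus> inv (f_series b bs (- 2)) \<otimes> sigma b bs
                        \<otimes> cls b (rho_plus b (qpow bs (- 1 / 2) * lam))
                        \<otimes> cls b (rho_minus b (qpow bs (1 / 2) * lam))"
    using cls_W_mod[of 0 lam, folded R, unfolded p1] by (simp add: cls_W_0[of lam, folded R, symmetric])
  have pow: "cls b (U_mod bs (odd m) p) = sigma b bs [^] m \<otimes> cls b (U_mod bs False p)" for m :: nat and p
    using cls_U_mult[of "odd m" 0 False p] by (simp add: R sigma_pow)
  show ?thesis
    using ring_groth rho_plus_objects rho_minus_objects W_objects U_objects U_sum_objects pow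
      f_series_unit cls_W_mod[of s lam] cls_W_0[of lam] W0
    unfolding R U_sum_def by blast
qed

end
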